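(* Let $\kappa\in(0,1)$ be a constant and consider the two-dimensional system $$\dot{I}=\epsilon\biggl(\frac{\sin\theta}{1-\kappa\cos\theta}+1\biggr),\qquad \dot{\theta}=I,\qquad (I,\theta)\in\mathbb{R}\times\mathbb{S}^1,$$ where $\epsilon$ is a small parameter. Let $I\in\mathbb{R}$ with $I\neq0$, let $\theta\in\mathbb{S}^1$, and put $\omega^\ast=I$, $T^\ast=2\pi/I$ and $$\tau^\ast=-\frac{\theta}{I}+\frac{i}{I}\operatorname{arccosh}\Bigl(\frac1\kappa\Bigr).$$ Let $\Gamma$ be a domain in $\mathbb{C}/T^\ast\mathbb{Z}$ containing $\mathbb{R}/T^\ast\mathbb{Z}$ and $\tau=\tau^\ast$. Then the system is not meromorphically integrable in the Bogoyavlenskij sense near the periodic orbit $$\{(I,\omega^\ast\tau+\theta)\mid\tau\in\Gamma\}$$ of the system with $\epsilon=0$, in such a way that the first integrals and commutative vector fields also depend meromorphically on $\epsilon$ near $\epsilon=0$.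
   Context: $\mathbb{S}^1=\mathbb{R}/2\pi\mathbb{Z}$. Time and the state variables are complexified, the state space becoming $\mathbb{C}\times(\mathbb{C}/2\pi\mathbb{Z})$; in particular first integrals and vector fields are required to be (single-valued) on subsets of $\mathbb{C}\times(\mathbb{C}/2\pi\mathbb{Z})$. Bogoyavlenskij integrability: an $N$-dimensional system $\dot y=f(y)$ is $(q,N-q)$-integrable, or simply integrable, if there are $q$ vector fields $f_1:=f,f_2,\dots,f_q$ and $N-q$ scalar functions $F_1,\dots,F_{N-q}$ such that (i) $f_1,\dots,f_q$ are linearly independent almost everywhere and commute, $[f_j,f_k]=\mathrm{D}f_k\,f_j-\mathrm{D}f_j\,f_k\equiv0$; (ii) $\mathrm{D}F_1,\dots,\mathrm{D}F_{N-q}$ are linearly independent almost everywhere and $\mathrm{D}F_k\cdot f_j\equiv0$ for all $j,k$. It is meromorphically integrable if the $f_j$ and $F_k$ are meromorphic. For a family $\dot y=f(y;\epsilon)$, "not meromorphically integrable near an orbit $\mathcal{O}$ such that the first integrals and commutative vector fields also depend meromorphically on $\epsilon$ near $\epsilon=0$" means: for no $q\in\{1,\dots,N\}$ and no neighborhood of $\mathcal{O}\times\{\epsilon=0\}$ in the complexified (state, parameter) space do there exist $f_1=f(\cdot;\epsilon),f_2,\dots,f_q$ and $F_1,\dots,F_{N-q}$, meromorphic in $(y,\epsilon)$ on that neighborhood, satisfying (i) and (ii) (brackets and derivatives taken in $y$, identities holding identically in $(y,\epsilon)$, independence almost everywhere). Here $N=2$, $y=(I,\theta)$. *)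

theory Defs
  imports "HOL-Analysis.Analysis"
begin

text \<open>
  A quotient of a vector space by a group of translations \<open>L\<close> is handled through
  the covering: subsets of the quotient are \<open>L\<close>-invariant subsets, and functions
  on them are \<open>L\<close>-periodic functions.  The topology below has exactly the
  preimages of the open sets of the quotient as its open sets, so that
  \<^const>\<open>openin\<close> and \<^const>\<open>connectedin\<close>, applied to an invariant set, express
  openness and connectedness of its image in the quotient.
\<close>

definition quotient_topology :: "'a::{topological_space,plus} set \<Rightarrow> 'a topology" where
  "quotient_topology L = topology (\<lambda>U. open U \<and> (\<forall>p\<in>U. \<forall>l\<in>L. p + l \<in> U))"

lemma openin_quotient_topology:
  "openin (quotient_topology L) U \<longleftrightarrow> open U \<and> (\<forall>p\<in>U. \<forall>l\<in>L. p + l \<in> U)"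
proof -
  have "istopology (\<lambda>U. open U \<and> (\<forall>p\<in>U. \<forall>l\<in>L. p + l \<in> U))"
    unfolding istopology_def by blast
  then show ?thesis
    by (simp add: quotient_topology_def)
qed

lemma topspace_quotient_topology [simp]: "topspace (quotient_topology L) = UNIV"
proof -
  have "openin (quotient_topology L) UNIV"
    by (simp add: openin_quotient_topology)
  then show ?thesis
    using openin_subset by blast
qed

text \<open>
  Points are pairs \<open>(y, \<epsilon>)\<close> of a state \<open>y\<close> in complex \<open>N\<close>-space, \<open>N = CARD('n)\<close>,
  and a complex parameter \<open>\<epsilon>\<close>; holomorphy and meromorphy are joint in \<open>(y, \<epsilon>)\<close>.
\<close>

definition complex_differentiable_at ::
    "((complex^'n) \<times> complex \<Rightarrow> complex) \<Rightarrow> (complex^'n) \<times> complex \<Rightarrow> bool" where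
  "complex_differentiable_at g p \<longleftrightarrow>
     (\<exists>D. (g has_derivative D) (at p) \<and> (\<forall>c v e. D (c *s v, c * e) = c * D (v, e)))"

definition holomorphic_near ::
    "((complex^'n) \<times> complex \<Rightarrow> complex) \<Rightarrow> (complex^'n) \<times> complex \<Rightarrow> bool" where
  "holomorphic_near g p \<longleftrightarrow>
     (\<exists>V. open V \<and> p \<in> V \<and> (\<forall>x\<in>V. complex_differentiable_at g x))"

text \<open>
  A meromorphic function is locally a quotient of holomorphic functions.  It is
  represented by a total function, whose values on the zero set of the local
  denominators are arbitrary.
\<close>

definition meromorphic_in ::
    "((complex^'n) \<times> complex \<Rightarrow> complex) \<Rightarrow> ((complex^'n) \<times> complex) set \<Rightarrow> bool" where
  "meromorphic_in F U \<longleftrightarrow>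
     (\<forall>p\<in>U. \<exists>V g h. open V \<and> connected V \<and> p \<in> V \<and>
        (\<forall>x\<in>V. complex_differentiable_at g x \<and> complex_differentiable_at h x) \<and>
        (\<exists>x\<in>V. h x \<noteq> 0) \<and> (\<forall>x\<in>V. h x \<noteq> 0 \<longrightarrow> F x = g x / h x))"

definition partial_deriv ::
    "'n \<Rightarrow> ((complex^'n) \<times> complex \<Rightarrow> complex) \<Rightarrow> (complex^'n) \<times> complex \<Rightarrow> complex" where
  "partial_deriv i F p = deriv (\<lambda>z. F (fst p + axis i z, snd p)) 0"

definition state_gradient ::
    "((complex^'n) \<times> complex \<Rightarrow> complex) \<Rightarrow> (complex^'n) \<times> complex \<Rightarrow> complex^'n" where
  "state_gradient F p = (\<chi> i. partial_deriv i F p)"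

text \<open>The directional derivative \<open>DF \<cdot> v\<close>; no complex conjugation is involved.\<close>

definition lie_deriv ::
    "((complex^'n) \<times> complex \<Rightarrow> complex^'n) \<Rightarrow> ((complex^'n) \<times> complex \<Rightarrow> complex) \<Rightarrow>
     (complex^'n) \<times> complex \<Rightarrow> complex" where
  "lie_deriv v F p = (\<Sum>l\<in>UNIV. state_gradient F p $ l * v p $ l)"

definition lie_bracket ::
    "((complex^'n) \<times> complex \<Rightarrow> complex^'n) \<Rightarrow> ((complex^'n) \<times> complex \<Rightarrow> complex^'n) \<Rightarrow>
     (complex^'n) \<times> complex \<Rightarrow> complex^'n" where
  "lie_bracket v w p =
     (\<chi> i. lie_deriv v (\<lambda>x. w x $ i) p - lie_deriv w (\<lambda>x. v x $ i) p)"

definition independent_family :: "'i set \<Rightarrow> ('i \<Rightarrow> complex^'n) \<Rightarrow> bool" where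
  "independent_family J v \<longleftrightarrow>
     (\<forall>c. (\<Sum>j\<in>J. c j *s v j) = 0 \<longrightarrow> (\<forall>j\<in>J. c j = 0))"

text \<open>
  Identities between meromorphic functions are required at all points at which
  the functions involved are holomorphic.  The remaining points form a null set
  and thus do not affect independence almost everywhere either.
\<close>

definition bogoyavlenskij_integrable_in ::
    "nat \<Rightarrow> (complex^'n) set \<Rightarrow> ((complex^'n) \<times> complex \<Rightarrow> complex^'n) \<Rightarrow>
     ((complex^'n) \<times> complex) set \<Rightarrow> bool" where
  "bogoyavlenskij_integrable_in q L f U \<longleftrightarrow>
     (\<exists>(v :: nat \<Rightarrow> (complex^'n) \<times> complex \<Rightarrow> complex^'n)
       (F :: nat \<Rightarrow> (complex^'n) \<times> complex \<Rightarrow> complex).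
        (\<forall>p\<in>U. v 1 p = f p) \<and>
        (\<forall>j\<in>{1..q}. \<forall>i. meromorphic_in (\<lambda>p. v j p $ i) U) \<and>
        (\<forall>k\<in>{1..CARD('n) - q}. meromorphic_in (F k) U) \<and>
        (\<forall>j\<in>{1..q}. \<forall>p\<in>U. \<forall>l\<in>L. v j (fst p + l, snd p) = v j p) \<and>
        (\<forall>k\<in>{1..CARD('n) - q}. \<forall>p\<in>U. \<forall>l\<in>L. F k (fst p + l, snd p) = F k p) \<and>
        negligible {p\<in>U. \<not> independent_family {1..q} (\<lambda>j. v j p)} \<and>
        (\<forall>j\<in>{1..q}. \<forall>k\<in>{1..q}. \<forall>p\<in>U.
           (\<forall>i. holomorphic_near (\<lambda>x. v j x $ i) p \<and> holomorphic_near (\<lambda>x. v k x $ i) p)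
           \<longrightarrow> lie_bracket (v j) (v k) p = 0) \<and>
        negligible {p\<in>U. \<not> independent_family {1..CARD('n) - q} (\<lambda>k. state_gradient (F k) p)} \<and>
        (\<forall>j\<in>{1..q}. \<forall>k\<in>{1..CARD('n) - q}. \<forall>p\<in>U.
           holomorphic_near (F k) p \<and> (\<forall>i. holomorphic_near (\<lambda>x. v j x $ i) p)
           \<longrightarrow> lie_deriv (v j) (F k) p = 0))"

definition meromorphically_integrable_near ::
    "(complex^'n) set \<Rightarrow> ((complex^'n) \<times> complex \<Rightarrow> complex^'n) \<Rightarrow> (complex^'n) set \<Rightarrow> bool" where
  "meromorphically_integrable_near L f Orb \<longleftrightarrow>
     (\<exists>q\<in>{1..CARD('n)}. \<exists>U. openin (quotient_topology (L \<times> {0})) U \<and> Orb \<times> {0} \<subseteq> U \<and>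
        bogoyavlenskij_integrable_in q L f U)"

definition multiples :: "complex \<Rightarrow> complex set" where
  "multiples P = range (\<lambda>k::int. of_int k * P)"

text \<open>The translations defining the state space of pairs \<open>(I, \<theta>)\<close> with \<open>\<theta>\<close> modulo \<open>2\<pi>\<close>.\<close>

definition angle_periods :: "(complex^2) set" where
  "angle_periods = {vector [0, l] | l. l \<in> multiples (of_real (2 * pi))}"

definition forced_rotor :: "real \<Rightarrow> (complex^2) \<times> complex \<Rightarrow> complex^2" where
  "forced_rotor \<kappa> = (\<lambda>(y, \<epsilon>).
     vector [\<epsilon> * (sin (y $ 2) / (1 - of_real \<kappa> * cos (y $ 2)) + 1), y $ 1])"

end

(*
On the unperturbed torus the forcing has a simple pole at the complex angle c = i arcosh(1/kappa),
with nonzero residue.  Write X = eps h(theta) d/dI + I d/dtheta.  In I, theta, eps near an annulus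
around the pole, a solution Y of X Y = r(eps)/I^2 has a limit Y_0 at eps = 0 that satisfies
I dY_0/dtheta = r_0/I^2, and the next order is solvable only if the integral of h dY_0/dI around the
pole vanishes; this forces Y_0 = r_0 (theta - c)/I^3 + const.

With r = 0 and division by powers of eps this shows that a single-valued first integral depends on
eps alone, which excludes q = 1.  For q = 2 let (a, b) commute with X.  Then D = eps h b - I a is a
first integral, hence a function of eps, and X(b/(I D)) = -1/I^2.  Consequently, as eps tends to 0,
b/(I D) minus a function of eps alone tends to -(theta - c)/I^3 + const.  Being a statement about
leading coefficients of a meromorphic function, this convergence propagates along the connected
unperturbed orbit from c to c + 2 pi, where it contradicts the periodicity of b in theta.
*)
theory Submission
  imports Defs "HOL-Complex_Analysis.Complex_Analysis"
begin

subsection \<open>Holomorphic functions with parameters\<close>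

text \<open>X is divergence free, which makes the determinant D a first integral; and X(I) = eps h
  turns X b = a into X(b/I) = -D/I^2, so dividing by D leaves a known right-hand side. Centring the
  limit at c matters: the factor theta - c cancels the simple pole of h in the solvability integral,
  so only the derivative of the free function of I meets the residue, and it must vanish. Each
  coefficient below the critical order in eps is therefore a constant, removable by a function of
  eps alone, and the induction on orders can go on. Two obstacles shape the rest. Zeros of the local
  denominators may run through the pole itself, so the calculation takes place over a thin annulus
  around it and a small disc of I, where a power of eps is the only denominator left. Elsewhere on
  the orbit the limit may fail to exist where leading coefficients vanish, so what is propagated is
  validity on a dense open set, with the data u, p, m, k, C fixed once and for all.\<close>

lemma continuous_on_circle_integral:
  fixes f :: "'a::topological_space \<Rightarrow> complex \<Rightarrow> complex"
  assumes "0 \<le> r" and cont: "continuous_on (U \<times> sphere z r) (\<lambda>(u, w). f u w)"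
  shows "continuous_on U (\<lambda>u. contour_integral (circlepath z r) (f u))"
proof -
  let ?g = "\<lambda>u t. f u (circlepath z r t) * (2 * pi * \<i> * r * exp (2 * of_real pi * \<i> * t))"
  have "contour_integral (circlepath z r) (f u) = integral (cbox 0 1) (?g u)" for u
    unfolding contour_integral_integral
    unfolding cbox_interval
    by (intro integral_cong) (simp add: vector_derivative_circlepath)
  moreover have "continuous_on U (\<lambda>u. integral (cbox 0 1) (?g u))"
  proof (rule integral_continuous_on_param)
    have "continuous_on (U \<times> cbox 0 1) (\<lambda>p. (\<lambda>(u, w). f u w) (fst p, circlepath z r (snd p)))"
    proof (rule continuous_on_compose2[OF cont])
      show "continuous_on (U \<times> cbox 0 1) (\<lambda>p. (fst p, circlepath z r (snd p)))"
        unfolding circlepath_def part_circlepath_def linepath_def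
        by (intro continuous_intros)
      show "(\<lambda>p. (fst p, circlepath z r (snd p))) ` (U \<times> cbox 0 1) \<subseteq> U \<times> sphere z r"
        using path_image_circlepath_nonneg[OF \<open>0 \<le> r\<close>, of z]
        by (force simp: path_image_def)
    qed
    then show "continuous_on (U \<times> cbox 0 1) (\<lambda>(u, t). ?g u t)"
      unfolding case_prod_beta by (intro continuous_intros) auto
  qed
  ultimately show ?thesis by simp
qed

text \<open>Cauchy's formula on a fixed circle expresses the derivative through values of
  \<open>f\<close> on that circle, and the integrand is jointly continuous in \<open>u\<close> and
  \<open>y\<close>.\<close>

lemma continuous_on_deriv_param:
  fixes f :: "'a::t2_space \<Rightarrow> complex \<Rightarrow> complex"
  assumes "open S" and cont: "continuous_on (U \<times> S) (\<lambda>(u, y). f u y)"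
    and hol: "\<And>u. u \<in> U \<Longrightarrow> f u holomorphic_on S"
  shows "continuous_on (U \<times> S) (\<lambda>(u, y). deriv (f u) y)"
proof -
  have "continuous (at p within U \<times> S) (\<lambda>(u, y). deriv (f u) y)" if p: "p \<in> U \<times> S" for p
  proof -
    obtain u0 y0 where p0: "p = (u0, y0)" "u0 \<in> U" "y0 \<in> S" using p by auto
    obtain r where r: "r > 0" "cball y0 r \<subseteq> S"
      using \<open>open S\<close> p0 open_contains_cball by blast
    have eq: "deriv (f u) y =
        1 / (2 * of_real pi * \<i>) * contour_integral (circlepath y0 r) (\<lambda>w. f u w / (w - y)^2)"
      if "u \<in> U" "y \<in> ball y0 r" for u y
    proof (rule DERIV_imp_deriv[OF Cauchy_derivative_integral_circlepath(2)])
      have "f u holomorphic_on cball y0 r"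
        using hol[OF that(1)] r(2) holomorphic_on_subset by blast
      then show "continuous_on (cball y0 r) (f u)" "f u holomorphic_on ball y0 r"
        using holomorphic_on_imp_continuous_on holomorphic_on_subset ball_subset_cball by blast+
    qed (use that in auto)
    have "continuous_on ((U \<times> ball y0 r) \<times> sphere y0 r)
        (\<lambda>q. (\<lambda>(u, y). f u y) (fst (fst q), snd q) / (snd q - snd (fst q))^2)"
      using r(2)
      by (intro continuous_intros continuous_on_compose2[OF cont]) (force simp: dist_commute)+
    then have "continuous_on (U \<times> ball y0 r)
        (\<lambda>q. contour_integral (circlepath y0 r) (\<lambda>w. f (fst q) w / (w - snd q)^2))"
      using r(1) by (intro continuous_on_circle_integral) (auto simp: case_prod_beta)
    then have "continuous_on (U \<times> ball y0 r) (\<lambda>q. 1 / (2 * of_real pi * \<i>) *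
        contour_integral (circlepath y0 r) (\<lambda>w. f (fst q) w / (w - snd q)^2))"
      by (intro continuous_intros)
    then have "continuous_on (U \<times> ball y0 r) (\<lambda>(u, y). deriv (f u) y)"
      by (rule continuous_on_eq) (auto simp: eq)
    then have "continuous (at p within U \<times> ball y0 r) (\<lambda>(u, y). deriv (f u) y)"
      using p0 r(1) by (auto simp: continuous_on_eq_continuous_within)
    moreover have "at p within U \<times> ball y0 r = at p within U \<times> S"
      by (rule at_within_nhd[where S = "UNIV \<times> ball y0 r"]) (use p0 r in \<open>auto intro: open_Times\<close>)
    ultimately show ?thesis by simp
  qed
  then show ?thesis by (simp add: continuous_on_eq_continuous_within)
qed

text \<open>Weierstrass: on compact pieces the slices converge uniformly as \<open>e\<close> tends
  to \<open>e0\<close>, so holomorphy survives the limit. This supplies the slice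
  \<open>e = 0\<close> of a quotient by \<open>e\<close>, which division alone does not
  reach.\<close>

lemma holomorphic_on_parameter_limit:
  fixes G :: "complex \<Rightarrow> complex \<Rightarrow> complex"
  assumes "open A" "open E" "e0 \<in> E" and cont: "continuous_on (A \<times> E) (\<lambda>(x, e). G x e)"
    and hol: "\<And>e. e \<in> E - {e0} \<Longrightarrow> (\<lambda>x. G x e) holomorphic_on A"
  shows "(\<lambda>x. G x e0) holomorphic_on A"
proof -
  obtain r where r: "r > 0" "cball e0 r \<subseteq> E"
    using assms open_contains_cball by blast
  \<comment> \<open>Approaches \<open>e0\<close> without meeting it; the \<open>+ 1\<close> keeps
    every term inside \<open>cball e0 r\<close>.\<close>
  define s where "s = (\<lambda>n::nat. e0 + of_real (r / (real n + 1)))"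
  have s_in: "s n \<in> cball e0 r" "s n \<noteq> e0" for n
    using r(1) by (auto simp: s_def dist_norm norm_divide divide_simps simp del: of_real_divide)
  have "(\<lambda>n. r / (real n + 1)) \<longlonglongrightarrow> 0"
    by real_asymp
  then have s_lim: "s \<longlonglongrightarrow> e0"
    unfolding s_def using tendsto_add[OF tendsto_const[of e0] tendsto_of_real[of _ 0]]
    by (simp del: of_real_divide)
  show ?thesis
  proof (rule holomorphic_uniform_sequence[OF \<open>open A\<close>])
    show "(\<lambda>x. G x (s n)) holomorphic_on A" for n
      using s_in[of n] r(2) by (intro hol) auto
    fix x assume "x \<in> A"
    then obtain d where d: "d > 0" "cball x d \<subseteq> A"
      using \<open>open A\<close> open_contains_cball by blast
    have "continuous_on (cball x d \<times> cball e0 r) (\<lambda>(x, e). G x e)"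
      using d(2) r(2) by (intro continuous_on_subset[OF cont]) auto
    then have uc: "uniformly_continuous_on (cball x d \<times> cball e0 r) (\<lambda>(x, e). G x e)"
      by (intro compact_uniformly_continuous compact_Times) auto
    have "uniform_limit (cball x d) (\<lambda>n x. G x (s n)) (\<lambda>x. G x e0) sequentially"
      unfolding uniform_limit_iff
    proof (intro allI impI)
      fix \<epsilon> :: real assume "\<epsilon> > 0"
      then obtain \<delta> where \<delta>: "\<delta> > 0"
        "\<And>p q. p \<in> cball x d \<times> cball e0 r \<Longrightarrow> q \<in> cball x d \<times> cball e0 r \<Longrightarrow> dist q p < \<delta> \<Longrightarrow>
           dist ((\<lambda>(x, e). G x e) q) ((\<lambda>(x, e). G x e) p) < \<epsilon>"
        using uc unfolding uniformly_continuous_on_def by metis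
      show "\<forall>\<^sub>F n in sequentially. \<forall>x\<in>cball x d. dist (G x (s n)) (G x e0) < \<epsilon>"
        using tendstoD[OF s_lim \<open>\<delta> > 0\<close>]
      proof eventually_elim
        case (elim n)
        then show ?case
          using \<delta>(2)[of "(y, e0)" "(y, s n)" for y] s_in[of n] r(1)
          by (auto simp: dist_Pair_Pair)
      qed
    qed
    then show "\<exists>d>0. cball x d \<subseteq> A \<and> uniform_limit (cball x d) (\<lambda>n x. G x (s n)) (\<lambda>x. G x e0) sequentially"
      using d by blast
  qed
qed

text \<open>Flatness with \<open>m = 1\<close> gives \<open>f 0 = 0\<close>, so a nonzero
  \<open>f\<close> is nonconstant and vanishes at 0 to a finite order \<open>n\<close>. Flatness
  with exponent \<open>n + 1\<close> then forces its nonvanishing cofactor to tend to 0.\<close>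

lemma holomorphic_zero_if_flat:
  fixes f :: "complex \<Rightarrow> complex"
  assumes hol: "f holomorphic_on ball 0 r" and e: "e \<in> ball 0 r"
    and flat: "\<And>m. \<exists>R. continuous_on (ball 0 r) R \<and> (\<forall>e\<in>ball 0 r. f e = e^m * R e)"
  shows "f e = 0"
proof (rule ccontr)
  assume ne: "f e \<noteq> 0"
  have r: "r > 0" using e by (metis ball_empty empty_iff linorder_not_le)
  have f0: "f 0 = 0" using flat[of 1] r by auto
  have nc: "\<not> f constant_on ball 0 r"
    using ne e r f0 by (metis constant_on_def centre_in_ball)
  have z: "0 \<in> ball (0::complex) r" using r by simp
  show False
  proof (rule holomorphic_factor_zero_nonconstant[OF hol open_ball connected_ball z f0 nc])
    fix g \<rho> n
    assume g: "0 < n" "0 < \<rho>" "ball (0::complex) \<rho> \<subseteq> ball 0 r" "g holomorphic_on ball 0 \<rho>"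
      "\<And>w. w \<in> ball 0 \<rho> \<Longrightarrow> f w = (w - 0) ^ n * g w" "\<And>w. w \<in> ball 0 \<rho> \<Longrightarrow> g w \<noteq> 0"
  \<comment> \<open>One more than the order, so that a factor \<open>w\<close> survives the division
    by \<open>w^n\<close>.\<close>
  obtain R where R: "continuous_on (ball 0 r) R" "\<And>e. e \<in> ball 0 r \<Longrightarrow> f e = e^(Suc n) * R e"
    using flat[of "Suc n"] by auto
  have eq: "g w = w * R w" if "w \<in> ball 0 \<rho> - {0}" for w
  proof -
    have "w \<in> ball 0 r" using that g(3) by blast
    then show ?thesis using g(5)[of w] R(2)[of w] that by auto
  qed
  have "(\<lambda>w. w * R w) \<midarrow>0\<rightarrow> 0 * R 0"
    using R(1) r by (intro tendsto_intros) (auto simp: continuous_on_eq_continuous_at isCont_def)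
  then have "(\<lambda>w. w * R w) \<midarrow>0\<rightarrow> 0"
    by simp
  then have "g \<midarrow>0\<rightarrow> 0"
    by (rule Lim_transform_within_open[where s = "ball 0 \<rho>"]) (use eq g(2) in auto)
  moreover have "g \<midarrow>0\<rightarrow> g 0"
    using holomorphic_on_imp_continuous_on[OF g(4)] g(2)
    by (auto simp: continuous_on_eq_continuous_at isCont_def)
  ultimately have "g 0 = 0" using LIM_unique by blast
  then show False using g(2,6) by auto
  qed
qed

text \<open>
  Joint holomorphy in three complex variables, encoded as joint continuity together with
  holomorphy in each variable separately (equivalent by Osgood's lemma).
\<close>

definition hol3 :: "complex set \<Rightarrow> complex set \<Rightarrow> complex set \<Rightarrow>
    (complex \<Rightarrow> complex \<Rightarrow> complex \<Rightarrow> complex) \<Rightarrow> bool" where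
  "hol3 A S E f \<longleftrightarrow> continuous_on (A \<times> S \<times> E) (\<lambda>(x, y, e). f x y e) \<and>
     (\<forall>y\<in>S. \<forall>e\<in>E. (\<lambda>x. f x y e) holomorphic_on A) \<and>
     (\<forall>x\<in>A. \<forall>e\<in>E. (\<lambda>y. f x y e) holomorphic_on S) \<and>
     (\<forall>x\<in>A. \<forall>y\<in>S. (\<lambda>e. f x y e) holomorphic_on E)"

lemma hol3_fst:
  assumes "\<phi> holomorphic_on A"
  shows "hol3 A S E (\<lambda>x y e. \<phi> x)"
proof -
  have "continuous_on (A \<times> S \<times> E) (\<lambda>p. \<phi> (fst p))"
    by (rule continuous_on_compose2[OF holomorphic_on_imp_continuous_on[OF assms]])
       (auto intro!: continuous_intros)
  then show ?thesis
    using assms by (simp add: hol3_def case_prod_beta)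
qed

lemma hol3_snd:
  assumes "\<phi> holomorphic_on S"
  shows "hol3 A S E (\<lambda>x y e. \<phi> y)"
proof -
  have "continuous_on (A \<times> S \<times> E) (\<lambda>p. \<phi> (fst (snd p)))"
    by (rule continuous_on_compose2[OF holomorphic_on_imp_continuous_on[OF assms]])
       (auto intro!: continuous_intros)
  then show ?thesis
    using assms by (simp add: hol3_def case_prod_beta)
qed

lemma hol3_thd:
  assumes "\<phi> holomorphic_on E"
  shows "hol3 A S E (\<lambda>x y e. \<phi> e)"
proof -
  have "continuous_on (A \<times> S \<times> E) (\<lambda>p. \<phi> (snd (snd p)))"
    by (rule continuous_on_compose2[OF holomorphic_on_imp_continuous_on[OF assms]])
       (auto intro!: continuous_intros)
  then show ?thesis
    using assms by (simp add: hol3_def case_prod_beta)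
qed

lemma hol3_const: "hol3 A S E (\<lambda>x y e. c)"
  by (rule hol3_fst) simp

lemma hol3_add: "hol3 A S E f \<Longrightarrow> hol3 A S E g \<Longrightarrow> hol3 A S E (\<lambda>x y e. f x y e + g x y e)"
  by (simp add: hol3_def case_prod_beta continuous_intros holomorphic_intros)

lemma hol3_diff: "hol3 A S E f \<Longrightarrow> hol3 A S E g \<Longrightarrow> hol3 A S E (\<lambda>x y e. f x y e - g x y e)"
  by (simp add: hol3_def case_prod_beta continuous_intros holomorphic_intros)

lemma hol3_mult: "hol3 A S E f \<Longrightarrow> hol3 A S E g \<Longrightarrow> hol3 A S E (\<lambda>x y e. f x y e * g x y e)"
  by (simp add: hol3_def case_prod_beta continuous_intros holomorphic_intros)

lemma hol3_divide:
  "hol3 A S E f \<Longrightarrow> hol3 A S E g \<Longrightarrow> (\<And>x y e. x \<in> A \<Longrightarrow> y \<in> S \<Longrightarrow> e \<in> E \<Longrightarrow> g x y e \<noteq> 0) \<Longrightarrow>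
   hol3 A S E (\<lambda>x y e. f x y e / g x y e)"
  by (simp add: hol3_def case_prod_beta continuous_intros holomorphic_intros)

lemma hol3_subset:
  assumes "hol3 A S E f" "A' \<subseteq> A" "S' \<subseteq> S" "E' \<subseteq> E"
  shows "hol3 A' S' E' f"
  using assms unfolding hol3_def
  by (blast intro: continuous_on_subset holomorphic_on_subset Sigma_mono)

lemmas hol3_intros = hol3_const hol3_add hol3_diff hol3_mult

text \<open>In \<open>e\<close> alone this is a removable singularity. The work lies in joint
  continuity across \<open>e = 0\<close>, which comes from Cauchy's formula in \<open>e\<close>, and
  in holomorphy of the slice \<open>e = 0\<close> in \<open>x\<close> and in \<open>y\<close>, which
  comes from the neighbouring slices.\<close>

lemma hol3_divide_parameter:
  assumes F: "hol3 A S (ball 0 r) F" and "open A" "open S"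
    and zero: "\<And>x y. x \<in> A \<Longrightarrow> y \<in> S \<Longrightarrow> F x y 0 = 0"
  obtains R where "hol3 A S (ball 0 r) R"
    and "\<And>x y e. x \<in> A \<Longrightarrow> y \<in> S \<Longrightarrow> e \<in> ball 0 r \<Longrightarrow> F x y e = e * R x y e"
proof
  define R where "R = (\<lambda>x y e. if e = 0 then deriv (F x y) 0 else (F x y e - F x y 0) / (e - 0))"
  show eq: "F x y e = e * R x y e" if "x \<in> A" "y \<in> S" "e \<in> ball 0 r" for x y e
    using zero that by (simp add: R_def)
  have contF: "continuous_on (A \<times> S \<times> ball 0 r) (\<lambda>(x, y, e). F x y e)"
    using F unfolding hol3_def by blast
  have hol_e: "R x y holomorphic_on ball 0 r" if "x \<in> A" "y \<in> S" for x y
  proof -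
    have "F x y holomorphic_on ball 0 r" using F that unfolding hol3_def by blast
    from pole_lemma_open[OF this open_ball, of 0] show ?thesis unfolding R_def by simp
  qed
  have R_ne: "R x y e = F x y e / e" if "x \<in> A" "y \<in> S" "e \<noteq> 0" for x y e
    using that zero by (simp add: R_def)
  have cont: "continuous_on (A \<times> S \<times> ball 0 r) (\<lambda>(x, y, e). R x y e)"
  proof (rule continuous_at_imp_continuous_on, rule ballI)
    fix p :: "complex \<times> complex \<times> complex" assume "p \<in> A \<times> S \<times> ball 0 r"
    then obtain x0 y0 e0 where p: "p = (x0, y0, e0)" "x0 \<in> A" "y0 \<in> S" "norm e0 < r" by auto
    \<comment> \<open>The circle of radius \<open>\<rho>\<close> encloses \<open>e0\<close> and
      avoids 0: on it the quotient is literally \<open>F x y u / u\<close>, so the value chosen at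
      \<open>e = 0\<close> does not enter the integral.\<close>
    then obtain \<rho> where \<rho>: "norm e0 < \<rho>" "\<rho> < r" using dense by blast
    then have \<rho>0: "\<rho> > 0" using norm_ge_zero[of e0] by linarith
    have sub: "cball 0 \<rho> \<subseteq> ball (0::complex) r" "ball 0 \<rho> \<subseteq> ball (0::complex) r" using \<rho> by auto
    let ?U = "A \<times> S \<times> ball (0::complex) \<rho>"
    have "continuous_on (?U \<times> sphere 0 \<rho>)
        (\<lambda>q. (\<lambda>(x, y, e). F x y e) (fst (fst q), fst (snd (fst q)), snd q) / snd q
              / (snd q - snd (snd (fst q))))"
      using sub \<rho>0 by (intro continuous_intros continuous_on_compose2[OF contF]) auto
    then have "continuous_on (?U \<times> sphere 0 \<rho>)
        (\<lambda>(q, u). F (fst q) (fst (snd q)) u / u / (u - snd (snd q)))"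
      by (simp add: case_prod_beta)
    then have "continuous_on ?U (\<lambda>q. contour_integral (circlepath 0 \<rho>)
        (\<lambda>u. F (fst q) (fst (snd q)) u / u / (u - snd (snd q))))"
      using \<rho>0 by (intro continuous_on_circle_integral) auto
    then have "continuous_on ?U (\<lambda>q. contour_integral (circlepath 0 \<rho>)
        (\<lambda>u. F (fst q) (fst (snd q)) u / u / (u - snd (snd q))) / (2 * of_real pi * \<i>))"
      by (intro continuous_intros) auto
    then have "continuous_on ?U (\<lambda>(x, y, e). R x y e)"
    proof (rule continuous_on_eq)
      fix q assume "q \<in> ?U"
      then obtain x y e where q: "q = (x, y, e)" "x \<in> A" "y \<in> S" "e \<in> ball 0 \<rho>" by auto
      have h: "R x y holomorphic_on cball 0 \<rho>"
        using hol_e[OF q(2,3)] sub(1) holomorphic_on_subset by blast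
      have "((\<lambda>u. R x y u / (u - e)) has_contour_integral (2 * of_real pi * \<i> * R x y e)) (circlepath 0 \<rho>)"
        by (rule Cauchy_integral_circlepath)
           (use h q(4) in \<open>auto intro: holomorphic_on_imp_continuous_on holomorphic_on_subset\<close>)
      then have "((\<lambda>u. F x y u / u / (u - e)) has_contour_integral (2 * of_real pi * \<i> * R x y e)) (circlepath 0 \<rho>)"
        by (rule has_contour_integral_eq) (use R_ne q \<rho>0 in auto)
      from contour_integral_unique[OF this] q(1)
      show "contour_integral (circlepath 0 \<rho>) (\<lambda>u. F (fst q) (fst (snd q)) u / u / (u - snd (snd q)))
          / (2 * of_real pi * \<i>) = (\<lambda>(x, y, e). R x y e) q"
        by simp
    qed
    moreover have "open ?U" using \<open>open A\<close> \<open>open S\<close> by (intro open_Times open_ball)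
    moreover have "p \<in> ?U" using p \<rho> by auto
    ultimately show "isCont (\<lambda>(x, y, e). R x y e) p"
      using continuous_on_eq_continuous_at by blast
  qed
  have hol_x: "(\<lambda>x. R x y e) holomorphic_on A" if "y \<in> S" "e \<in> ball 0 r" for y e
  proof -
    have r0: "0 < r" using that(2) norm_ge_zero[of e] by (simp del: norm_ge_zero)
    have ne: "(\<lambda>x. R x y e) holomorphic_on A" if "e \<in> ball 0 r - {0}" for e
    proof -
      have "(\<lambda>x. F x y e / e) holomorphic_on A"
        using F that \<open>y \<in> S\<close> unfolding hol3_def by (auto intro!: holomorphic_intros)
      then show ?thesis by (rule holomorphic_transform) (use R_ne that \<open>y \<in> S\<close> in auto)
    qed
    have "continuous_on (A \<times> ball 0 r) (\<lambda>p. (\<lambda>(x, y, e). R x y e) (fst p, y, snd p))"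
      using that by (intro continuous_on_compose2[OF cont] continuous_intros) auto
    then have c: "continuous_on (A \<times> ball 0 r) (\<lambda>(x, e). R x y e)"
      by (simp add: case_prod_beta)
    have "(\<lambda>x. R x y 0) holomorphic_on A"
      by (rule holomorphic_on_parameter_limit[OF \<open>open A\<close> open_ball _ c ne]) (use r0 in auto)
    with ne that show ?thesis by (cases "e = 0") auto
  qed
  have hol_y: "(\<lambda>y. R x y e) holomorphic_on S" if "x \<in> A" "e \<in> ball 0 r" for x e
  proof -
    have r0: "0 < r" using that(2) norm_ge_zero[of e] by (simp del: norm_ge_zero)
    have ne: "(\<lambda>y. R x y e) holomorphic_on S" if "e \<in> ball 0 r - {0}" for e
    proof -
      have "(\<lambda>y. F x y e / e) holomorphic_on S"
        using F that \<open>x \<in> A\<close> unfolding hol3_def by (auto intro!: holomorphic_intros)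
      then show ?thesis by (rule holomorphic_transform) (use R_ne that \<open>x \<in> A\<close> in auto)
    qed
    have "continuous_on (S \<times> ball 0 r) (\<lambda>p. (\<lambda>(x, y, e). R x y e) (x, fst p, snd p))"
      using that by (intro continuous_on_compose2[OF cont] continuous_intros) auto
    then have c: "continuous_on (S \<times> ball 0 r) (\<lambda>(y, e). R x y e)"
      by (simp add: case_prod_beta)
    have "(\<lambda>y. R x y 0) holomorphic_on S"
      by (rule holomorphic_on_parameter_limit[OF \<open>open S\<close> open_ball _ c ne]) (use r0 in auto)
    with ne that show ?thesis by (cases "e = 0") auto
  qed
  show "hol3 A S (ball 0 r) R"
    unfolding hol3_def using cont hol_x hol_y hol_e by auto
qed

lemma hol3_continuous_thd:
  assumes "hol3 A S E f" "x \<in> A" "y \<in> S"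
  shows "continuous_on E (f x y)"
  using assms holomorphic_on_imp_continuous_on unfolding hol3_def by blast

lemma hol3_zero_if_flat:
  assumes F: "hol3 A S (ball 0 r) F" and "x \<in> A" "y \<in> S" "e \<in> ball 0 r"
    and flat: "\<And>m. \<exists>R. hol3 A S (ball 0 r) R \<and>
      (\<forall>x\<in>A. \<forall>y\<in>S. \<forall>e\<in>ball 0 r. F x y e = e^m * R x y e)"
  shows "F x y e = 0"
proof (rule holomorphic_zero_if_flat[where r = r and f = "F x y" and e = e])
  show "F x y holomorphic_on ball 0 r" using assms unfolding hol3_def by blast
  show "\<exists>R. continuous_on (ball 0 r) R \<and> (\<forall>e\<in>ball 0 r. F x y e = e^m * R e)" for m
  proof -
    obtain R where R: "hol3 A S (ball 0 r) R"
      "\<forall>x\<in>A. \<forall>y\<in>S. \<forall>e\<in>ball 0 r. F x y e = e^m * R x y e"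
      using flat[of m] by (elim exE conjE)
    from hol3_continuous_thd[OF R(1) assms(2,3)] R(2) assms(2,3) show ?thesis
      by (intro exI[of _ "R x y"]) simp
  qed
qed fact

lemma hol3_order:
  assumes F: "hol3 A S (ball 0 r) F" and "open A" "open S"
    and ne: "x \<in> A" "y \<in> S" "e \<in> ball 0 r" "F x y e \<noteq> 0"
  obtains m :: nat and R x' y' where "hol3 A S (ball 0 r) R"
    and "\<And>x y e. x \<in> A \<Longrightarrow> y \<in> S \<Longrightarrow> e \<in> ball 0 r \<Longrightarrow> F x y e = e^m * R x y e"
    and "x' \<in> A" "y' \<in> S" "R x' y' 0 \<noteq> 0"
proof -
  define P where "P = (\<lambda>m. \<exists>R. hol3 A S (ball 0 r) R \<and>
      (\<forall>x\<in>A. \<forall>y\<in>S. \<forall>e\<in>ball 0 r. F x y e = e^m * R x y e))"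
  have "\<exists>m. P m \<and> \<not> P (Suc m)"
  proof (rule ccontr)
    assume "\<not> ?thesis"
    moreover have "P 0" using F unfolding P_def by auto
    ultimately have "P m" for m by (induction m) auto
    then have "F x y e = 0" unfolding P_def by (rule hol3_zero_if_flat[OF F ne(1-3)])
    with ne(4) show False ..
  qed
  then obtain m where m: "P m" "\<not> P (Suc m)" by blast
  then obtain R where R: "hol3 A S (ball 0 r) R"
      "\<And>x y e. x \<in> A \<Longrightarrow> y \<in> S \<Longrightarrow> e \<in> ball 0 r \<Longrightarrow> F x y e = e^m * R x y e"
    unfolding P_def by blast
  have "\<exists>x'\<in>A. \<exists>y'\<in>S. R x' y' 0 \<noteq> 0"
  proof (rule ccontr)
    assume "\<not> ?thesis"
    then have z: "R x y 0 = 0" if "x \<in> A" "y \<in> S" for x y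
      using that by blast
    obtain R' where R': "hol3 A S (ball 0 r) R'"
      "\<And>x y e. x \<in> A \<Longrightarrow> y \<in> S \<Longrightarrow> e \<in> ball 0 r \<Longrightarrow> R x y e = e * R' x y e"
      using hol3_divide_parameter[OF R(1) \<open>open A\<close> \<open>open S\<close> z] by metis
    have "F x y e = e ^ Suc m * R' x y e" if "x \<in> A" "y \<in> S" "e \<in> ball 0 r" for x y e
      using R(2)[OF that] R'(2)[OF that] by simp
    then show False using m(2) R'(1) unfolding P_def by blast
  qed
  then obtain x' y' where "x' \<in> A" "y' \<in> S" "R x' y' 0 \<noteq> 0" by (elim bexE)
  with R show ?thesis by (rule that)
qed

lemma continuous_zero_at_puncture:
  fixes f :: "complex \<Rightarrow> complex"
  assumes "continuous_on (ball 0 r) f" "0 < r" "\<And>e. e \<in> ball 0 r - {0} \<Longrightarrow> f e = 0"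
  shows "f 0 = 0"
proof -
  have "(f \<longlongrightarrow> f 0) (at 0)"
    using assms by (simp add: continuous_on_eq_continuous_at isCont_def)
  moreover have "(f \<longlongrightarrow> 0) (at 0)"
    by (rule Lim_transform_within_open[OF tendsto_const, where s = "ball 0 r"]) (use assms in auto)
  ultimately show ?thesis by (rule LIM_unique)
qed

lemma derivative_zero_imp_eq:
  fixes f :: "complex \<Rightarrow> complex"
  assumes "open S" "connected S" and D: "\<And>y. y \<in> S \<Longrightarrow> (f has_field_derivative 0) (at y)"
    and ab: "a \<in> S" "b \<in> S"
  shows "f a = f b"
proof -
  have "continuous_on S f" using D by (auto intro: DERIV_isCont continuous_at_imp_continuous_on)
  then obtain k where "\<And>y. y \<in> S \<Longrightarrow> f y = k"
    using DERIV_zero_connected_constant[OF assms(2,1), of "{}" f] D by auto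
  with ab show ?thesis by simp
qed

subsection \<open>The transport equation around the pole\<close>

text \<open>
  The variables \<open>x\<close>, \<open>y\<close>, \<open>e\<close> stand for \<open>I\<close>, \<open>\<theta>\<close>, \<open>\<epsilon>\<close>; the set \<open>S\<close> is thought of as an annulus
  around the pole \<open>c\<close> of the force \<open>h\<close>, and \<open>s c\<close> is the residue.  \<open>Xd\<close> is differentiation along the flow.
\<close>

locale pole_chart =
  fixes A S :: "complex set" and r :: real and c :: complex and \<rho> R0 :: real
    and s h :: "complex \<Rightarrow> complex" and x1 y1 :: complex
  assumes A: "open A" "connected A" "0 \<notin> A" "x1 \<in> A"
    and S: "open S" "connected S" "sphere c \<rho> \<subseteq> S" "y1 \<in> S"
    and rho: "0 < \<rho>" "\<rho> < R0" and r: "0 < r"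
    and s: "s holomorphic_on ball c R0" "s c \<noteq> 0"
    and h: "\<And>y. y \<in> S \<Longrightarrow> y \<noteq> c \<and> h y = s y / (y - c)" "h holomorphic_on S"
begin

definition Xd :: "(complex \<Rightarrow> complex \<Rightarrow> complex \<Rightarrow> complex) \<Rightarrow> complex \<Rightarrow> complex \<Rightarrow> complex \<Rightarrow> complex" where
  "Xd Y x y e = e * h y * deriv (\<lambda>x. Y x y e) x + x * deriv (\<lambda>y. Y x y e) y"

text \<open>At \<open>e = 0\<close> the equation determines \<open>Y\<close> only up to a function
  \<open>\<phi>\<close> of \<open>x\<close>. That \<open>\<phi>\<close> is constant is the
  solvability condition of the next order, an integral around the pole; it is obtained by continuity
  from \<open>e \<noteq> 0\<close>, without expanding in \<open>e\<close>.\<close>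

lemma transport_limit:
  assumes Y: "hol3 A S (ball 0 r) Y" and q: "(q \<longlongrightarrow> q0) (at 0)"
    and eq: "\<And>x y e. x \<in> A \<Longrightarrow> y \<in> S \<Longrightarrow> e \<in> ball 0 r - {0} \<Longrightarrow> Xd Y x y e = q e / x^2"
  obtains C where "\<And>x y. x \<in> A \<Longrightarrow> y \<in> S \<Longrightarrow> Y x y 0 = q0 * (y - c) / x^3 + C"
proof -
  define Yx where "Yx = (\<lambda>x y e. deriv (\<lambda>x. Y x y e) x)"
  define Yy where "Yy = (\<lambda>x y e. deriv (\<lambda>y. Y x y e) y)"
  let ?E = "ball (0::complex) r"
  have E0: "0 \<in> ?E" using r by simp
  have nz: "x \<noteq> 0" if "x \<in> A" for x using A that by auto
  have contY: "continuous_on (A \<times> S \<times> ?E) (\<lambda>(x, y, e). Y x y e)"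
    and Y_x: "\<And>y e. y \<in> S \<Longrightarrow> e \<in> ?E \<Longrightarrow> (\<lambda>x. Y x y e) holomorphic_on A"
    and Y_y: "\<And>x e. x \<in> A \<Longrightarrow> e \<in> ?E \<Longrightarrow> (\<lambda>y. Y x y e) holomorphic_on S"
    using Y unfolding hol3_def by auto
  have DYx: "((\<lambda>x. Y x y e) has_field_derivative Yx x y e) (at x)" if "x \<in> A" "y \<in> S" "e \<in> ?E" for x y e
    unfolding Yx_def using holomorphic_derivI[OF Y_x A(1)] that by simp
  have DYy: "((\<lambda>y. Y x y e) has_field_derivative Yy x y e) (at y)" if "x \<in> A" "y \<in> S" "e \<in> ?E" for x y e
    unfolding Yy_def using holomorphic_derivI[OF Y_y S(1)] that by simp
  \<comment> \<open>The variable to be differentiated is moved to the last place, as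
    \<open>continuous_on_deriv_param\<close> expects it.\<close>
  have "continuous_on ((S \<times> ?E) \<times> A) (\<lambda>q. (\<lambda>(x, y, e). Y x y e) (snd q, fst (fst q), snd (fst q)))"
    by (intro continuous_on_compose2[OF contY] continuous_intros) auto
  then have "continuous_on ((S \<times> ?E) \<times> A) (\<lambda>(q, x). (\<lambda>x. Y x (fst q) (snd q)) x)"
    by (simp add: case_prod_beta)
  then have "continuous_on ((S \<times> ?E) \<times> A) (\<lambda>(q, x). deriv (\<lambda>x. Y x (fst q) (snd q)) x)"
    by (rule continuous_on_deriv_param[OF A(1)]) (use Y_x in auto)
  then have cYx: "continuous_on ((S \<times> ?E) \<times> A) (\<lambda>(q, x). Yx x (fst q) (snd q))"
    by (simp add: Yx_def)
  have "continuous_on ((A \<times> ?E) \<times> S) (\<lambda>q. (\<lambda>(x, y, e). Y x y e) (fst (fst q), snd q, snd (fst q)))"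
    by (intro continuous_on_compose2[OF contY] continuous_intros) auto
  then have "continuous_on ((A \<times> ?E) \<times> S) (\<lambda>(q, y). (\<lambda>y. Y (fst q) y (snd q)) y)"
    by (simp add: case_prod_beta)
  then have "continuous_on ((A \<times> ?E) \<times> S) (\<lambda>(q, y). deriv (\<lambda>y. Y (fst q) y (snd q)) y)"
    by (rule continuous_on_deriv_param[OF S(1)]) (use Y_y in auto)
  then have cYy: "continuous_on ((A \<times> ?E) \<times> S) (\<lambda>(q, y). Yy (fst q) y (snd q))"
    by (simp add: Yy_def)
  have lim0: "(f \<longlongrightarrow> f 0) (at 0)" if "continuous_on ?E f" for f :: "complex \<Rightarrow> complex"
    using that E0 by (auto simp: continuous_on_eq_continuous_at isCont_def)
  have ev: "eventually (\<lambda>e. e \<in> ?E - {0}) (at 0)"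
    using eventually_at_in_open[OF open_ball E0] by simp
  have Yy0: "Yy x y 0 = q0 / x^3" if "x \<in> A" "y \<in> S" for x y
  proof -
    have "continuous_on ?E (\<lambda>e. (\<lambda>(q, x). Yx x (fst q) (snd q)) ((y, e), x))"
      using that by (intro continuous_on_compose2[OF cYx] continuous_intros) auto
    then have lx: "((\<lambda>e. Yx x y e) \<longlongrightarrow> Yx x y 0) (at 0)" using lim0 by simp
    have "continuous_on ?E (\<lambda>e. (\<lambda>(q, y). Yy (fst q) y (snd q)) ((x, e), y))"
      using that by (intro continuous_on_compose2[OF cYy] continuous_intros) auto
    then have ly: "((\<lambda>e. Yy x y e) \<longlongrightarrow> Yy x y 0) (at 0)" using lim0 by simp
    have "((\<lambda>e. e * h y * Yx x y e + x * Yy x y e) \<longlongrightarrow> 0 * h y * Yx x y 0 + x * Yy x y 0) (at 0)"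
      by (intro tendsto_intros lx ly)
    moreover have "eventually (\<lambda>e. e * h y * Yx x y e + x * Yy x y e = q e / x^2) (at 0)"
      using ev by eventually_elim (use eq[OF that] in \<open>simp add: Xd_def Yx_def Yy_def\<close>)
    ultimately have "((\<lambda>e. q e / x^2) \<longlongrightarrow> 0 * h y * Yx x y 0 + x * Yy x y 0) (at 0)"
      by (rule Lim_transform_eventually)
    then have "((\<lambda>e. q e / x^2) \<longlongrightarrow> x * Yy x y 0) (at 0)"
      by simp
    moreover have "((\<lambda>e. q e / x^2) \<longlongrightarrow> q0 / x^2) (at 0)"
      using nz[OF that(1)] by (intro tendsto_intros q) auto
    ultimately have "x * Yy x y 0 = q0 / x^2" using LIM_unique by blast
    then show ?thesis using nz[OF that(1)] by (simp add: field_simps power3_eq_cube power2_eq_square)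
  qed
  \<comment> \<open>The integration constant in \<open>y\<close>, read off at the base point
    \<open>y1\<close>.\<close>
  define \<phi> where "\<phi> = (\<lambda>x. Y x y1 0 - q0 * (y1 - c) / x^3)"
  have Y0: "Y x y 0 = q0 * (y - c) / x^3 + \<phi> x" if "x \<in> A" "y \<in> S" for x y
  proof -
    have D: "((\<lambda>y. Y x y 0 - q0 * (y - c) / x^3) has_field_derivative 0) (at y)" if "y \<in> S" for y
      using DYy[OF \<open>x \<in> A\<close> that E0] Yy0[OF \<open>x \<in> A\<close> that] nz[OF \<open>x \<in> A\<close>]
      by (auto intro!: derivative_eq_intros simp: field_simps eval_nat_numeral)
    from derivative_zero_imp_eq[OF S(1,2) D \<open>y \<in> S\<close> S(4)] show ?thesis
      by (simp add: \<phi>_def algebra_simps)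
  qed
  \<comment> \<open>For \<open>e \<noteq> 0\<close> the form \<open>h * Yx\<close> has a primitive in \<open>y\<close>, so its integral around the pole vanishes; let \<open>e\<close> tend to 0.\<close>
  have D\<phi>0: "(\<phi> has_field_derivative 0) (at x)" if x: "x \<in> A" for x
  proof -
    define \<phi>' where "\<phi>' = Yx x y1 0 + 3 * q0 * (y1 - c) / x^4"
    have D\<phi>: "(\<phi> has_field_derivative \<phi>') (at x)"
      unfolding \<phi>_def \<phi>'_def using DYx[OF x S(4) E0] nz[OF x]
      by (auto intro!: derivative_eq_intros simp: field_simps eval_nat_numeral)
    have Yx0: "Yx x y 0 = \<phi>' - 3 * q0 * (y - c) / x^4" if "y \<in> S" for y
    proof -
      have "((\<lambda>x. q0 * (y - c) / x^3 + \<phi> x) has_field_derivative (\<phi>' - 3 * q0 * (y - c) / x^4)) (at x)"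
        using D\<phi> nz[OF x] by (auto intro!: derivative_eq_intros simp: field_simps eval_nat_numeral)
      then have "((\<lambda>x. Y x y 0) has_field_derivative (\<phi>' - 3 * q0 * (y - c) / x^4)) (at x)"
        by (rule has_field_derivative_transform_within_open[OF _ A(1) x]) (use Y0 that in auto)
      then show ?thesis using DYx[OF x that E0] DERIV_unique by blast
    qed
    let ?J = "\<lambda>e. contour_integral (circlepath c \<rho>) (\<lambda>y. h y * Yx x y e)"
    have sph: "path_image (circlepath c \<rho>) \<subseteq> S" using S(3) rho by simp
    have "continuous_on (?E \<times> sphere c \<rho>) (\<lambda>p. h (snd p) * (\<lambda>(q, x). Yx x (fst q) (snd q)) ((snd p, fst p), x))"
      using S(3) x
      by (intro continuous_intros continuous_on_compose2[OF cYx]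
           continuous_on_compose2[OF holomorphic_on_imp_continuous_on[OF h(2)]]) auto
    then have "continuous_on ?E ?J"
      using rho by (intro continuous_on_circle_integral) (auto simp: case_prod_beta)
    then have J: "(?J \<longlongrightarrow> ?J 0) (at 0)" using lim0 by blast
    have "?J e = 0" if e: "e \<in> ?E - {0}" for e
    proof (rule contour_integral_unique)
      have "((\<lambda>y. (q e / x^2 - x * Yy x y e) / e) has_contour_integral 0) (circlepath c \<rho>)"
      proof (rule Cauchy_theorem_primitive)
        fix y assume y: "y \<in> S"
        have "((\<lambda>y. (q e * y / x^2 - x * Y x y e) / e) has_field_derivative (q e / x^2 - x * Yy x y e) / e) (at y)"
          using e nz[OF x] by (auto intro!: derivative_eq_intros DYy[OF x y] simp: field_simps eval_nat_numeral)
        then show "((\<lambda>y. (q e * y / x^2 - x * Y x y e) / e) has_field_derivative (q e / x^2 - x * Yy x y e) / e) (at y within S)"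
          by (rule has_field_derivative_at_within)
      qed (use sph in auto)
      then show "((\<lambda>y. h y * Yx x y e) has_contour_integral 0) (circlepath c \<rho>)"
      proof (rule has_contour_integral_eq)
        fix y assume "y \<in> path_image (circlepath c \<rho>)"
        then have "y \<in> S" using sph by blast
        from eq[OF x this e] show "(q e / x^2 - x * Yy x y e) / e = h y * Yx x y e"
          using e nz[OF x] by (simp add: Xd_def Yx_def Yy_def field_simps eval_nat_numeral)
      qed
    qed
    then have "eventually (\<lambda>e. ?J e = 0) (at 0)" using ev by (rule eventually_mono[rotated])
    then have "(?J \<longlongrightarrow> 0) (at 0)" by (rule tendsto_eventually)
    then have J0: "?J 0 = 0" using J LIM_unique by blast
    have scont: "s holomorphic_on cball c \<rho>"
      using s(1) rho by (rule_tac holomorphic_on_subset) auto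
    have i1: "((\<lambda>y. s y / (y - c)) has_contour_integral (2 * of_real pi * \<i> * s c)) (circlepath c \<rho>)"
      by (rule Cauchy_integral_circlepath_simple) (use scont rho in auto)
    have "(s has_contour_integral 0) (circlepath c \<rho>)"
      by (rule Cauchy_theorem_convex_simple[OF scont convex_cball]) (use rho in auto)
    \<comment> \<open>The factor \<open>y - c\<close> in \<open>Yx x y 0\<close> cancels the pole of
      \<open>h\<close>; that part integrates to 0 by Cauchy's theorem, and only
      \<open>\<phi>'\<close> is multiplied by the residue \<open>s c\<close>.\<close>
    from has_contour_integral_diff[OF has_contour_integral_lmul[OF i1, of \<phi>'] has_contour_integral_lmul[OF this, of "3 * q0 / x^4"]]
    have "((\<lambda>y. \<phi>' * (s y / (y - c)) - 3 * q0 / x^4 * s y) has_contour_integral (\<phi>' * (2 * of_real pi * \<i> * s c))) (circlepath c \<rho>)"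
      by simp
    then have "((\<lambda>y. h y * Yx x y 0) has_contour_integral (\<phi>' * (2 * of_real pi * \<i> * s c))) (circlepath c \<rho>)"
    proof (rule has_contour_integral_eq)
      fix y assume "y \<in> path_image (circlepath c \<rho>)"
      then have "y \<in> S" using sph by blast
      then show "\<phi>' * (s y / (y - c)) - 3 * q0 / x^4 * s y = h y * Yx x y 0"
        using h(1)[of y] nz[OF x] unfolding Yx0[OF \<open>y \<in> S\<close>]
        by (simp add: right_diff_distrib mult.commute)
    qed
    then have "\<phi>' * (2 * of_real pi * \<i> * s c) = 0" using J0 contour_integral_unique by metis
    then have "\<phi>' = 0" using s(2) by simp
    with D\<phi> show ?thesis by simp
  qed
  have "\<phi> x = \<phi> x1" if "x \<in> A" for x
    by (rule derivative_zero_imp_eq[OF A(1,2) D\<phi>0 that A(4)])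
  with Y0 show ?thesis by (intro that[of "\<phi> x1"]) auto
qed

text \<open>\<open>Xd\<close> involves no derivative in \<open>e\<close>: it annihilates
  \<open>p e\<close>, and powers of \<open>e\<close> pass through it.\<close>

lemma Xd_divided_power:
  assumes P: "hol3 A S (ball 0 r) P"
    and RP: "\<And>x y e. x \<in> A \<Longrightarrow> y \<in> S \<Longrightarrow> e \<in> ball 0 r \<Longrightarrow> P x y e - p e = e^j * R x y e"
    and x: "x \<in> A" "y \<in> S" "e \<in> ball 0 r - {0}"
  shows "Xd R x y e = Xd P x y e / e^j"
proof -
  have e: "e \<noteq> 0" "e \<in> ball 0 r" using x by auto
  have R_eq: "R x y e = (P x y e - p e) / e^j" if "x \<in> A" "y \<in> S" for x y
    using RP[OF that e(2)] e(1) by simp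
  have "(\<lambda>x. P x y e) holomorphic_on A" "(\<lambda>y. P x y e) holomorphic_on S"
    using P x unfolding hol3_def by auto
  then have Px: "((\<lambda>x. P x y e) has_field_derivative deriv (\<lambda>x. P x y e) x) (at x)"
    and Py: "((\<lambda>y. P x y e) has_field_derivative deriv (\<lambda>y. P x y e) y) (at y)"
    using holomorphic_derivI A(1) S(1) x by blast+
  have "((\<lambda>x. (P x y e - p e) / e^j) has_field_derivative deriv (\<lambda>x. P x y e) x / e^j) (at x)"
    using e(1) by (auto intro!: derivative_eq_intros Px)
  then have "((\<lambda>x. R x y e) has_field_derivative deriv (\<lambda>x. P x y e) x / e^j) (at x)"
    by (rule has_field_derivative_transform_within_open[OF _ A(1) x(1)]) (use R_eq x in auto)
  then have 1: "deriv (\<lambda>x. R x y e) x = deriv (\<lambda>x. P x y e) x / e^j" by (rule DERIV_imp_deriv)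
  have "((\<lambda>y. (P x y e - p e) / e^j) has_field_derivative deriv (\<lambda>y. P x y e) y / e^j) (at y)"
    using e(1) by (auto intro!: derivative_eq_intros Py)
  then have "((\<lambda>y. R x y e) has_field_derivative deriv (\<lambda>y. P x y e) y / e^j) (at y)"
    by (rule has_field_derivative_transform_within_open[OF _ S(1) x(2)]) (use R_eq x in auto)
  then have 2: "deriv (\<lambda>y. R x y e) y = deriv (\<lambda>y. P x y e) y / e^j" by (rule DERIV_imp_deriv)
  show ?thesis unfolding Xd_def 1 2 by (simp add: add_divide_distrib)
qed

text \<open>By induction on the order in \<open>e\<close>: while the right-hand side still vanishes at \<open>e = 0\<close>,
  \<open>transport_limit\<close> makes the leading coefficient constant, hence zero by normalisation.\<close>

lemma transport_divisible:
  assumes P: "hol3 A S (ball 0 r) P"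
    and eq: "\<And>x y e. x \<in> A \<Longrightarrow> y \<in> S \<Longrightarrow> e \<in> ball 0 r - {0} \<Longrightarrow> Xd P x y e = \<sigma> * e^M / x^2"
    and "j \<le> M"
  shows "\<exists>R. hol3 A S (ball 0 r) R \<and>
    (\<forall>x\<in>A. \<forall>y\<in>S. \<forall>e\<in>ball 0 r. P x y e - P x1 y1 e = e^j * R x y e)"
  using \<open>j \<le> M\<close>
proof (induction j)
  case 0
  have "P x1 y1 holomorphic_on ball 0 r" using P A(4) S(4) unfolding hol3_def by blast
  then have "hol3 A S (ball 0 r) (\<lambda>x y e. P x y e - P x1 y1 e)"
    by (intro hol3_intros P hol3_thd)
  then show ?case by auto
next
  case (Suc j)
  then obtain R where R: "hol3 A S (ball 0 r) R"
    "\<And>x y e. x \<in> A \<Longrightarrow> y \<in> S \<Longrightarrow> e \<in> ball 0 r \<Longrightarrow> P x y e - P x1 y1 e = e^j * R x y e"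
    by auto
  have XR: "Xd R x y e = \<sigma> * e^(M - j) / x^2" if "x \<in> A" "y \<in> S" "e \<in> ball 0 r - {0}" for x y e
    using Xd_divided_power[OF P R(2) that] eq[OF that] that Suc.prems by (simp add: power_diff)
  \<comment> \<open>\<open>Suc j \<le> M\<close> keeps the exponent \<open>M - j\<close> positive,
    so the limit equation is the homogeneous one.\<close>
  have "((\<lambda>e. \<sigma> * e^(M - j)) \<longlongrightarrow> \<sigma> * 0^(M - j)) (at 0)"
    by (intro tendsto_intros)
  then have q: "((\<lambda>e. \<sigma> * e^(M - j)) \<longlongrightarrow> 0) (at 0)"
    using Suc.prems zero_power[of "M - j", where 'a = complex] by simp
  obtain C where C: "\<And>x y. x \<in> A \<Longrightarrow> y \<in> S \<Longrightarrow> R x y 0 = 0 * (y - c) / x^3 + C"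
    using transport_limit[OF R(1) q XR] by blast
  have cR: "continuous_on (ball 0 r) (R x1 y1)" by (rule hol3_continuous_thd[OF R(1) A(4) S(4)])
  have "R x1 y1 e = 0" if "e \<in> ball 0 r - {0}" for e
    using R(2)[OF A(4) S(4), of e] that by simp
  then have "R x1 y1 0 = 0"
    by (intro continuous_zero_at_puncture[OF cR r])
  then have z: "R x y 0 = 0" if "x \<in> A" "y \<in> S" for x y
    using C[OF that] C[OF A(4) S(4)] by simp
  obtain R' where R': "hol3 A S (ball 0 r) R'"
    "\<And>x y e. x \<in> A \<Longrightarrow> y \<in> S \<Longrightarrow> e \<in> ball 0 r \<Longrightarrow> R x y e = e * R' x y e"
    using hol3_divide_parameter[OF R(1) A(1) S(1) z] by metis
  then show ?case using R(2) by (intro exI[of _ R']) simp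
qed

text \<open>After \<open>M\<close> divisions by \<open>e\<close> the right-hand side is
  \<open>\<sigma> / x^2\<close>, free of \<open>e\<close>, and one more use of
  \<open>transport_limit\<close> gives the inhomogeneous leading coefficient. The subtracted base
  point value depends on \<open>e\<close> alone.\<close>

lemma transport_solution:
  assumes P: "hol3 A S (ball 0 r) P"
    and eq: "\<And>x y e. x \<in> A \<Longrightarrow> y \<in> S \<Longrightarrow> e \<in> ball 0 r - {0} \<Longrightarrow> Xd P x y e = \<sigma> * e^M / x^2"
  obtains C where "\<And>x y. x \<in> A \<Longrightarrow> y \<in> S \<Longrightarrow>
    ((\<lambda>e. (P x y e - P x1 y1 e) / e^M) \<longlongrightarrow> \<sigma> * (y - c) / x^3 + C) (at 0)"
proof -
  obtain R where R: "hol3 A S (ball 0 r) R"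
    "\<And>x y e. x \<in> A \<Longrightarrow> y \<in> S \<Longrightarrow> e \<in> ball 0 r \<Longrightarrow> P x y e - P x1 y1 e = e^M * R x y e"
    using transport_divisible[OF P eq order_refl] by auto
  have XR: "Xd R x y e = \<sigma> / x^2" if "x \<in> A" "y \<in> S" "e \<in> ball 0 r - {0}" for x y e
    using Xd_divided_power[OF P R(2) that] eq[OF that] that by simp
  obtain C where C: "\<And>x y. x \<in> A \<Longrightarrow> y \<in> S \<Longrightarrow> R x y 0 = \<sigma> * (y - c) / x^3 + C"
    using transport_limit[OF R(1) tendsto_const XR] by metis
  have "((\<lambda>e. (P x y e - P x1 y1 e) / e^M) \<longlongrightarrow> \<sigma> * (y - c) / x^3 + C) (at 0)"
    if "x \<in> A" "y \<in> S" for x y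
  proof -
    have "(R x y \<longlongrightarrow> R x y 0) (at 0)"
      using hol3_continuous_thd[OF R(1) that] r by (simp add: continuous_on_eq_continuous_at isCont_def)
    then have "((\<lambda>e. (P x y e - P x1 y1 e) / e^M) \<longlongrightarrow> R x y 0) (at 0)"
      by (rule Lim_transform_within_open[where s = "ball 0 r"]) (use R(2)[OF that] r in auto)
    with C[OF that] show ?thesis by simp
  qed
  then show ?thesis by (rule that)
qed

text \<open>With \<open>\<sigma> = 0\<close> the hypothesis of \<open>transport_divisible\<close>
  holds for every \<open>M\<close>, so the difference to the base point value is divisible by all
  powers of \<open>e\<close>.\<close>

lemma first_integral_constant:
  assumes G: "hol3 A S (ball 0 r) G"
    and eq: "\<And>x y e. x \<in> A \<Longrightarrow> y \<in> S \<Longrightarrow> e \<in> ball 0 r - {0} \<Longrightarrow> Xd G x y e = 0"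
    and x: "x \<in> A" "y \<in> S" "e \<in> ball 0 r"
  shows "G x y e = G x1 y1 e"
proof -
  have "G x1 y1 holomorphic_on ball 0 r" using G A(4) S(4) unfolding hol3_def by blast
  then have D: "hol3 A S (ball 0 r) (\<lambda>x y e. G x y e - G x1 y1 e)"
    by (intro hol3_intros G hol3_thd)
  have "G x y e - G x1 y1 e = 0"
    by (rule hol3_zero_if_flat[OF D x])
       (rule transport_divisible[OF G, where \<sigma> = 0], use eq in auto)
  then show ?thesis by simp
qed

text \<open>\<open>G1\<close> and \<open>G2\<close> are the components of the commuting field up to
  a common power of \<open>e\<close>; \<open>X1\<close> and \<open>X2\<close> are the two components
  of the bracket relation. The determinant with the flow is constant along it, hence of the form
  \<open>e^k * u e\<close>, and \<open>G2 / (x * u e)\<close> solves the transport equation with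
  \<open>\<sigma> = -1\<close> and \<open>M = k\<close>.\<close>

lemma commuting_field_asymptotics:
  assumes G1: "hol3 A S (ball 0 r) G1" and G2: "hol3 A S (ball 0 r) G2"
    and X1: "\<And>x y e. x \<in> A \<Longrightarrow> y \<in> S \<Longrightarrow> e \<in> ball 0 r - {0} \<Longrightarrow> Xd G1 x y e = e * deriv h y * G2 x y e"
    and X2: "\<And>x y e. x \<in> A \<Longrightarrow> y \<in> S \<Longrightarrow> e \<in> ball 0 r - {0} \<Longrightarrow> Xd G2 x y e = G1 x y e"
    and ne: "x0 \<in> A" "y0 \<in> S" "e0 \<in> ball 0 r" "e0 * h y0 * G2 x0 y0 e0 \<noteq> x0 * G1 x0 y0 e0"
  obtains r' u p C and k :: nat where "0 < r'" "u holomorphic_on ball 0 r'" "p holomorphic_on ball 0 r'"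
    and "\<And>e. e \<in> ball 0 r' \<Longrightarrow> u e \<noteq> 0"
    and "\<And>x y. x \<in> A \<Longrightarrow> y \<in> S \<Longrightarrow>
      ((\<lambda>e. (G2 x y e / (x * u e) - p e) / e^k + (y - c) / x^3) \<longlongrightarrow> C) (at 0)"
proof -
  let ?E = "ball (0::complex) r"
  define D where "D = (\<lambda>x y e. e * h y * G2 x y e - x * G1 x y e)"
  have D: "hol3 A S ?E D"
    unfolding D_def by (intro hol3_intros G1 G2 hol3_fst hol3_snd hol3_thd h(2)) (auto intro: holomorphic_intros)
  have d: "((\<lambda>x. G x y e) has_field_derivative deriv (\<lambda>x. G x y e) x) (at x)"
          "((\<lambda>y. G x y e) has_field_derivative deriv (\<lambda>y. G x y e) y) (at y)"
    if "hol3 A S ?E G" "x \<in> A" "y \<in> S" "e \<in> ?E" for G x y e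
  proof -
    have "(\<lambda>x. G x y e) holomorphic_on A" "(\<lambda>y. G x y e) holomorphic_on S"
      using that unfolding hol3_def by auto
    then show "((\<lambda>x. G x y e) has_field_derivative deriv (\<lambda>x. G x y e) x) (at x)"
          "((\<lambda>y. G x y e) has_field_derivative deriv (\<lambda>y. G x y e) y) (at y)"
      using holomorphic_derivI A(1) S(1) that by blast+
  qed
  have dh: "(h has_field_derivative deriv h y) (at y)" if "y \<in> S" for y
    using holomorphic_derivI[OF h(2) S(1) that] .
  have "Xd D x y e = 0" if x: "x \<in> A" "y \<in> S" "e \<in> ?E - {0}" for x y e
  proof -
    have e: "e \<in> ?E" using x by simp
    let ?a = "deriv (\<lambda>x. G1 x y e) x" and ?a' = "deriv (\<lambda>y. G1 x y e) y"
      and ?b = "deriv (\<lambda>x. G2 x y e) x" and ?b' = "deriv (\<lambda>y. G2 x y e) y"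
    have "((\<lambda>x. D x y e) has_field_derivative e * h y * ?b - (G1 x y e + x * ?a)) (at x)"
      unfolding D_def using d[OF G1 x(1,2) e] d[OF G2 x(1,2) e]
      by (auto intro!: derivative_eq_intros)
    then have 1: "deriv (\<lambda>x. D x y e) x = e * h y * ?b - (G1 x y e + x * ?a)" by (rule DERIV_imp_deriv)
    have "((\<lambda>y. D x y e) has_field_derivative e * deriv h y * G2 x y e + e * h y * ?b' - x * ?a') (at y)"
      unfolding D_def using d[OF G1 x(1,2) e] d[OF G2 x(1,2) e] dh[OF x(2)]
      by (auto intro!: derivative_eq_intros)
    then have 2: "deriv (\<lambda>y. D x y e) y = e * deriv h y * G2 x y e + e * h y * ?b' - x * ?a'" by (rule DERIV_imp_deriv)
    \<comment> \<open>Regrouping exhibits \<open>Xd G2\<close> and \<open>Xd G1\<close>, after which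
      the bracket relations cancel all terms.\<close>
    have "e * h y * (e * h y * ?b - (G1 x y e + x * ?a))
        + x * (e * deriv h y * G2 x y e + e * h y * ?b' - x * ?a')
        = e * h y * (e * h y * ?b + x * ?b') - x * (e * h y * ?a + x * ?a')
          - e * h y * G1 x y e + x * (e * deriv h y * G2 x y e)"
      by (simp add: algebra_simps)
    also have "\<dots> = 0"
      using X1[OF x] X2[OF x] by (simp add: Xd_def)
    finally show ?thesis unfolding Xd_def 1 2 .
  qed
  then have Dc: "D x y e = D x1 y1 e" if "x \<in> A" "y \<in> S" "e \<in> ?E" for x y e
    by (rule first_integral_constant[OF D _ that])
  have "D x1 y1 holomorphic_on ?E" using D A(4) S(4) unfolding hol3_def by blast
  then have hd: "hol3 A S ?E (\<lambda>x y e. D x1 y1 e)" by (rule hol3_thd)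
  have "D x1 y1 e0 \<noteq> 0" using Dc[OF ne(1-3)] ne(4) unfolding D_def by (metis right_minus_eq)
  \<comment> \<open>The base point value of \<open>D\<close>, a function of \<open>e\<close> alone,
    is read as one of three variables so that \<open>hol3_order\<close> applies. Freezing the
    cofactor at \<open>(x', y')\<close> yields \<open>u\<close> with
    \<open>u 0 \<noteq> 0\<close>.\<close>
  then obtain k R x' y' where R: "hol3 A S ?E R"
      "\<And>x y e. x \<in> A \<Longrightarrow> y \<in> S \<Longrightarrow> e \<in> ?E \<Longrightarrow> D x1 y1 e = e^k * R x y e"
      "x' \<in> A" "y' \<in> S" "R x' y' 0 \<noteq> 0"
    using hol3_order[OF hd A(1) S(1) ne(1-3)] by metis
  define u where "u = R x' y'"
  have uhol: "u holomorphic_on ?E" using R unfolding u_def hol3_def by blast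
  have du: "D x1 y1 e = e^k * u e" if "e \<in> ?E" for e using R(2)[OF R(3,4) that] by (simp add: u_def)
  have "isCont u 0"
    using holomorphic_on_imp_continuous_on[OF uhol] r by (simp add: continuous_on_eq_continuous_at)
  then obtain \<delta> where \<delta>: "\<delta> > 0" "\<And>e. dist 0 e < \<delta> \<Longrightarrow> u e \<noteq> 0"
    using continuous_at_avoid[of 0 u 0] R(5) unfolding u_def by metis
  \<comment> \<open>On this disc \<open>u\<close> has no zeros; the chart is instantiated again with
    the smaller radius.\<close>
  define r' where "r' = min r \<delta>"
  have r': "0 < r'" "ball 0 r' \<subseteq> ?E" "\<And>e. e \<in> ball 0 r' \<Longrightarrow> u e \<noteq> 0"
    using r \<delta> by (auto simp: r'_def)
  interpret sub: pole_chart A S r' c \<rho> R0 s h x1 y1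
    by unfold_locales (use A S rho s h r' in auto)
  have uhol': "u holomorphic_on ball 0 r'" using uhol r'(2) holomorphic_on_subset by blast
  have nz: "x \<noteq> 0" if "x \<in> A" for x using A that by auto
  \<comment> \<open>Division by the unit part \<open>u\<close> only: \<open>P\<close> stays
    holomorphic at \<open>e = 0\<close>, and the factor \<open>e^k\<close> of \<open>D\<close>
    remains on the right-hand side.\<close>
  define P where "P = (\<lambda>x y e. G2 x y e / (x * u e))"
  have "hol3 A S (ball 0 r') G2" by (rule hol3_subset[OF G2]) (use r' in auto)
  then have P: "hol3 A S (ball 0 r') P"
    unfolding P_def using r'(3) nz
    by (intro hol3_divide hol3_mult hol3_fst hol3_thd uhol') (auto intro: holomorphic_intros)
  have XP: "Xd P x y e = -1 * e^k / x^2" if x: "x \<in> A" "y \<in> S" "e \<in> ball 0 r' - {0}" for x y e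
  proof -
    have e: "e \<in> ?E" "e \<in> ?E - {0}" "e \<in> ball 0 r'" using x r' by auto
    let ?b = "deriv (\<lambda>x. G2 x y e) x" and ?b' = "deriv (\<lambda>y. G2 x y e) y"
    note [simp] = nz[OF x(1)] r'(3)[OF e(3)]
    have "((\<lambda>x. P x y e) has_field_derivative ?b / (x * u e) - G2 x y e / (x^2 * u e)) (at x)"
      unfolding P_def using d[OF G2 x(1,2) e(1)]
      by (auto intro!: derivative_eq_intros simp: field_simps eval_nat_numeral)
    then have 1: "deriv (\<lambda>x. P x y e) x = ?b / (x * u e) - G2 x y e / (x^2 * u e)" by (rule DERIV_imp_deriv)
    have "((\<lambda>y. P x y e) has_field_derivative ?b' / (x * u e)) (at y)"
      unfolding P_def using d[OF G2 x(1,2) e(1)]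
      by (auto intro!: derivative_eq_intros)
    then have 2: "deriv (\<lambda>y. P x y e) y = ?b' / (x * u e)" by (rule DERIV_imp_deriv)
    have "Xd P x y e = (e * h y * ?b + x * ?b') / (x * u e) - e * h y * G2 x y e / (x^2 * u e)"
      unfolding Xd_def 1 2 by (simp add: field_simps)
    also have "\<dots> = G1 x y e / (x * u e) - e * h y * G2 x y e / (x^2 * u e)"
      using X2[OF x(1,2) e(2)] by (simp add: Xd_def)
    also have "\<dots> = - D x y e / (x^2 * u e)"
      by (simp add: D_def field_simps eval_nat_numeral)
    also have "\<dots> = -1 * e^k / x^2"
      using Dc[OF x(1,2) e(1)] du[OF e(1)] by (simp add: field_simps)
    finally show ?thesis .
  qed
  have hp: "P x1 y1 holomorphic_on ball 0 r'" using P A(4) S(4) unfolding hol3_def by blast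
  show ?thesis
  proof (rule sub.transport_solution[OF P XP])
    fix C
    assume C: "\<And>x y. x \<in> A \<Longrightarrow> y \<in> S \<Longrightarrow>
      ((\<lambda>e. (P x y e - P x1 y1 e) / e^k) \<longlongrightarrow> - 1 * (y - c) / x^3 + C) (at 0)"
    show ?thesis
    proof (rule that[OF r'(1) uhol' hp r'(3)])
      fix x y assume xy: "x \<in> A" "y \<in> S"
      show "((\<lambda>e. (G2 x y e / (x * u e) - P x1 y1 e) / e^k + (y - c) / x^3) \<longlongrightarrow> C) (at 0)"
        using tendsto_add[OF C[OF xy] tendsto_const[of "(y - c) / x^3"]]
        by (simp add: P_def diff_divide_distrib)
    qed
  qed
qed

end

subsection \<open>Meromorphic functions on the extended phase space\<close>

lemma vector_2_axis: "vector [x, y] = axis 1 x + (axis 2 y :: complex^2)"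
  by (simp add: vec_eq_iff forall_2 axis_def)

lemma bounded_linear_axis: "bounded_linear (axis i :: complex \<Rightarrow> complex^'n)"
  unfolding linear_conv_bounded_linear[symmetric]
  by (rule linearI) (auto simp: vec_eq_iff axis_def)

lemma bounded_linear_vector_scalar: "bounded_linear (\<lambda>t::complex. t *s (v :: complex^'n))"
proof -
  have "(\<lambda>t. t *s v) = (\<lambda>t. \<Sum>i\<in>UNIV. axis i (t * v $ i))"
    by (auto simp: vec_eq_iff fun_eq_iff axis_def)
  moreover have "bounded_linear (\<lambda>t. \<Sum>i\<in>UNIV. axis i (t * v $ i))"
    by (intro bounded_linear_sum bounded_linear_compose[OF bounded_linear_axis] bounded_linear_mult_left)
  ultimately show ?thesis by simp
qed

lemma continuous_on_vector_2:
  assumes "continuous_on X f" "continuous_on X g"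
  shows "continuous_on X (\<lambda>p. vector [f p, g p] :: complex^2)"
  unfolding vector_2_axis
  by (intro continuous_intros bounded_linear.continuous_on[OF bounded_linear_axis] assms)

lemma complex_differentiable_at_imp_continuous:
  "complex_differentiable_at g p \<Longrightarrow> isCont g p"
  unfolding complex_differentiable_at_def using has_derivative_continuous by blast

text \<open>Complex linearity of the total derivative \<open>D\<close> makes its restriction to a
  complex line multiplication by the number \<open>D (v, w)\<close>.\<close>

lemma complex_differentiable_at_line:
  assumes "complex_differentiable_at g (y + t *s v, e + t * w)"
  shows "\<exists>d. ((\<lambda>t. g (y + t *s v, e + t * w)) has_field_derivative d) (at t)"
proof -
  obtain D where D: "(g has_derivative D) (at (y + t *s v, e + t * w))"
    "\<And>c v e. D (c *s v, c * e) = c * D (v, e)"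
    using assms unfolding complex_differentiable_at_def by blast
  have "((\<lambda>t. (y + t *s v, e + t * w)) has_derivative (\<lambda>s. (s *s v, s * w))) (at t)"
    by (auto intro!: derivative_eq_intros bounded_linear.has_derivative[OF bounded_linear_vector_scalar])
  from has_derivative_compose[OF this D(1)]
  have "((\<lambda>t. g (y + t *s v, e + t * w)) has_derivative (\<lambda>s. s * D (v, w))) (at t)"
    by (simp add: D(2))
  then show ?thesis
    unfolding has_field_derivative_def
    by (intro exI[of _ "D (v, w)"]) (simp add: mult_commute_abs)
qed

lemma complex_differentiable_at_mult:
  assumes "complex_differentiable_at g p" "complex_differentiable_at h p"
  shows "complex_differentiable_at (\<lambda>p. g p * h p) p"
proof -
  obtain D D' where "(g has_derivative D) (at p)" "\<And>c v e. D (c *s v, c * e) = c * D (v, e)"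
    "(h has_derivative D') (at p)" "\<And>c v e. D' (c *s v, c * e) = c * D' (v, e)"
    using assms unfolding complex_differentiable_at_def by blast
  then show ?thesis unfolding complex_differentiable_at_def
    by (intro exI[of _ "\<lambda>q. g p * D' q + D q * h p"] conjI has_derivative_mult)
       (auto simp: algebra_simps)
qed

lemma complex_differentiable_at_compose:
  assumes "complex_differentiable_at g p" "(\<phi> has_field_derivative d) (at (g p))"
  shows "complex_differentiable_at (\<lambda>p. \<phi> (g p)) p"
proof -
  obtain D where D: "(g has_derivative D) (at p)" "\<And>c v e. D (c *s v, c * e) = c * D (v, e)"
    using assms unfolding complex_differentiable_at_def by blast
  show ?thesis unfolding complex_differentiable_at_def
    using has_derivative_compose[OF D(1) assms(2)[unfolded has_field_derivative_def]]
    by (intro exI[of _ "\<lambda>q. d * D q"]) (auto simp: D(2))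
qed

lemma complex_differentiable_at_component:
  "complex_differentiable_at (\<lambda>p. fst p $ i) p"
  "complex_differentiable_at (\<lambda>p. snd p) p"
proof -
  have "((\<lambda>p. fst p $ i) has_derivative (\<lambda>p. fst p $ i)) (at p)"
    by (intro bounded_linear.has_derivative[OF bounded_linear_vec_nth] has_derivative_fst has_derivative_ident)
  then show "complex_differentiable_at (\<lambda>p. fst p $ i) p"
    unfolding complex_differentiable_at_def by (intro exI[of _ "\<lambda>p. fst p $ i"]) simp
  have "((\<lambda>p. snd p) has_derivative (\<lambda>p. snd p)) (at p)"
    by (intro has_derivative_snd has_derivative_ident)
  then show "complex_differentiable_at (\<lambda>p. snd p) p"
    unfolding complex_differentiable_at_def by (intro exI[of _ snd]) simp
qed

lemma complex_differentiable_at_transform: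
  assumes "complex_differentiable_at g p" "open W" "p \<in> W" "\<And>q. q \<in> W \<Longrightarrow> F q = g q"
  shows "complex_differentiable_at F p"
proof -
  obtain D where D: "(g has_derivative D) (at p)" "\<And>c v e. D (c *s v, c * e) = c * D (v, e)"
    using assms unfolding complex_differentiable_at_def by blast
  have "(F has_derivative D) (at p)"
    by (rule has_derivative_transform_within_open[OF D(1) assms(2,3)]) (use assms(4) in auto)
  with D(2) show ?thesis unfolding complex_differentiable_at_def by blast
qed

section \<open>Holomorphic quotients and the identity theorem in several variables\<close>

lemma holomorphic_near_quotient:
  assumes V: "open V" "\<And>x. x \<in> V \<Longrightarrow> complex_differentiable_at g x \<and> complex_differentiable_at h x"
    and F: "\<And>x. x \<in> V \<Longrightarrow> h x \<noteq> 0 \<Longrightarrow> F x = g x / h x" and p: "p \<in> V" "h p \<noteq> 0"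
  shows "holomorphic_near F p"
proof -
  let ?W = "V \<inter> h -` (- {0})"
  have "continuous_on V h"
    using V(2) complex_differentiable_at_imp_continuous continuous_at_imp_continuous_on by blast
  then have W: "open ?W" using V(1) by (intro continuous_open_preimage) auto
  have "complex_differentiable_at F x" if x: "x \<in> ?W" for x
  proof (rule complex_differentiable_at_transform[OF _ W x])
    show "complex_differentiable_at (\<lambda>x. g x * inverse (h x)) x"
      using V(2) x
      by (intro complex_differentiable_at_mult complex_differentiable_at_compose[OF _ DERIV_inverse]) auto
  qed (use F in \<open>auto simp: field_simps\<close>)
  then show ?thesis unfolding holomorphic_near_def using W p by blast
qed

text \<open>The interior \<open>Z\<close> of the zero set is relatively closed in \<open>V\<close>:
  a small ball around a limit point contains some \<open>q\<close> in \<open>Z\<close>, and along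
  every complex line through \<open>q\<close> the one-variable identity theorem spreads the zeros
  over the ball. Connectedness of \<open>V\<close> then gives \<open>Z = V\<close>.\<close>

lemma complex_differentiable_identity:
  fixes h :: "(complex^'n) \<times> complex \<Rightarrow> complex"
  assumes V: "open V" "connected V" "\<And>x. x \<in> V \<Longrightarrow> complex_differentiable_at h x"
    and W: "open W" "W \<subseteq> V" "W \<noteq> {}" "\<And>x. x \<in> W \<Longrightarrow> h x = 0"
    and x: "x \<in> V"
  shows "h x = 0"
proof -
  define Z where "Z = interior {x\<in>V. h x = 0}"
  have Z: "open Z" "Z \<subseteq> V" "\<And>x. x \<in> Z \<Longrightarrow> h x = 0"
    unfolding Z_def using interior_subset by auto
  have WZ: "W \<subseteq> Z" unfolding Z_def using W by (intro interior_maximal) auto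
  have cl: "p \<in> Z" if p: "p \<in> V" "p \<in> closure Z" for p
  proof -
    obtain \<delta> where \<delta>: "\<delta> > 0" "ball p \<delta> \<subseteq> V" using V(1) p(1) open_contains_ball by blast
    obtain q where q: "q \<in> Z" "dist q p < \<delta>" using p(2) \<delta>(1) closure_approachable by blast
    have "h p' = 0" if p': "p' \<in> ball p \<delta>" for p'
    proof -
      define v w where "v = fst p' - fst q" and "w = snd p' - snd q"
      \<comment> \<open>The complex line through \<open>q\<close> and \<open>p'\<close>. Its part
        \<open>T\<close> over the ball is convex because \<open>l\<close> is affine, hence
        connected.\<close>
      define l where "l = (\<lambda>t. (fst q + t *s v, snd q + t * w))"
      define T where "T = l -` ball p \<delta>"
      have l01: "l 0 = q" "l 1 = p'" by (auto simp: l_def v_def w_def)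
      have l_aff: "l (a *\<^sub>R s + b *\<^sub>R t) = a *\<^sub>R l s + b *\<^sub>R l t" if "a + b = 1" for a b s t
      proof -
        have b: "b = 1 - a" using that by simp
        show ?thesis unfolding l_def b
          by (simp add: vec_eq_iff scaleR_left_diff_distrib scaleR_right_distrib algebra_simps)
      qed
      have lc: "isCont l t" for t
        unfolding l_def
        by (intro continuous_intros bounded_linear.isCont[OF bounded_linear_vector_scalar])
      have "convex T" unfolding T_def
      proof (rule convexI)
        fix s t u w' assume "s \<in> l -` ball p \<delta>" "t \<in> l -` ball p \<delta>" "0 \<le> u" "0 \<le> w'" "u + w' = (1::real)"
        then show "u *\<^sub>R s + w' *\<^sub>R t \<in> l -` ball p \<delta>"
          using convexD[OF convex_ball, of "l s" p \<delta> "l t" u w'] by (simp add: l_aff)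
      qed
      have "open T" unfolding T_def
        using lc by (intro continuous_open_vimage continuous_at_imp_continuous_on) auto
      have "open (l -` Z)"
        using lc Z(1) by (intro continuous_open_vimage continuous_at_imp_continuous_on) auto
      then have oZ: "open (T \<inter> l -` Z)" using \<open>open T\<close> by blast
      have hol: "(\<lambda>t. h (l t)) holomorphic_on T"
        unfolding holomorphic_on_open[OF \<open>open T\<close>]
      proof
        fix t assume "t \<in> T"
        then have "l t \<in> V" using \<delta>(2) by (auto simp: T_def)
        then have "complex_differentiable_at h (l t)" by (rule V(3))
        then show "\<exists>d. ((\<lambda>t. h (l t)) has_field_derivative d) (at t)"
          unfolding l_def by (rule complex_differentiable_at_line)
      qed
      have "0 \<in> T" "1 \<in> T" using l01 q p' by (auto simp: T_def dist_commute)
      have "h (l 1) = 0"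
      proof (rule analytic_continuation_open[where f = "\<lambda>t. h (l t)" and g = "\<lambda>t. 0" and s = "T \<inter> l -` Z" and s' = T])
        show "T \<inter> l -` Z \<noteq> {}" using \<open>0 \<in> T\<close> l01 q by auto
        show "connected T" using \<open>convex T\<close> convex_connected by blast
      qed (use oZ \<open>open T\<close> hol Z \<open>1 \<in> T\<close> in auto)
      then show ?thesis by (simp add: l01)
    qed
    then have "ball p \<delta> \<subseteq> {x\<in>V. h x = 0}" using \<delta>(2) by auto
    then have "ball p \<delta> \<subseteq> Z" unfolding Z_def by (simp add: interior_maximal)
    then show ?thesis using \<delta>(1) by auto
  qed
  have "V \<inter> Z = {} \<or> V \<inter> (- closure Z) = {}"
    using connectedD[OF V(2) Z(1), of "- closure Z"] cl closure_subset[of Z] by blast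
  then have "V \<subseteq> Z" using cl WZ W(2,3) by blast
  then show ?thesis using Z(3) x by blast
qed

text \<open>The passage from phase space to separate variables: each variable is moved along a
  coordinate line, where complex linearity of the derivative gives holomorphy.\<close>

lemma hol3_of_complex_differentiable:
  assumes op: "open A" "open S" "open E"
    and g: "\<And>x y e. x \<in> A \<Longrightarrow> y \<in> S \<Longrightarrow> e \<in> E \<Longrightarrow> complex_differentiable_at g (vector [x, y] :: complex^2, e)"
  shows "hol3 A S E (\<lambda>x y e. g (vector [x, y], e))"
  unfolding hol3_def
proof (intro conjI ballI)
  have "continuous_on (A \<times> S \<times> E) (\<lambda>p. g (vector [fst p, fst (snd p)], snd (snd p)))"
  proof (rule continuous_on_compose2[where t = "(\<lambda>p. (vector [fst p, fst (snd p)], snd (snd p))) ` (A \<times> S \<times> E)" and g = g])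
    show "continuous_on ((\<lambda>p. (vector [fst p, fst (snd p)] :: complex^2, snd (snd p))) ` (A \<times> S \<times> E)) g"
    proof (rule continuous_at_imp_continuous_on, rule ballI)
      fix p assume "p \<in> (\<lambda>p. (vector [fst p, fst (snd p)] :: complex^2, snd (snd p))) ` (A \<times> S \<times> E)"
      then obtain x y e where "p = (vector [x, y], e)" "x \<in> A" "y \<in> S" "e \<in> E" by auto
      then show "isCont g p" using complex_differentiable_at_imp_continuous[OF g, of x y e] by simp
    qed
    show "continuous_on (A \<times> S \<times> E) (\<lambda>p. (vector [fst p, fst (snd p)] :: complex^2, snd (snd p)))"
      by (intro continuous_on_vector_2 continuous_intros)
  qed auto
  then show "continuous_on (A \<times> S \<times> E) (\<lambda>(x, y, e). g (vector [x, y], e))"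
    by (simp add: case_prod_beta)
next
  fix y e assume "y \<in> S" "e \<in> E"
  have eq: "(vector [x, y], e) = (vector [0, y] + x *s axis 1 1 :: complex^2, e + x * 0)" for x
    by (simp add: vec_eq_iff forall_2 axis_def)
  show "(\<lambda>x. g (vector [x, y], e)) holomorphic_on A"
    unfolding holomorphic_on_open[OF op(1)]
    using g[OF _ \<open>y \<in> S\<close> \<open>e \<in> E\<close>] complex_differentiable_at_line[of g "vector [0, y]" _ "axis 1 1" e 0]
    unfolding eq by blast
next
  fix x e assume "x \<in> A" "e \<in> E"
  have eq: "(vector [x, y], e) = (vector [x, 0] + y *s axis 2 1 :: complex^2, e + y * 0)" for y
    by (simp add: vec_eq_iff forall_2 axis_def)
  show "(\<lambda>y. g (vector [x, y], e)) holomorphic_on S"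
    unfolding holomorphic_on_open[OF op(2)]
    using g[OF \<open>x \<in> A\<close> _ \<open>e \<in> E\<close>] complex_differentiable_at_line[of g "vector [x, 0]" _ "axis 2 1" e 0]
    unfolding eq by blast
next
  fix x y assume "x \<in> A" "y \<in> S"
  have eq: "(vector [x, y], e) = (vector [x, y] + e *s 0 :: complex^2, 0 + e * 1)" for e
    by (simp add: vec_eq_iff forall_2)
  show "(\<lambda>e. g (vector [x, y], e)) holomorphic_on E"
    unfolding holomorphic_on_open[OF op(3)]
    using g[OF \<open>x \<in> A\<close> \<open>y \<in> S\<close>] complex_differentiable_at_line[of g "vector [x, y]" _ 0 0 1]
    unfolding eq by blast
qed

lemma open_polydisc:
  fixes x0 y0 e0 :: complex
  assumes "open W" "(x0, y0, e0) \<in> W"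
  obtains \<delta> where "0 < \<delta>" "ball x0 \<delta> \<times> ball y0 \<delta> \<times> ball e0 \<delta> \<subseteq> W"
proof -
  obtain A B where 1: "open A" "open B" "(x0, y0, e0) \<in> A \<times> B" "A \<times> B \<subseteq> W"
    using open_prod_elim[OF assms] by metis
  then have B: "(y0, e0) \<in> B" by simp
  obtain S E where 2: "open S" "open E" "(y0, e0) \<in> S \<times> E" "S \<times> E \<subseteq> B"
    using open_prod_elim[OF 1(2) B] by metis
  have "x0 \<in> A" "y0 \<in> S" "e0 \<in> E" using 1(3) 2(3) by auto
  then obtain a b d where "a > 0" "ball x0 a \<subseteq> A" "b > 0" "ball y0 b \<subseteq> S" "d > 0" "ball e0 d \<subseteq> E"
    using 1(1) 2(1,2) open_contains_ball by metis
  with 1 2 show ?thesis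
    by (intro that[of "min a (min b d)"]) (auto simp: subset_iff)
qed

text \<open>The zeros first fill a small polydisc inside \<open>W\<close>; the one-variable identity
  theorem then enlarges its factors to \<open>A\<close>, \<open>S\<close> and \<open>E\<close>, one
  at a time.\<close>

lemma hol3_identity:
  assumes f: "hol3 A S E f" and dom: "open A" "connected A" "open S" "connected S" "open E" "connected E"
    and W: "open W" "W \<subseteq> A \<times> S \<times> E" "W \<noteq> {}" "\<And>x y e. (x, y, e) \<in> W \<Longrightarrow> f x y e = 0"
    and x: "x \<in> A" "y \<in> S" "e \<in> E"
  shows "f x y e = 0"
proof -
  obtain p0 where "p0 \<in> W" using W(3) by blast
  then obtain x0 y0 e0 where p0: "(x0, y0, e0) \<in> W" by (cases p0) auto
  obtain \<delta> where \<delta>: "0 < \<delta>" "ball x0 \<delta> \<times> ball y0 \<delta> \<times> ball e0 \<delta> \<subseteq> W"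
    using open_polydisc[OF W(1) p0] .
  let ?a = "ball x0 \<delta>" and ?b = "ball y0 \<delta>" and ?d = "ball e0 \<delta>"
  have sub: "?a \<subseteq> A" "?b \<subseteq> S" "?d \<subseteq> E"
    using \<delta> W(2) by (auto simp: subset_iff) (metis centre_in_ball mem_ball)+
  have ne: "?a \<noteq> {}" "?b \<noteq> {}" "?d \<noteq> {}" using \<delta>(1) by auto
  have hx: "\<And>y e. y \<in> S \<Longrightarrow> e \<in> E \<Longrightarrow> (\<lambda>x. f x y e) holomorphic_on A"
    and hy: "\<And>x e. x \<in> A \<Longrightarrow> e \<in> E \<Longrightarrow> (\<lambda>y. f x y e) holomorphic_on S"
    and he: "\<And>x y. x \<in> A \<Longrightarrow> y \<in> S \<Longrightarrow> (\<lambda>e. f x y e) holomorphic_on E"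
    using f unfolding hol3_def by auto
  have 0: "f x y e = 0" if "x \<in> ?a" "y \<in> ?b" "e \<in> ?d" for x y e
    using W(4)[OF subsetD[OF \<delta>(2)]] that by simp
  have 1: "f x y e = 0" if "x \<in> A" "y \<in> ?b" "e \<in> ?d" for x y e
    by (rule analytic_continuation_open[where s = ?a and s' = A and f = "\<lambda>x. f x y e" and g = "\<lambda>x. 0"])
       (use that sub ne 0 dom hx[OF subsetD[OF sub(2) that(2)] subsetD[OF sub(3) that(3)]] in auto)
  have 2: "f x y e = 0" if "x \<in> A" "y \<in> S" "e \<in> ?d" for x y e
    by (rule analytic_continuation_open[where s = ?b and s' = S and f = "\<lambda>y. f x y e" and g = "\<lambda>y. 0"])
       (use that sub ne 1 dom hy[OF that(1) subsetD[OF sub(3) that(3)]] in auto)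
  show ?thesis
    by (rule analytic_continuation_open[where s = ?d and s' = E and f = "\<lambda>e. f x y e" and g = "\<lambda>e. 0"])
       (use x sub ne 2 dom he in auto)
qed

lemma hol3_open_nonzero:
  assumes f: "hol3 A S E f" and "open A" "open S" "open E"
  shows "open {(x, y, e). x \<in> A \<and> y \<in> S \<and> e \<in> E \<and> f x y e \<noteq> 0}"
proof -
  have "open ((A \<times> S \<times> E) \<inter> (\<lambda>(x, y, e). f x y e) -` (- {0}))"
    using assms unfolding hol3_def by (intro continuous_open_preimage open_Times) auto
  also have "(A \<times> S \<times> E) \<inter> (\<lambda>(x, y, e). f x y e) -` (- {0}) = {(x, y, e). x \<in> A \<and> y \<in> S \<and> e \<in> E \<and> f x y e \<noteq> 0}"
    by auto
  finally show ?thesis .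
qed

text \<open>There are no zero divisors over a connected domain: if the product vanished,
  \<open>g\<close> would vanish on the nonempty open set where \<open>f\<close> does not, hence
  everywhere.\<close>

lemma hol3_mult_nonzero:
  assumes fg: "hol3 A S E f" "hol3 A S E g"
    and dom: "open A" "connected A" "open S" "connected S" "open E" "connected E"
    and f: "\<exists>x\<in>A. \<exists>y\<in>S. \<exists>e\<in>E. f x y e \<noteq> 0" and g: "\<exists>x\<in>A. \<exists>y\<in>S. \<exists>e\<in>E. g x y e \<noteq> 0"
  shows "\<exists>x\<in>A. \<exists>y\<in>S. \<exists>e\<in>E. f x y e * g x y e \<noteq> 0"
proof (rule ccontr)
  assume "\<not> ?thesis"
  then have "g x y e = 0" if "(x, y, e) \<in> {(x, y, e). x \<in> A \<and> y \<in> S \<and> e \<in> E \<and> f x y e \<noteq> 0}" for x y e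
    using that by auto
  then have "g x y e = 0" if "x \<in> A" "y \<in> S" "e \<in> E" for x y e
    using f by (intro hol3_identity[OF fg(2) dom hol3_open_nonzero[OF fg(1) dom(1,3,5)] _ _ _ that]) auto
  with g show False by blast
qed

lemma vector_polydisc:
  fixes U :: "((complex^2) \<times> complex) set"
  assumes "open U" "(vector [x0, y0], e0) \<in> U"
  obtains \<delta> where "0 < \<delta>"
    "\<And>x y e. x \<in> ball x0 \<delta> \<Longrightarrow> y \<in> ball y0 \<delta> \<Longrightarrow> e \<in> ball e0 \<delta> \<Longrightarrow> (vector [x, y], e) \<in> U"
proof -
  let ?\<psi> = "\<lambda>p. (vector [fst p, fst (snd p)] :: complex^2, snd (snd p))"
  have "continuous_on UNIV ?\<psi>" by (intro continuous_on_vector_2 continuous_intros)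
  then have "open (?\<psi> -` U)" using assms(1) open_vimage by blast
  moreover have "(x0, y0, e0) \<in> ?\<psi> -` U" using assms(2) by simp
  ultimately obtain \<delta> where \<delta>: "0 < \<delta>" "ball x0 \<delta> \<times> ball y0 \<delta> \<times> ball e0 \<delta> \<subseteq> ?\<psi> -` U"
    by (rule open_polydisc)
  have "(vector [x, y], e) \<in> U" if "x \<in> ball x0 \<delta>" "y \<in> ball y0 \<delta>" "e \<in> ball e0 \<delta>" for x y e
    using subsetD[OF \<delta>(2), of "(x, y, e)"] that by simp
  with \<delta>(1) show ?thesis by (rule that)
qed

text \<open>A local denominator is only known to be nonzero somewhere in the connected set
  \<open>V\<close>. The identity theorem carries this into every smaller polydisc around the point,
  which is needed once radii shrink to fit several functions together.\<close>

lemma meromorphic_chart: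
  fixes F :: "(complex^2) \<times> complex \<Rightarrow> complex"
  assumes "meromorphic_in F U" "(vector [x0, y0], 0) \<in> U"
  obtains \<delta> g h where "0 < \<delta>" "hol3 (ball x0 \<delta>) (ball y0 \<delta>) (ball 0 \<delta>) g" "hol3 (ball x0 \<delta>) (ball y0 \<delta>) (ball 0 \<delta>) h"
    and "\<And>\<delta>'. 0 < \<delta>' \<Longrightarrow> \<delta>' \<le> \<delta> \<Longrightarrow> \<exists>x\<in>ball x0 \<delta>'. \<exists>y\<in>ball y0 \<delta>'. \<exists>e\<in>ball 0 \<delta>'. h x y e \<noteq> 0"
    and "\<And>x y e. x \<in> ball x0 \<delta> \<Longrightarrow> y \<in> ball y0 \<delta> \<Longrightarrow> e \<in> ball 0 \<delta> \<Longrightarrow> h x y e \<noteq> 0 \<Longrightarrow>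
           F (vector [x, y], e) = g x y e / h x y e \<and> holomorphic_near F (vector [x, y], e)"
proof -
  from assms(1)[unfolded meromorphic_in_def, rule_format, OF assms(2)]
  obtain V g h where V0: "open V" "connected V" "(vector [x0, y0], 0) \<in> V"
    "\<forall>x\<in>V. complex_differentiable_at g x \<and> complex_differentiable_at h x"
    "\<exists>x\<in>V. h x \<noteq> 0" "\<forall>x\<in>V. h x \<noteq> 0 \<longrightarrow> F x = g x / h x"
    by (elim exE conjE)
  note V = V0(1-3) V0(4)[rule_format] V0(5) V0(6)[rule_format]
  obtain \<delta> where \<delta>: "0 < \<delta>" "\<And>x y e. x \<in> ball x0 \<delta> \<Longrightarrow> y \<in> ball y0 \<delta> \<Longrightarrow> e \<in> ball 0 \<delta> \<Longrightarrow> (vector [x, y], e) \<in> V"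
    by (rule vector_polydisc[OF V(1,3)]) (rule that)
  note inV = \<delta>(2)
  show ?thesis
  proof (rule that[OF \<delta>(1)])
    show "hol3 (ball x0 \<delta>) (ball y0 \<delta>) (ball 0 \<delta>) (\<lambda>x y e. g (vector [x, y], e))"
      "hol3 (ball x0 \<delta>) (ball y0 \<delta>) (ball 0 \<delta>) (\<lambda>x y e. h (vector [x, y], e))"
      using V(4) inV by (auto intro!: hol3_of_complex_differentiable)
    show "\<exists>x\<in>ball x0 \<delta>'. \<exists>y\<in>ball y0 \<delta>'. \<exists>e\<in>ball 0 \<delta>'. h (vector [x, y], e) \<noteq> 0" if \<delta>': "0 < \<delta>'" "\<delta>' \<le> \<delta>" for \<delta>'
    proof (rule ccontr)
      assume neg: "\<not> ?thesis"
      let ?W = "((\<lambda>p::(complex^2) \<times> complex. fst p $ 1) -` ball x0 \<delta>') \<inter> ((\<lambda>p. fst p $ 2) -` ball y0 \<delta>') \<inter> snd -` ball 0 \<delta>'"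
      have "open ?W" by (intro open_Int open_vimage open_ball continuous_intros)
      have pW: "p = (vector [fst p $ 1, fst p $ 2], snd p)" for p :: "(complex^2) \<times> complex"
        by (cases p) (simp add: vec_eq_iff forall_2)
      have "h x = 0" if "x \<in> V" for x
      proof (rule complex_differentiable_identity[OF V(1,2) _ \<open>open ?W\<close> _ _ _ that])
        show "?W \<subseteq> V"
        proof
          fix p assume "p \<in> ?W"
          then show "p \<in> V" using inV[of "fst p $ 1" "fst p $ 2" "snd p"] pW[of p] \<delta>' by auto
        qed
        have "(vector [x0, y0], 0) \<in> ?W" using \<delta>' by simp
        then show "?W \<noteq> {}" by blast
        show "h p = 0" if "p \<in> ?W" for p
        proof -
          have "fst p $ 1 \<in> ball x0 \<delta>'" "fst p $ 2 \<in> ball y0 \<delta>'" "snd p \<in> ball 0 \<delta>'"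
            using that by auto
          then have "h (vector [fst p $ 1, fst p $ 2], snd p) = 0" using neg by blast
          then show ?thesis using pW[of p] by simp
        qed
      qed (use V(4) in blast)
      with V(5) show False by blast
    qed
    show "F (vector [x, y], e) = g (vector [x, y], e) / h (vector [x, y], e) \<and> holomorphic_near F (vector [x, y], e)"
      if "x \<in> ball x0 \<delta>" "y \<in> ball y0 \<delta>" "e \<in> ball 0 \<delta>" "h (vector [x, y], e) \<noteq> 0" for x y e
      using V(6) holomorphic_near_quotient[OF V(1,4,6)] inV that by blast
  qed
qed

subsection \<open>Charts at the pole of the force\<close>

text \<open>\<open>cos c = cosh (arcosh (1 / \<kappa>)) = 1 / \<kappa>\<close>, so the denominator
  vanishes at \<open>c\<close>. Its derivative there is \<open>\<kappa> * sin c\<close>, nonzero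
  because \<open>1 / \<kappa>\<close> differs from 1 and -1; the pole is simple, with residue
  \<open>1 / \<kappa>\<close>.\<close>

lemma rotor_force_pole:
  assumes \<kappa>: "0 < \<kappa>" "\<kappa> < 1" and c: "c = \<i> * of_real (arcosh (1 / \<kappa>))"
  obtains R0 s where "0 < R0" "s holomorphic_on ball c R0" "s c \<noteq> 0"
    and "\<And>y. y \<in> ball c R0 \<Longrightarrow> y \<noteq> c \<Longrightarrow> 1 - of_real \<kappa> * cos y \<noteq> 0"
    and "\<And>y. y \<in> ball c R0 \<Longrightarrow> y \<noteq> c \<Longrightarrow> sin y / (1 - of_real \<kappa> * cos y) + 1 = s y / (y - c)"
proof -
  have "cosh (of_real x :: complex) = of_real (cosh x)" for x :: real
    by (simp add: cosh_def scaleR_conv_of_real exp_of_real flip: of_real_minus)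
  then have cosc: "cos c = of_real (1 / \<kappa>)"
    using \<kappa> unfolding c cosh_conv_cos[symmetric] by simp
  have "sin c \<noteq> 0"
  proof
    assume "sin c = 0"
    then have "(cos c)^2 = 1" using sin_cos_squared_add[of c] by simp
    then have "of_real ((1 / \<kappa>)^2) = (1 :: complex)" unfolding cosc of_real_power .
    then have "(1 / \<kappa>)^2 = 1" using of_real_eq_1_iff by blast
    then show False using \<kappa> by (simp add: power2_eq_1_iff divide_eq_eq)
  qed
  define D where "D = (\<lambda>y. 1 - of_real \<kappa> * cos y :: complex)"
  have Dc: "D c = 0" using \<kappa> by (simp add: D_def cosc)
  have "D holomorphic_on UNIV" unfolding D_def by (intro holomorphic_intros)
  \<comment> \<open>The denominator divided by its simple zero, with the derivative as the value at
    \<open>c\<close>.\<close>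
  define k where "k = (\<lambda>y. if y = c then deriv D c else (D y - D c) / (y - c))"
  have k: "k holomorphic_on UNIV"
    unfolding k_def by (rule pole_lemma_open) (fact | simp)+
  have Dk: "D y = (y - c) * k y" for y by (simp add: k_def Dc)
  have "(D has_field_derivative of_real \<kappa> * sin c) (at c)"
    unfolding D_def by (auto intro!: derivative_eq_intros)
  then have kc: "k c \<noteq> 0"
    using \<open>sin c \<noteq> 0\<close> \<kappa> by (simp add: k_def DERIV_imp_deriv)
  have "isCont k c" using holomorphic_on_imp_continuous_on[OF k] by (simp add: continuous_on_eq_continuous_at)
  then obtain R0 where R0: "R0 > 0" "\<And>y. dist c y < R0 \<Longrightarrow> k y \<noteq> 0"
    using continuous_at_avoid[of c k 0] kc by blast
  show ?thesis
  \<comment> \<open>The summand \<open>y - c\<close> accounts for the constant term 1 of the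
    force.\<close>
  proof (rule that[OF R0(1), of "\<lambda>y. sin y / k y + (y - c)"])
    show "(\<lambda>y. sin y / k y + (y - c)) holomorphic_on ball c R0"
      using R0(2) by (intro holomorphic_intros holomorphic_on_subset[OF k]) auto
    show "sin c / k c + (c - c) \<noteq> 0" using kc \<open>sin c \<noteq> 0\<close> by simp
    fix y assume y: "y \<in> ball c R0" "y \<noteq> c"
    have ky: "k y \<noteq> 0" using R0(2) y(1) by simp
    have Dy: "1 - of_real \<kappa> * cos y = (y - c) * k y" using Dk[of y] by (simp add: D_def)
    show "1 - of_real \<kappa> * cos y \<noteq> 0" using ky y(2) unfolding Dy by simp
    show "sin y / (1 - of_real \<kappa> * cos y) + 1 = (sin y / k y + (y - c)) / (y - c)"
      unfolding Dy using ky y(2) by (simp add: field_simps)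
  qed
qed

text \<open>Used to find a circle around the pole on which the leading coefficient of a denominator
  has no zeros, even if it vanishes at the pole. Zeros being isolated, every sufficiently small
  circle will do.\<close>

lemma holomorphic_nonzero_circle:
  assumes f: "f holomorphic_on ball c \<delta>" and ne: "z0 \<in> ball c \<delta>" "f z0 \<noteq> 0"
  obtains \<rho> where "0 < \<rho>" "\<rho> < \<delta>" "\<And>z. z \<in> sphere c \<rho> \<Longrightarrow> f z \<noteq> 0"
proof -
  have \<delta>: "0 < \<delta>" using ne(1) by (metis ball_empty empty_iff linorder_not_le)
  obtain r where r: "0 < r" "r \<le> \<delta>" "\<And>z. z \<in> ball c r - {c} \<Longrightarrow> f z \<noteq> 0"
  proof (cases "f c = 0")
    case True
    show ?thesis
    proof (rule isolated_zeros[OF f open_ball connected_ball _ True ne])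
      show "c \<in> ball c \<delta>" using \<delta> by simp
      fix r assume r: "0 < r" "ball c r \<subseteq> ball c \<delta>" "\<And>z. z \<in> ball c r - {c} \<Longrightarrow> f z \<noteq> 0"
      show ?thesis using r \<delta> by (intro that[of "min r \<delta>"]) auto
    qed
  next
    case False
    have "isCont f c"
      using holomorphic_on_imp_continuous_on[OF f] \<delta> by (simp add: continuous_on_eq_continuous_at)
    then obtain r where "r > 0" "\<And>y. dist c y < r \<Longrightarrow> f y \<noteq> 0"
      using continuous_at_avoid[of c f 0] False by blast
    then show ?thesis using \<delta> by (intro that[of "min r \<delta>"]) auto
  qed
  show ?thesis
    by (rule that[of "r / 2"]) (use r in \<open>auto simp: dist_commute\<close>)
qed

text \<open>After removing \<open>e^m\<close> from a common denominator, the cofactor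
  \<open>H1\<close> at \<open>e = 0\<close> and a suitable \<open>x1\<close> has no zeros on some
  circle around \<open>c\<close>. By compactness this persists for \<open>x\<close> near
  \<open>x1\<close>, \<open>y\<close> in a thin annulus and \<open>e\<close> small, where both
  functions become holomorphic after multiplication by \<open>e^m\<close>.\<close>

lemma meromorphic_pair_annulus:
  fixes F1 F2 :: "(complex^2) \<times> complex \<Rightarrow> complex"
  assumes U: "open U" "(vector [x0, c], 0) \<in> U" and mer: "meromorphic_in F1 U" "meromorphic_in F2 U"
    and "0 < \<delta>0"
  obtains A S r \<rho> x1 y1 G1 G2 and m :: nat where
    "open A" "connected A" "A \<subseteq> ball x0 \<delta>0" "x1 \<in> A"
    "open S" "connected S" "sphere c \<rho> \<subseteq> S" "S \<subseteq> ball c \<delta>0 - {c}" "y1 \<in> S"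
    "0 < \<rho>" "\<rho> < \<delta>0" "0 < r" "r \<le> \<delta>0"
    "hol3 A S (ball 0 r) G1" "hol3 A S (ball 0 r) G2"
    "\<And>x y e. x \<in> A \<Longrightarrow> y \<in> S \<Longrightarrow> e \<in> ball 0 r - {0} \<Longrightarrow>
      F1 (vector [x, y], e) = G1 x y e / e^m \<and> F2 (vector [x, y], e) = G2 x y e / e^m \<and>
      holomorphic_near F1 (vector [x, y], e) \<and> holomorphic_near F2 (vector [x, y], e)"
proof -
  obtain \<delta>1 g1 h1 where 1: "0 < \<delta>1" "hol3 (ball x0 \<delta>1) (ball c \<delta>1) (ball 0 \<delta>1) g1" "hol3 (ball x0 \<delta>1) (ball c \<delta>1) (ball 0 \<delta>1) h1"
    "\<And>\<delta>'. 0 < \<delta>' \<Longrightarrow> \<delta>' \<le> \<delta>1 \<Longrightarrow> \<exists>x\<in>ball x0 \<delta>'. \<exists>y\<in>ball c \<delta>'. \<exists>e\<in>ball 0 \<delta>'. h1 x y e \<noteq> 0"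
    "\<And>x y e. x \<in> ball x0 \<delta>1 \<Longrightarrow> y \<in> ball c \<delta>1 \<Longrightarrow> e \<in> ball 0 \<delta>1 \<Longrightarrow> h1 x y e \<noteq> 0 \<Longrightarrow>
       F1 (vector [x, y], e) = g1 x y e / h1 x y e \<and> holomorphic_near F1 (vector [x, y], e)"
    by (rule meromorphic_chart[OF mer(1) U(2)]) (rule that)
  obtain \<delta>2 g2 h2 where 2: "0 < \<delta>2" "hol3 (ball x0 \<delta>2) (ball c \<delta>2) (ball 0 \<delta>2) g2" "hol3 (ball x0 \<delta>2) (ball c \<delta>2) (ball 0 \<delta>2) h2"
    "\<And>\<delta>'. 0 < \<delta>' \<Longrightarrow> \<delta>' \<le> \<delta>2 \<Longrightarrow> \<exists>x\<in>ball x0 \<delta>'. \<exists>y\<in>ball c \<delta>'. \<exists>e\<in>ball 0 \<delta>'. h2 x y e \<noteq> 0"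
    "\<And>x y e. x \<in> ball x0 \<delta>2 \<Longrightarrow> y \<in> ball c \<delta>2 \<Longrightarrow> e \<in> ball 0 \<delta>2 \<Longrightarrow> h2 x y e \<noteq> 0 \<Longrightarrow>
       F2 (vector [x, y], e) = g2 x y e / h2 x y e \<and> holomorphic_near F2 (vector [x, y], e)"
    by (rule meromorphic_chart[OF mer(2) U(2)]) (rule that)
  define \<delta> where "\<delta> = min \<delta>0 (min \<delta>1 \<delta>2)"
  have \<delta>: "0 < \<delta>" "\<delta> \<le> \<delta>0" "\<delta> \<le> \<delta>1" "\<delta> \<le> \<delta>2" using 1(1) 2(1) \<open>0 < \<delta>0\<close> by (auto simp: \<delta>_def)
  have sub1: "ball x0 \<delta> \<subseteq> ball x0 \<delta>1" "ball c \<delta> \<subseteq> ball c \<delta>1" "ball 0 \<delta> \<subseteq> ball (0::complex) \<delta>1"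
    and sub2: "ball x0 \<delta> \<subseteq> ball x0 \<delta>2" "ball c \<delta> \<subseteq> ball c \<delta>2" "ball 0 \<delta> \<subseteq> ball (0::complex) \<delta>2"
    using \<delta> by auto
  let ?A = "ball x0 \<delta>" and ?S = "ball c \<delta>" and ?E = "ball (0::complex) \<delta>"
  note h1 = hol3_subset[OF 1(3) sub1] and g1 = hol3_subset[OF 1(2) sub1]
  note h2 = hol3_subset[OF 2(3) sub2] and g2 = hol3_subset[OF 2(2) sub2]
  \<comment> \<open>A common denominator, so that both functions receive the same exponent
    \<open>m\<close>.\<close>
  define H where "H = (\<lambda>x y e. h1 x y e * h2 x y e)"
  have H: "hol3 ?A ?S ?E H" unfolding H_def by (rule hol3_mult[OF h1 h2])
  have "\<exists>x\<in>?A. \<exists>y\<in>?S. \<exists>e\<in>?E. H x y e \<noteq> 0"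
    unfolding H_def
    by (rule hol3_mult_nonzero[OF h1 h2 open_ball connected_ball open_ball connected_ball open_ball connected_ball 1(4) 2(4)])
       (use \<delta> in auto)
  then obtain a b d where ne: "a \<in> ?A" "b \<in> ?S" "d \<in> ?E" "H a b d \<noteq> 0" by blast
  show ?thesis
  proof (rule hol3_order[OF H open_ball open_ball ne])
    fix m H1 x1 y'
    assume H1: "hol3 ?A ?S ?E H1" "\<And>x y e. x \<in> ?A \<Longrightarrow> y \<in> ?S \<Longrightarrow> e \<in> ?E \<Longrightarrow> H x y e = e^m * H1 x y e"
      and x1: "x1 \<in> ?A" "y' \<in> ?S" "H1 x1 y' 0 \<noteq> 0"
    have "(\<lambda>y. H1 x1 y 0) holomorphic_on ?S" using H1(1) x1(1) \<delta>(1) unfolding hol3_def by auto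
    then obtain \<rho> where \<rho>: "0 < \<rho>" "\<rho> < \<delta>" "\<And>z. z \<in> sphere c \<rho> \<Longrightarrow> H1 x1 z 0 \<noteq> 0"
      by (rule holomorphic_nonzero_circle[of "\<lambda>y. H1 x1 y 0" c \<delta> y', OF _ x1(2)]) (use x1(3) in \<open>auto intro: that\<close>)
    let ?O = "{(x, y, e). x \<in> ?A \<and> y \<in> ?S \<and> e \<in> ?E \<and> H1 x y e \<noteq> 0}"
    have "open ?O" by (rule hol3_open_nonzero[OF H1(1)]) auto
    moreover have "compact ({x1} \<times> sphere c \<rho> \<times> {0::complex})" by (intro compact_Times) auto
    moreover have "{x1} \<times> sphere c \<rho> \<times> {0} \<subseteq> ?O" using x1(1) \<rho> \<delta>(1) by auto
    ultimately obtain \<epsilon> where \<epsilon>: "\<epsilon> > 0" "(\<Union>p\<in>{x1} \<times> sphere c \<rho> \<times> {0}. ball p \<epsilon>) \<subseteq> ?O"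
      using compact_subset_open_imp_ball_epsilon_subset[of "{x1} \<times> sphere c \<rho> \<times> {0}" ?O] by blast
    \<comment> \<open>A third of \<open>\<epsilon>\<close> for each of the three coordinates; the
      bound by \<open>\<rho> / 2\<close> keeps \<open>c\<close> out of the annulus.\<close>
    define \<eta> where "\<eta> = min (\<epsilon> / 3) (\<rho> / 2)"
    have \<eta>: "0 < \<eta>" "3 * \<eta> \<le> \<epsilon>" "\<eta> < \<rho>" using \<epsilon>(1) \<rho>(1) by (auto simp: \<eta>_def)
    define A S where "A = ball x1 \<eta>" and "S = {y. \<rho> - \<eta> < norm (y - c) \<and> norm (y - c) < \<rho> + \<eta>}"
    let ?r = \<eta>
    have inO: "x \<in> ?A \<and> y \<in> ?S \<and> e \<in> ?E \<and> H1 x y e \<noteq> 0" if "x \<in> A" "y \<in> S" "e \<in> ball 0 ?r" for x y e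
    proof -
      have yc: "0 < norm (y - c)" "\<bar>norm (y - c) - \<rho>\<bar> < \<eta>" using that(2) \<eta> by (auto simp: S_def)
      \<comment> \<open>Radial projection of \<open>y\<close> onto the circle of radius
        \<open>\<rho>\<close>.\<close>
      define z where "z = c + of_real (\<rho> / norm (y - c)) * (y - c)"
      have z: "z \<in> sphere c \<rho>" using yc(1) \<rho>(1) by (auto simp: z_def dist_norm norm_mult norm_divide)
      have "z - y = of_real (\<rho> / norm (y - c) - 1) * (y - c)" by (simp add: z_def algebra_simps)
      then have "norm (z - y) = \<bar>\<rho> / norm (y - c) - 1\<bar> * norm (y - c)" by (simp only: norm_mult norm_of_real)
      also have "\<dots> = \<bar>(\<rho> / norm (y - c) - 1) * norm (y - c)\<bar>" by (simp add: abs_mult)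
      also have "(\<rho> / norm (y - c) - 1) * norm (y - c) = \<rho> - norm (y - c)" using yc(1) by (simp add: field_simps)
      finally have "dist z y < \<eta>" using yc(2) by (simp add: dist_norm abs_minus_commute)
      have "dist (x1, z, 0) (x, y, e) \<le> dist x1 x + dist (z, 0) (y, e)"
        unfolding dist_Pair_Pair[of x1 "(z, 0)"] by (rule sqrt_sum_squares_le_sum) auto
      also have "dist (z, 0) (y, e) \<le> dist z y + dist 0 e"
        unfolding dist_Pair_Pair by (rule sqrt_sum_squares_le_sum) auto
      finally have "dist (x1, z, 0) (x, y, e) < \<epsilon>"
        using that \<open>dist z y < \<eta>\<close> \<eta> by (auto simp: A_def)
      then have "(x, y, e) \<in> ball (x1, z, 0) \<epsilon>" unfolding mem_ball .
      moreover have "(x1, z, 0) \<in> {x1} \<times> sphere c \<rho> \<times> {0}" using z by simp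
      ultimately have "(x, y, e) \<in> (\<Union>p\<in>{x1} \<times> sphere c \<rho> \<times> {0}. ball p \<epsilon>)" by (rule UN_I[rotated])
      then have "(x, y, e) \<in> ?O" by (rule subsetD[OF \<epsilon>(2)])
      then show ?thesis by simp
    qed
    have y1: "c + of_real \<rho> \<in> S" using \<eta> \<rho> by (simp add: S_def)
    have sph: "sphere c \<rho> \<subseteq> S" using \<eta> by (auto simp: S_def dist_norm norm_minus_commute)
    have cS: "c \<notin> S" using \<eta> by (simp add: S_def)
    have subs: "A \<subseteq> ?A" "S \<subseteq> ?S" "ball 0 ?r \<subseteq> ?E"
    proof -
      have i: "x1 \<in> A" "0 \<in> ball (0::complex) ?r" using \<eta> by (auto simp: A_def)
      show "A \<subseteq> ?A" using inO[OF _ y1 i(2)] by blast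
      show "S \<subseteq> ?S" using inO[OF i(1) _ i(2)] by blast
      show "ball 0 ?r \<subseteq> ?E" using inO[OF i(1) y1] by blast
    qed
    have oS: "open S"
    proof -
      have "S = (norm \<circ> (\<lambda>y. y - c)) -` {\<rho> - \<eta><..<\<rho> + \<eta>}" by (auto simp: S_def)
      moreover have "open ((norm \<circ> (\<lambda>y. y - c)) -` {\<rho> - \<eta><..<\<rho> + \<eta>})"
        by (intro open_vimage open_greaterThanLessThan) (auto simp: o_def intro!: continuous_intros)
      ultimately show ?thesis by simp
    qed
    have cnS: "connected S" unfolding S_def by (rule connected_annulus) simp
    have le: "\<eta> \<le> \<delta>0"
      using subs(1) \<rho> \<delta> \<eta> by linarith
    note sub = hol3_subset[OF _ subs]
    show ?thesis
    proof (rule that[of A x1 S \<rho> "c + of_real \<rho>" ?r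
        "\<lambda>x y e. g1 x y e * h2 x y e / H1 x y e" "\<lambda>x y e. g2 x y e * h1 x y e / H1 x y e" m])
      have nz: "H1 x y e \<noteq> 0" if "x \<in> A" "y \<in> S" "e \<in> ball 0 ?r" for x y e
        using inO[OF that] by simp
      show "hol3 A S (ball 0 ?r) (\<lambda>x y e. g1 x y e * h2 x y e / H1 x y e)"
        by (rule hol3_divide[OF hol3_mult[OF sub[OF g1] sub[OF h2]] sub[OF H1(1)] nz])
      show "hol3 A S (ball 0 ?r) (\<lambda>x y e. g2 x y e * h1 x y e / H1 x y e)"
        by (rule hol3_divide[OF hol3_mult[OF sub[OF g2] sub[OF h1]] sub[OF H1(1)] nz])
      fix x y e assume xye: "x \<in> A" "y \<in> S" "e \<in> ball (0::complex) ?r - {0}"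
      then have i: "x \<in> ?A" "y \<in> ?S" "e \<in> ?E" "H1 x y e \<noteq> 0" "e \<noteq> 0"
        using inO[of x y e] by auto
      have Heq: "h1 x y e * h2 x y e = e^m * H1 x y e" using H1(2)[OF i(1-3)] by (simp add: H_def)
      then have nz: "h1 x y e \<noteq> 0" "h2 x y e \<noteq> 0" using i(4,5) by auto
      have F1: "F1 (vector [x, y], e) = g1 x y e / h1 x y e \<and> holomorphic_near F1 (vector [x, y], e)"
        by (rule 1(5)) (use i sub1 nz in auto)
      have F2: "F2 (vector [x, y], e) = g2 x y e / h2 x y e \<and> holomorphic_near F2 (vector [x, y], e)"
        by (rule 2(5)) (use i sub2 nz in auto)
      have "g1 x y e / h1 x y e = g1 x y e * h2 x y e / (h1 x y e * h2 x y e)" using nz by simp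
      then have e1: "g1 x y e / h1 x y e = g1 x y e * h2 x y e / H1 x y e / e^m"
        unfolding Heq by (simp add: field_simps)
      have "g2 x y e / h2 x y e = g2 x y e * h1 x y e / (h1 x y e * h2 x y e)" using nz by simp
      then have e2: "g2 x y e / h2 x y e = g2 x y e * h1 x y e / H1 x y e / e^m"
        unfolding Heq by (simp add: field_simps)
      show "F1 (vector [x, y], e) = g1 x y e * h2 x y e / H1 x y e / e^m \<and>
        F2 (vector [x, y], e) = g2 x y e * h1 x y e / H1 x y e / e^m \<and>
        holomorphic_near F1 (vector [x, y], e) \<and> holomorphic_near F2 (vector [x, y], e)"
        using F1 F2 e1 e2 by simp
    next
      show "A \<subseteq> ball x0 \<delta>0" "S \<subseteq> ball c \<delta>0 - {c}" using subs(1,2) \<delta>(2) cS by auto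
      show "open A" "connected A" "x1 \<in> A" using \<eta> by (auto simp: A_def)
    qed (use \<delta> \<rho> \<eta> le y1 sph oS cnS in auto)
  qed
qed

section \<open>Lie derivatives and brackets along the rotor field in coordinates\<close>

lemma partial_deriv_vector:
  "((\<lambda>x. F (vector [x, y] :: complex^2, e)) has_field_derivative d) (at x) \<Longrightarrow> partial_deriv 1 F (vector [x, y], e) = d"
  "((\<lambda>y. F (vector [x, y] :: complex^2, e)) has_field_derivative d) (at y) \<Longrightarrow> partial_deriv 2 F (vector [x, y], e) = d"
proof -
  have 1: "vector [x, y] + axis 1 z = (vector [z + x, y] :: complex^2)"
    and 2: "vector [x, y] + axis 2 z = (vector [x, z + y] :: complex^2)" for z
    by (simp_all add: vec_eq_iff forall_2 axis_def)
  show "partial_deriv 1 F (vector [x, y], e) = d"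
    if "((\<lambda>x. F (vector [x, y] :: complex^2, e)) has_field_derivative d) (at x)"
    using that DERIV_shift[of "\<lambda>x. F (vector [x, y], e)" d 0 x]
    by (simp add: partial_deriv_def 1 DERIV_imp_deriv)
  show "partial_deriv 2 F (vector [x, y], e) = d"
    if "((\<lambda>y. F (vector [x, y] :: complex^2, e)) has_field_derivative d) (at y)"
    using that DERIV_shift[of "\<lambda>y. F (vector [x, y], e)" d 0 y]
    by (simp add: partial_deriv_def 2 DERIV_imp_deriv)
qed

lemma lie_deriv_2:
  "lie_deriv v F p = partial_deriv 1 F p * v p $ 1 + partial_deriv 2 F p * v p $ (2::2)"
  by (simp add: lie_deriv_def state_gradient_def sum_2)

definition rotor_force :: "real \<Rightarrow> complex \<Rightarrow> complex" where
  "rotor_force \<kappa> y = sin y / (1 - of_real \<kappa> * cos y) + 1"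

lemma forced_rotor_vector: "forced_rotor \<kappa> (vector [x, y], e) = vector [e * rotor_force \<kappa> y, x]"
  by (simp add: forced_rotor_def rotor_force_def)

lemma complex_differentiable_forced_rotor:
  fixes p :: "(complex^2) \<times> complex"
  assumes "1 - of_real \<kappa> * cos (fst p $ 2) \<noteq> 0"
  shows "complex_differentiable_at (\<lambda>p. forced_rotor \<kappa> p $ i) p"
proof -
  let ?R = "{y. 1 - of_real \<kappa> * cos y \<noteq> (0 :: complex)}"
  have "open ?R" by (intro open_Collect_neq continuous_intros)
  have "rotor_force \<kappa> holomorphic_on ?R"
    unfolding rotor_force_def by (intro holomorphic_intros) auto
  then obtain d where d: "(rotor_force \<kappa> has_field_derivative d) (at (fst p $ 2))"
    using holomorphic_derivI[OF _ \<open>open ?R\<close>] assms by blast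
  have "(\<lambda>p. forced_rotor \<kappa> p $ 1) = (\<lambda>p. snd p * rotor_force \<kappa> (fst p $ 2))"
    by (auto simp: forced_rotor_def rotor_force_def)
  moreover have "complex_differentiable_at (\<lambda>p. snd p * rotor_force \<kappa> (fst p $ 2)) p"
    by (intro complex_differentiable_at_mult complex_differentiable_at_component
        complex_differentiable_at_compose[OF complex_differentiable_at_component(1) d])
  moreover have "(\<lambda>p. forced_rotor \<kappa> p $ 2) = (\<lambda>p. fst p $ 1)"
    by (auto simp: forced_rotor_def)
  ultimately show ?thesis
    using exhaust_2[of i] complex_differentiable_at_component(1)[of 1 p] by auto
qed

text \<open>The identities of integrability may be used only at points where all functions involved
  are holomorphic. For the given field this must be known at regular points of the force, although
  \<open>v\<close> agrees with it only on \<open>U\<close>.\<close>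

lemma holomorphic_near_forced_rotor:
  fixes p :: "(complex^2) \<times> complex" and v :: "(complex^2) \<times> complex \<Rightarrow> complex^2"
  assumes "open U" "p \<in> U" "\<And>p. p \<in> U \<Longrightarrow> v p = forced_rotor \<kappa> p" "1 - of_real \<kappa> * cos (fst p $ 2) \<noteq> 0"
  shows "holomorphic_near (\<lambda>x. v x $ i) p"
proof -
  let ?W = "U \<inter> (\<lambda>p. 1 - of_real \<kappa> * cos (fst p $ 2)) -` (- {0})"
  have "open ?W"
    using assms(1) by (intro open_Int open_vimage continuous_intros) auto
  moreover have "complex_differentiable_at (\<lambda>x. v x $ i) x" if "x \<in> ?W" for x
    by (rule complex_differentiable_at_transform[OF complex_differentiable_forced_rotor \<open>open ?W\<close> that])
       (use assms(3) that in auto)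
  ultimately show ?thesis
    unfolding holomorphic_near_def using assms(2,4) by (intro exI[of _ ?W]) auto
qed

locale rotor_chart = pole_chart A S r c \<rho> R0 s "rotor_force \<kappa>" x1 y1
  for A S r c \<rho> R0 s \<kappa> x1 y1 +
  fixes U :: "((complex^2) \<times> complex) set" and v :: "(complex^2) \<times> complex \<Rightarrow> complex^2"
  assumes U: "open U" "\<And>x y e. x \<in> A \<Longrightarrow> y \<in> S \<Longrightarrow> e \<in> ball 0 r \<Longrightarrow> (vector [x, y], e) \<in> U"
    and v: "\<And>p. p \<in> U \<Longrightarrow> v p = forced_rotor \<kappa> p"
    and regular: "\<And>y. y \<in> S \<Longrightarrow> 1 - of_real \<kappa> * cos y \<noteq> 0"
begin

lemma v_vector:
  assumes "x \<in> A" "y \<in> S" "e \<in> ball 0 r"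
  shows "v (vector [x, y], e) = vector [e * rotor_force \<kappa> y, x]"
  using v[OF U(2)[OF assms]] by (simp add: forced_rotor_vector)

lemma holomorphic_near_v:
  assumes "x \<in> A" "y \<in> S" "e \<in> ball 0 r"
  shows "holomorphic_near (\<lambda>p. v p $ i) (vector [x, y], e)"
  by (rule holomorphic_near_forced_rotor[OF U(1) U(2)[OF assms] v]) (use regular assms in auto)

lemma partial_deriv_quotient:
  fixes F :: "(complex^2) \<times> complex \<Rightarrow> complex"
  assumes G: "hol3 A S (ball 0 r) G"
    and F: "\<And>x y e. x \<in> A \<Longrightarrow> y \<in> S \<Longrightarrow> e \<in> ball 0 r - {0} \<Longrightarrow> F (vector [x, y], e) = G x y e / e^m"
    and x: "x \<in> A" "y \<in> S" "e \<in> ball 0 r - {0}"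
  shows "partial_deriv 1 F (vector [x, y], e) = deriv (\<lambda>x. G x y e) x / e^m"
    and "partial_deriv 2 F (vector [x, y], e) = deriv (\<lambda>y. G x y e) y / e^m"
proof -
  have "(\<lambda>x. G x y e) holomorphic_on A" "(\<lambda>y. G x y e) holomorphic_on S"
    using G x unfolding hol3_def by auto
  then have d: "((\<lambda>x. G x y e) has_field_derivative deriv (\<lambda>x. G x y e) x) (at x)"
    "((\<lambda>y. G x y e) has_field_derivative deriv (\<lambda>y. G x y e) y) (at y)"
    using holomorphic_derivI A(1) S(1) x by blast+
  have "((\<lambda>x. F (vector [x, y], e)) has_field_derivative deriv (\<lambda>x. G x y e) x / e^m) (at x)"
    by (rule has_field_derivative_transform_within_open[OF DERIV_cdivide[OF d(1)] A(1) x(1)]) (use F x in auto)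
  moreover have "((\<lambda>y. F (vector [x, y], e)) has_field_derivative deriv (\<lambda>y. G x y e) y / e^m) (at y)"
    by (rule has_field_derivative_transform_within_open[OF DERIV_cdivide[OF d(2)] S(1) x(2)]) (use F x in auto)
  ultimately show "partial_deriv 1 F (vector [x, y], e) = deriv (\<lambda>x. G x y e) x / e^m"
    and "partial_deriv 2 F (vector [x, y], e) = deriv (\<lambda>y. G x y e) y / e^m"
    by (simp_all add: partial_deriv_vector)
qed

lemma lie_deriv_quotient:
  fixes F :: "(complex^2) \<times> complex \<Rightarrow> complex"
  assumes G: "hol3 A S (ball 0 r) G"
    and F: "\<And>x y e. x \<in> A \<Longrightarrow> y \<in> S \<Longrightarrow> e \<in> ball 0 r - {0} \<Longrightarrow> F (vector [x, y], e) = G x y e / e^m"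
    and x: "x \<in> A" "y \<in> S" "e \<in> ball 0 r - {0}"
  shows "lie_deriv v F (vector [x, y], e) = Xd G x y e / e^m"
proof -
  have "e \<in> ball 0 r" using x(3) by simp
  then show ?thesis
    using partial_deriv_quotient[where F = F, OF G F x] v_vector[OF x(1,2)]
    by (simp add: lie_deriv_2 Xd_def add_divide_distrib mult.commute)
qed

text \<open>The slice \<open>e = 0\<close> is left out because the meromorphic data are known there
  only as quotients by \<open>e^m\<close>. What remains is open and nonempty, hence too large for a
  null set.\<close>

definition region :: "((complex^2) \<times> complex) set" where
  "region = {p. fst p $ 1 \<in> A \<and> fst p $ 2 \<in> S \<and> snd p \<in> ball 0 r - {0}}"

lemma regionE:
  assumes "p \<in> region"
  obtains x y e where "p = (vector [x, y], e)" "x \<in> A" "y \<in> S" "e \<in> ball 0 r - {0}"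
proof
  show "p = (vector [fst p $ 1, fst p $ 2], snd p)"
    by (cases p) (simp add: vec_eq_iff forall_2)
qed (use assms in \<open>auto simp: region_def\<close>)

lemma region_not_negligible:
  assumes "region \<subseteq> N"
  shows "\<not> negligible N"
proof -
  have "region = (\<lambda>p. fst p $ 1) -` A \<inter> (\<lambda>p. fst p $ 2) -` S \<inter> snd -` (ball 0 r - {0})"
    by (auto simp: region_def)
  then have "open region"
    using A(1) S(1) by (auto intro!: open_Int open_vimage continuous_intros simp: open_delete)
  moreover have "(vector [x1, y1], of_real (r / 2)) \<in> region"
    using A(4) S(4) r by (simp add: region_def)
  ultimately have "\<not> negligible region" using open_not_negligible by blast
  then show ?thesis using assms negligible_subset by blast
qed

text \<open>By \<open>first_integral_constant\<close> the numerator \<open>G\<close> depends on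
  \<open>e\<close> alone, so both state derivatives vanish.\<close>

lemma no_first_integral:
  fixes F :: "(complex^2) \<times> complex \<Rightarrow> complex"
  assumes G: "hol3 A S (ball 0 r) G"
    and F: "\<And>x y e. x \<in> A \<Longrightarrow> y \<in> S \<Longrightarrow> e \<in> ball 0 r - {0} \<Longrightarrow> F (vector [x, y], e) = G x y e / e^m"
    and X: "\<And>x y e. x \<in> A \<Longrightarrow> y \<in> S \<Longrightarrow> e \<in> ball 0 r - {0} \<Longrightarrow> lie_deriv v F (vector [x, y], e) = 0"
    and p: "p \<in> region"
  shows "state_gradient F p = 0"
proof -
  obtain x y e where xye: "p = (vector [x, y], e)" "x \<in> A" "y \<in> S" "e \<in> ball 0 r - {0}"
    using regionE[OF p] .
  have "Xd G x y e = 0" if "x \<in> A" "y \<in> S" "e \<in> ball 0 r - {0}" for x y e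
    using lie_deriv_quotient[OF G F that] X[OF that] that by simp
  then have c: "G x y e = G x1 y1 e" if "x \<in> A" "y \<in> S" "e \<in> ball 0 r" for x y e
    by (rule first_integral_constant[OF G _ that])
  have "deriv (\<lambda>x. G x y e) x = deriv (\<lambda>x. G x1 y1 e) x"
    by (intro deriv_cong_ev refl eventually_mono[OF eventually_nhds_in_open[OF A(1) xye(2)]]) (use c xye in auto)
  moreover have "deriv (\<lambda>y. G x y e) y = deriv (\<lambda>y. G x1 y1 e) y"
    by (intro deriv_cong_ev refl eventually_mono[OF eventually_nhds_in_open[OF S(1) xye(3)]]) (use c xye in auto)
  ultimately show ?thesis
    using partial_deriv_quotient[OF G F xye(2-4)]
    by (simp add: state_gradient_def vec_eq_iff forall_2 xye(1))
qed

text \<open>The Jacobian of the rotor field in the state variables has rows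
  \<open>(0, e * h')\<close> and \<open>(1, 0)\<close>, \<open>h\<close> being the force, so the
  bracket relation reads \<open>X w1 = e * h' * w2\<close> and \<open>X w2 = w1\<close>. The common
  factor \<open>1 / e^m\<close> is constant along the flow and cancels.\<close>

lemma commuting_field:
  fixes w :: "(complex^2) \<times> complex \<Rightarrow> complex^2"
  assumes G: "hol3 A S (ball 0 r) G1" "hol3 A S (ball 0 r) G2"
    and w: "\<And>x y e. x \<in> A \<Longrightarrow> y \<in> S \<Longrightarrow> e \<in> ball 0 r - {0} \<Longrightarrow> w (vector [x, y], e) $ 1 = G1 x y e / e^m"
      "\<And>x y e. x \<in> A \<Longrightarrow> y \<in> S \<Longrightarrow> e \<in> ball 0 r - {0} \<Longrightarrow> w (vector [x, y], e) $ 2 = G2 x y e / e^m"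
    and X: "\<And>x y e. x \<in> A \<Longrightarrow> y \<in> S \<Longrightarrow> e \<in> ball 0 r - {0} \<Longrightarrow> lie_bracket v w (vector [x, y], e) = 0"
    and xye: "x \<in> A" "y \<in> S" "e \<in> ball 0 r - {0}"
  shows "Xd G1 x y e = e * deriv (rotor_force \<kappa>) y * G2 x y e" and "Xd G2 x y e = G1 x y e"
proof -
  let ?p = "(vector [x, y] :: complex^2, e)"
  have e: "e \<in> ball 0 r" "e^m \<noteq> 0" using xye by auto
  have near: "(\<lambda>x. v (vector [x, y], e) $ i) x' = vector [e * rotor_force \<kappa> y, x'] $ i" if "x' \<in> A" for x' i
    using v_vector[OF that xye(2) e(1)] by simp
  have near': "(\<lambda>y. v (vector [x, y], e) $ i) y' = vector [e * rotor_force \<kappa> y', x] $ i" if "y' \<in> S" for y' i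
    using v_vector[OF xye(1) that e(1)] by simp
  have df: "(rotor_force \<kappa> has_field_derivative deriv (rotor_force \<kappa>) y) (at y)"
    using holomorphic_derivI[OF h(2) S(1) xye(2)] .
  have 11: "partial_deriv 1 (\<lambda>p. v p $ 1) ?p = 0"
    by (rule partial_deriv_vector, rule has_field_derivative_transform_within_open[OF DERIV_const A(1) xye(1)])
       (simp add: near)
  have 12: "partial_deriv 1 (\<lambda>p. v p $ 2) ?p = 1"
    by (rule partial_deriv_vector, rule has_field_derivative_transform_within_open[OF DERIV_ident A(1) xye(1)])
       (simp add: near)
  have 21: "partial_deriv 2 (\<lambda>p. v p $ 1) ?p = e * deriv (rotor_force \<kappa>) y"
    by (rule partial_deriv_vector, rule has_field_derivative_transform_within_open[OF DERIV_cmult[OF df] S(1) xye(2)])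
       (simp add: near')
  have 22: "partial_deriv 2 (\<lambda>p. v p $ 2) ?p = 0"
    by (rule partial_deriv_vector, rule has_field_derivative_transform_within_open[OF DERIV_const S(1) xye(2)])
       (simp add: near')
  have "lie_deriv v (\<lambda>p. w p $ i) ?p = lie_deriv w (\<lambda>p. v p $ i) ?p" for i
    using X[OF xye] by (simp add: lie_bracket_def vec_eq_iff)
  note this[of 1] this[of 2]
  moreover have l1: "lie_deriv v (\<lambda>p. w p $ 1) ?p = Xd G1 x y e / e^m"
    by (rule lie_deriv_quotient[OF G(1) _ xye]) (rule w(1))
  moreover have l2: "lie_deriv v (\<lambda>p. w p $ 2) ?p = Xd G2 x y e / e^m"
    by (rule lie_deriv_quotient[OF G(2) _ xye]) (rule w(2))
  ultimately
  have "Xd G1 x y e / e^m = e * deriv (rotor_force \<kappa>) y * G2 x y e / e^m" "Xd G2 x y e / e^m = G1 x y e / e^m"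
    unfolding lie_deriv_2[of w] 11 12 21 22
    by (simp_all add: w[OF xye])
  then show "Xd G1 x y e = e * deriv (rotor_force \<kappa>) y * G2 x y e" "Xd G2 x y e = G1 x y e"
    using e(2) by auto
qed

lemma independent_pair_imp_det:
  fixes u :: "nat \<Rightarrow> (complex^2) \<times> complex \<Rightarrow> complex^2"
  assumes "independent_family {1..2} (\<lambda>j. u j (vector [x, y], e))"
    and "u (1::nat) (vector [x, y], e) = v (vector [x, y], e)" "x \<in> A" "y \<in> S" "e \<in> ball 0 r"
  shows "e * rotor_force \<kappa> y * u 2 (vector [x, y], e) $ 2 \<noteq> x * u 2 (vector [x, y], e) $ 1"
proof
  assume eq: "e * rotor_force \<kappa> y * u 2 (vector [x, y], e) $ 2 = x * u 2 (vector [x, y], e) $ 1"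
  \<comment> \<open>These coefficients always annihilate the second component; in the first they
    leave the determinant. The second coefficient is nonzero since 0 is not in
    \<open>A\<close>.\<close>
  let ?c = "\<lambda>j::nat. if j = 1 then u 2 (vector [x, y], e) $ 2 else - x"
  have "{1..2} = {1, 2::nat}" by auto
  then have "(\<Sum>j\<in>{1..2}. ?c j *s u j (vector [x, y], e)) = 0"
    using eq assms(2) v_vector[OF assms(3-5)] by (simp add: vec_eq_iff forall_2 mult.commute)
  then have "?c 2 = 0" using assms(1) unfolding independent_family_def by force
  then show False using A(3) assms(3) by simp
qed

end

lemma rotor_pair_chart:
  fixes F1 F2 :: "(complex^2) \<times> complex \<Rightarrow> complex"
  assumes \<kappa>: "0 < \<kappa>" "\<kappa> < 1" and c: "c = \<i> * of_real (arcosh (1 / \<kappa>))"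
    and U: "open U" "(vector [x0, c], 0) \<in> U" and "x0 \<noteq> 0"
    and v: "\<And>p. p \<in> U \<Longrightarrow> v p = forced_rotor \<kappa> p"
    and mer: "meromorphic_in F1 U" "meromorphic_in F2 U" and "0 < \<delta>0"
  obtains A S r \<rho> R0 s x1 y1 G1 G2 and m :: nat where
    "rotor_chart A S r c \<rho> R0 s \<kappa> x1 y1 U v" "A \<subseteq> ball x0 \<delta>0" "S \<subseteq> ball c \<delta>0"
    "hol3 A S (ball 0 r) G1" "hol3 A S (ball 0 r) G2"
    "\<And>x y e. x \<in> A \<Longrightarrow> y \<in> S \<Longrightarrow> e \<in> ball 0 r - {0} \<Longrightarrow>
      F1 (vector [x, y], e) = G1 x y e / e^m \<and> F2 (vector [x, y], e) = G2 x y e / e^m \<and>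
      holomorphic_near F1 (vector [x, y], e) \<and> holomorphic_near F2 (vector [x, y], e)"
proof -
  obtain R0 s where s: "0 < R0" "s holomorphic_on ball c R0" "s c \<noteq> 0"
    "\<And>y. y \<in> ball c R0 \<Longrightarrow> y \<noteq> c \<Longrightarrow> 1 - of_real \<kappa> * cos y \<noteq> 0"
    "\<And>y. y \<in> ball c R0 \<Longrightarrow> y \<noteq> c \<Longrightarrow> sin y / (1 - of_real \<kappa> * cos y) + 1 = s y / (y - c)"
    by (rule rotor_force_pole[OF \<kappa> c]) (rule that)
  obtain \<delta>U where \<delta>U: "0 < \<delta>U"
    "\<And>x y e. x \<in> ball x0 \<delta>U \<Longrightarrow> y \<in> ball c \<delta>U \<Longrightarrow> e \<in> ball 0 \<delta>U \<Longrightarrow> (vector [x, y], e) \<in> U"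
    by (rule vector_polydisc[OF U]) (rule that)
  \<comment> \<open>The bounds ensure, in turn: the requested size, the representation of the force
    by \<open>s\<close>, containment of the chart in \<open>U\<close>, and
    \<open>x \<noteq> 0\<close>.\<close>
  define \<delta> where "\<delta> = min (min \<delta>0 R0) (min \<delta>U (norm x0))"
  have \<delta>: "0 < \<delta>" "\<delta> \<le> \<delta>0" "\<delta> \<le> R0" "\<delta> \<le> \<delta>U" "\<delta> \<le> norm x0"
    using s(1) \<delta>U(1) \<open>0 < \<delta>0\<close> \<open>x0 \<noteq> 0\<close> by (auto simp: \<delta>_def)
  show ?thesis
  proof (rule meromorphic_pair_annulus[OF U mer \<delta>(1)])
    fix A S r \<rho> x1 y1 G1 G2 and m :: nat
    assume A: "open A" "connected A" "A \<subseteq> ball x0 \<delta>" "x1 \<in> A"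
      and S: "open S" "connected S" "sphere c \<rho> \<subseteq> S" "S \<subseteq> ball c \<delta> - {c}" "y1 \<in> S"
      and rho: "0 < \<rho>" "\<rho> < \<delta>" and r: "0 < r" "r \<le> \<delta>"
      and G: "hol3 A S (ball 0 r) G1" "hol3 A S (ball 0 r) G2"
      and F: "\<And>x y e. x \<in> A \<Longrightarrow> y \<in> S \<Longrightarrow> e \<in> ball 0 r - {0} \<Longrightarrow>
      F1 (vector [x, y], e) = G1 x y e / e^m \<and> F2 (vector [x, y], e) = G2 x y e / e^m \<and>
      holomorphic_near F1 (vector [x, y], e) \<and> holomorphic_near F2 (vector [x, y], e)"
    have Sy: "y \<in> ball c R0" "y \<in> ball c \<delta>U" "y \<noteq> c" if "y \<in> S" for y
      using subsetD[OF S(4) that] \<delta> by auto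
    have Ax: "x \<in> ball x0 \<delta>U" if "x \<in> A" for x
      using subsetD[OF A(3) that] \<delta> by auto
    have reg: "1 - of_real \<kappa> * cos y \<noteq> 0" if "y \<in> S" for y using s(4) Sy[OF that] by blast
    have "rotor_chart A S r c \<rho> R0 s \<kappa> x1 y1 U v"
    proof
      show "0 \<notin> A" using subsetD[OF A(3), of 0] \<delta>(5) by auto
      show "y \<noteq> c \<and> rotor_force \<kappa> y = s y / (y - c)" if "y \<in> S" for y
        using s(5) Sy[OF that] unfolding rotor_force_def by blast
      show "rotor_force \<kappa> holomorphic_on S"
        unfolding rotor_force_def using reg by (intro holomorphic_intros)
      show "(vector [x, y], e) \<in> U" if "x \<in> A" "y \<in> S" "e \<in> ball 0 r" for x y e
        using \<delta>U(2)[OF Ax[OF that(1)] Sy(2)[OF that(2)]] that(3) r(2) \<delta>(4) by simp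
      show "\<rho> < R0" using rho \<delta> by linarith
    qed (fact A S rho r s U v reg)+
    moreover have "A \<subseteq> ball x0 \<delta>0" "S \<subseteq> ball c \<delta>0" using A(3) S(4) \<delta>(2) by auto
    ultimately show ?thesis using G F by (rule that)
  qed
qed

section \<open>The case \<open>q = 1\<close>, and the asymptotics forced by
  \<open>q = 2\<close>\<close>

lemma not_integrable_1:
  assumes \<kappa>: "0 < \<kappa>" "\<kappa> < 1" and c: "c = \<i> * of_real (arcosh (1 / \<kappa>))"
    and U: "open U" "(vector [x0, c], 0) \<in> U" and "x0 \<noteq> 0"
  shows "\<not> bogoyavlenskij_integrable_in 1 L (forced_rotor \<kappa>) U"
proof
  assume "bogoyavlenskij_integrable_in 1 L (forced_rotor \<kappa>) U"
  then obtain v :: "nat \<Rightarrow> (complex^2) \<times> complex \<Rightarrow> complex^2" and F where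
    v0: "\<forall>p\<in>U. v 1 p = forced_rotor \<kappa> p" and mer: "meromorphic_in (F (1::nat)) U"
    and ind: "negligible {p\<in>U. \<not> independent_family {1..1::nat} (\<lambda>k. state_gradient (F k) p)}"
    and lie: "\<forall>p\<in>U. holomorphic_near (F 1) p \<and> (\<forall>i. holomorphic_near (\<lambda>x. v 1 x $ i) p) \<longrightarrow>
      lie_deriv (v 1) (F 1) p = 0"
    unfolding bogoyavlenskij_integrable_in_def by - (elim exE conjE, rule that, simp_all)
  from v0 have v: "v 1 p = forced_rotor \<kappa> p" if "p \<in> U" for p using that by blast
  show False
  \<comment> \<open>There is a single first integral here; the chart for pairs is applied to it
    twice.\<close>
  proof (rule rotor_pair_chart[OF \<kappa> c U \<open>x0 \<noteq> 0\<close> v mer mer zero_less_one])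
    fix A S r \<rho> R0 s x1 y1 G1 G2 and m :: nat
    assume "rotor_chart A S r c \<rho> R0 s \<kappa> x1 y1 U (v 1)"
      and G: "hol3 A S (ball 0 r) G1"
      and F: "\<And>x y e. x \<in> A \<Longrightarrow> y \<in> S \<Longrightarrow> e \<in> ball 0 r - {0} \<Longrightarrow>
      F 1 (vector [x, y], e) = G1 x y e / e^m \<and> F 1 (vector [x, y], e) = G2 x y e / e^m \<and>
      holomorphic_near (F 1) (vector [x, y], e) \<and> holomorphic_near (F 1) (vector [x, y], e)"
    then interpret rotor_chart A S r c \<rho> R0 s \<kappa> x1 y1 U "v 1" by simp
    have L: "lie_deriv (v 1) (F 1) (vector [x, y], e) = 0" if "x \<in> A" "y \<in> S" "e \<in> ball 0 r - {0}" for x y e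
      using lie U(2)[of x y e] F[OF that] holomorphic_near_v[of x y e] that by simp
    have "region \<subseteq> {p\<in>U. \<not> independent_family {1..1} (\<lambda>k. state_gradient (F k) p)}"
    proof
      fix p assume p: "p \<in> region"
      have "state_gradient (F 1) p = 0"
        by (rule no_first_integral[OF G _ L p]) (use F in blast)
      then have "\<not> independent_family {1..1} (\<lambda>k. state_gradient (F k) p)"
        unfolding independent_family_def by (auto intro!: exI[of _ "\<lambda>_. 1"])
      moreover have "p \<in> U" using p U(2) by (auto elim!: regionE)
      ultimately show "p \<in> {p\<in>U. \<not> independent_family {1..1} (\<lambda>k. state_gradient (F k) p)}" by simp
    qed
    with region_not_negligible ind show False by blast
  qed
qed

text \<open>
  In the application \<open>b\<close> is the second component of the commuting field, \<open>e^k * u e / e^m\<close>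
  is its determinant with the given field, and the pole of order \<open>k\<close> in \<open>e\<close> is compensated by \<open>p e\<close>.
\<close>

definition asymptotic :: "((complex^2) \<times> complex \<Rightarrow> complex) \<Rightarrow> complex \<Rightarrow> (complex \<Rightarrow> complex) \<Rightarrow>
    (complex \<Rightarrow> complex) \<Rightarrow> nat \<Rightarrow> nat \<Rightarrow> complex \<Rightarrow> complex \<Rightarrow> complex \<Rightarrow> bool" where
  "asymptotic b c u p m k C x y \<longleftrightarrow>
     ((\<lambda>e. (e^m * b (vector [x, y], e) / (x * u e) - p e) / e^k + (y - c) / x^3) \<longlongrightarrow> C) (at 0)"

text \<open>\<open>b\<close> is chosen before \<open>\<delta>\<close>: one periodic function is
  followed along the orbit, while the chart giving its asymptotics must fit into a neighbourhood of
  \<open>c\<close> that is determined by \<open>b\<close>.\<close>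

lemma integrable_2_asymptotic:
  assumes \<kappa>: "0 < \<kappa>" "\<kappa> < 1" and c: "c = \<i> * of_real (arcosh (1 / \<kappa>))"
    and U: "open U" "(vector [x0, c], 0) \<in> U" and "x0 \<noteq> 0"
    and int: "bogoyavlenskij_integrable_in 2 L (forced_rotor \<kappa>) U"
  obtains b where "meromorphic_in b U" "\<And>p l. p \<in> U \<Longrightarrow> l \<in> L \<Longrightarrow> b (fst p + l, snd p) = b p"
    and "\<And>\<delta>. 0 < \<delta> \<Longrightarrow> \<exists>A S r u p m k C. open A \<and> A \<noteq> {} \<and> A \<subseteq> ball x0 \<delta> \<and> open S \<and> S \<noteq> {} \<and> S \<subseteq> ball c \<delta> \<and>
       0 < r \<and> u holomorphic_on ball 0 r \<and> p holomorphic_on ball 0 r \<and> (\<forall>e\<in>ball 0 r. u e \<noteq> 0) \<and>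
       (\<forall>x\<in>A. \<forall>y\<in>S. asymptotic b c u p m k C x y)"
proof -
  from int obtain v :: "nat \<Rightarrow> (complex^2) \<times> complex \<Rightarrow> complex^2" where
    v0: "\<forall>p\<in>U. v 1 p = forced_rotor \<kappa> p" and mer0: "\<forall>j\<in>{1..2}. \<forall>i. meromorphic_in (\<lambda>p. v j p $ i) U"
    and per: "\<forall>j\<in>{1..2}. \<forall>p\<in>U. \<forall>l\<in>L. v j (fst p + l, snd p) = v j p"
    and ind: "negligible {p\<in>U. \<not> independent_family {1..2} (\<lambda>j. v j p)}"
    and br0: "\<forall>j\<in>{1..2}. \<forall>k\<in>{1..2}. \<forall>p\<in>U.
      (\<forall>i. holomorphic_near (\<lambda>x. v j x $ i) p \<and> holomorphic_near (\<lambda>x. v k x $ i) p) \<longrightarrow>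
      lie_bracket (v j) (v k) p = 0"
    unfolding bogoyavlenskij_integrable_in_def by - (elim exE conjE, rule that)
  from v0 have v: "v 1 p = forced_rotor \<kappa> p" if "p \<in> U" for p using that by blast
  from mer0 have mer: "meromorphic_in (\<lambda>p. v 2 p $ i) U" for i by simp
  from br0 have br: "lie_bracket (v 1) (v 2) p = 0"
    if "p \<in> U" "\<And>i. holomorphic_near (\<lambda>x. v 1 x $ i) p" "\<And>i. holomorphic_near (\<lambda>x. v 2 x $ i) p" for p
    using that by simp
  show ?thesis
  proof (rule that[of "\<lambda>p. v 2 p $ 2"])
    show "meromorphic_in (\<lambda>p. v 2 p $ 2) U" by (rule mer)
    show "v 2 (fst p + l, snd p) $ 2 = v 2 p $ 2" if "p \<in> U" "l \<in> L" for p l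
      using per that by simp
    fix \<delta> :: real assume "0 < \<delta>"
    show "\<exists>A S r u p m k C. open A \<and> A \<noteq> {} \<and> A \<subseteq> ball x0 \<delta> \<and> open S \<and> S \<noteq> {} \<and> S \<subseteq> ball c \<delta> \<and>
       0 < r \<and> u holomorphic_on ball 0 r \<and> p holomorphic_on ball 0 r \<and> (\<forall>e\<in>ball 0 r. u e \<noteq> 0) \<and>
       (\<forall>x\<in>A. \<forall>y\<in>S. asymptotic (\<lambda>p. v 2 p $ 2) c u p m k C x y)"
    proof (rule rotor_pair_chart[OF \<kappa> c U \<open>x0 \<noteq> 0\<close> v mer[of 1] mer[of 2] \<open>0 < \<delta>\<close>])
      fix A S r \<rho> R0 s x1 y1 G1 G2 and m :: nat
      assume "rotor_chart A S r c \<rho> R0 s \<kappa> x1 y1 U (v 1)" and AS: "A \<subseteq> ball x0 \<delta>" "S \<subseteq> ball c \<delta>"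
        and G: "hol3 A S (ball 0 r) G1" "hol3 A S (ball 0 r) G2"
        and F: "\<And>x y e. x \<in> A \<Longrightarrow> y \<in> S \<Longrightarrow> e \<in> ball 0 r - {0} \<Longrightarrow>
        v 2 (vector [x, y], e) $ 1 = G1 x y e / e^m \<and> v 2 (vector [x, y], e) $ 2 = G2 x y e / e^m \<and>
        holomorphic_near (\<lambda>p. v 2 p $ 1) (vector [x, y], e) \<and> holomorphic_near (\<lambda>p. v 2 p $ 2) (vector [x, y], e)"
      then interpret rotor_chart A S r c \<rho> R0 s \<kappa> x1 y1 U "v 1" by simp
      have Br: "lie_bracket (v 1) (v 2) (vector [x, y], e) = 0" if "x \<in> A" "y \<in> S" "e \<in> ball 0 r - {0}" for x y e
      proof (rule br)
        show "holomorphic_near (\<lambda>p. v 2 p $ i) (vector [x, y], e)" for i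
          using F[OF that] exhaust_2[of i] by auto
      qed (use that U(2) holomorphic_near_v in auto)
      have w: "v 2 (vector [x, y], e) $ 1 = G1 x y e / e^m" "v 2 (vector [x, y], e) $ 2 = G2 x y e / e^m"
        if "x \<in> A" "y \<in> S" "e \<in> ball 0 r - {0}" for x y e using F[OF that] by auto
      note X = commuting_field[OF G w Br]
      \<comment> \<open>Independence almost everywhere is needed only at one point of the chart: the
        determinant is a function of \<open>e\<close>, and one nonzero value makes it
        nontrivial.\<close>
      have "\<not> region \<subseteq> {p\<in>U. \<not> independent_family {1..2} (\<lambda>j. v j p)}"
        using region_not_negligible ind by blast
      moreover have "region \<subseteq> U" using U(2) by (auto elim!: regionE)
      ultimately obtain p where p: "p \<in> region" "independent_family {1..2} (\<lambda>j. v j p)"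
        by blast
      obtain x0' y0' e0 where p_eq: "p = (vector [x0', y0'], e0)" "x0' \<in> A" "y0' \<in> S" "e0 \<in> ball 0 r - {0}"
        using regionE[OF p(1)] .
      have e0: "e0 \<in> ball 0 r" "e0^m \<noteq> 0" using p_eq(4) by auto
      have "e0 * rotor_force \<kappa> y0' * v 2 p $ 2 \<noteq> x0' * v 2 p $ 1"
        using independent_pair_imp_det[of v, OF p(2)[unfolded p_eq(1)] refl p_eq(2,3) e0(1)] p_eq(1) by simp
      then have ne: "e0 * rotor_force \<kappa> y0' * G2 x0' y0' e0 \<noteq> x0' * G1 x0' y0' e0"
        unfolding p_eq(1) w[OF p_eq(2-4)] using e0(2) by (auto simp: field_simps)
      show ?thesis
      proof (rule commuting_field_asymptotics[OF G X p_eq(2,3) e0(1) ne])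
        fix r' u q C and k :: nat
        assume r': "0 < r'" and uq: "u holomorphic_on ball 0 r'" "q holomorphic_on ball 0 r'"
          "\<And>e. e \<in> ball 0 r' \<Longrightarrow> u e \<noteq> 0"
          and lim: "\<And>x y. x \<in> A \<Longrightarrow> y \<in> S \<Longrightarrow>
            ((\<lambda>e. (G2 x y e / (x * u e) - q e) / e^k + (y - c) / x^3) \<longlongrightarrow> C) (at 0)"
        have "asymptotic (\<lambda>p. v 2 p $ 2) c u q m k C x y" if "x \<in> A" "y \<in> S" for x y
          unfolding asymptotic_def
          by (rule Lim_transform_within_open[OF lim[OF that] open_ball[of 0 r]])
             (use r w(2)[OF that] in auto)
        then have as: "\<forall>x\<in>A. \<forall>y\<in>S. asymptotic (\<lambda>p. v 2 p $ 2) c u q m k C x y" by blast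
        have "A \<noteq> {}" "S \<noteq> {}" using A(4) S(4) by auto
        with A(1) S(1) AS r' uq as show ?thesis
          by (intro exI[of _ A] exI[of _ S] exI[of _ r'] exI[of _ u] exI[of _ q] exI[of _ m]
              exI[of _ k] exI[of _ C] conjI ballI) (assumption | simp)+
      qed
    qed
  qed
qed

subsection \<open>Propagation along the orbit\<close>

lemma hol3_slice_nonzero:
  assumes f: "hol3 A S (ball 0 r) f" and "0 < r" and dom: "open A" "connected A" "open S" "connected S"
    and ne: "a \<in> A" "b \<in> S" "f a b 0 \<noteq> 0"
    and W: "open W" "W \<subseteq> A \<times> S" "W \<noteq> {}"
  obtains W' where "open W'" "W' \<subseteq> W" "W' \<noteq> {}" "\<And>x y. (x, y) \<in> W' \<Longrightarrow> f x y 0 \<noteq> 0"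
proof -
  let ?E = "ball (0::complex) r"
  have c: "continuous_on (A \<times> S \<times> ?E) (\<lambda>(x, y, e). f x y e)"
    using f unfolding hol3_def by blast
  have "continuous_on (A \<times> S \<times> ?E) (\<lambda>p. (\<lambda>(x, y, e). f x y e) (fst p, fst (snd p), 0))"
  proof (rule continuous_on_compose2[OF c])
    show "continuous_on (A \<times> S \<times> ?E) (\<lambda>p. (fst p, fst (snd p), 0 :: complex))"
      by (intro continuous_intros)
  qed (use \<open>0 < r\<close> in auto)
  \<comment> \<open>The slice at \<open>e = 0\<close>, made constant in the third variable so that
    the three-variable identity theorem applies.\<close>
  then have f0: "hol3 A S ?E (\<lambda>x y e. f x y 0)"
    using f \<open>0 < r\<close> unfolding hol3_def by (simp add: case_prod_beta)
  let ?N = "{(x, y, e). x \<in> A \<and> y \<in> S \<and> e \<in> ?E \<and> f x y 0 \<noteq> 0}"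
  have oN: "open ?N" by (rule hol3_open_nonzero[OF f0]) (use dom in auto)
  let ?W = "W \<inter> (\<lambda>p. (fst p, snd p, 0)) -` ?N"
  have oW: "open ?W" using W(1) oN by (intro open_Int open_vimage continuous_intros)
  have neW: "?W \<noteq> {}"
  proof
    assume emp: "?W = {}"
    have z: "f x y 0 = 0" if "(x, y) \<in> W" for x y
    proof (rule ccontr)
      assume "f x y 0 \<noteq> 0"
      then have "(x, y) \<in> ?W" using that W(2) \<open>0 < r\<close> by auto
      with emp show False by blast
    qed
    have oV: "open {p. (fst p, fst (snd p)) \<in> W \<and> snd (snd p) \<in> ?E}"
    proof -
      have "open ((\<lambda>p. (fst p, fst (snd p))) -` W \<inter> (\<lambda>p. snd (snd p)) -` ?E)"
        using W(1) by (intro open_Int open_vimage continuous_intros open_ball)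
      then show ?thesis by (simp add: vimage_def Int_def)
    qed
    have "f a b 0 = 0"
    proof (rule hol3_identity[OF f0 dom open_ball connected_ball oV _ _ _ ne(1,2), of 0])
      show "{p. (fst p, fst (snd p)) \<in> W \<and> snd (snd p) \<in> ?E} \<subseteq> A \<times> S \<times> ?E" using W(2) by auto
      obtain w where "w \<in> W" using W(3) by blast
      then have "(fst w, snd w, 0) \<in> {p. (fst p, fst (snd p)) \<in> W \<and> snd (snd p) \<in> ?E}"
        using \<open>0 < r\<close> by simp
      then show "{p. (fst p, fst (snd p)) \<in> W \<and> snd (snd p) \<in> ?E} \<noteq> {}" by blast
      show "f x y 0 = 0" if "(x, y, e) \<in> {p. (fst p, fst (snd p)) \<in> W \<and> snd (snd p) \<in> ?E}" for x y e
        using that z by simp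
    qed (use \<open>0 < r\<close> in simp)
    with ne(3) show False by simp
  qed
  have "f x y 0 \<noteq> 0" if "(x, y) \<in> ?W" for x y using that by simp
  with oW Int_lower1 neW show ?thesis by (rule that)
qed

text \<open>For open \<open>B\<close>: the interior of the set where \<open>P\<close> holds is dense
  in \<open>B\<close>. Unlike validity at every point, this tolerates the zero sets of leading
  coefficients, and \<open>P\<close> and its negation still cannot both hold densely on a nonempty
  open set.\<close>

definition densely :: "(complex \<Rightarrow> complex \<Rightarrow> bool) \<Rightarrow> (complex \<times> complex) set \<Rightarrow> bool" where
  "densely P B \<longleftrightarrow> (\<forall>W. open W \<and> W \<subseteq> B \<and> W \<noteq> {} \<longrightarrow>
     (\<exists>W'. open W' \<and> W' \<subseteq> W \<and> W' \<noteq> {} \<and> (\<forall>x y. (x, y) \<in> W' \<longrightarrow> P x y)))"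

lemma densely_subset: "densely P B \<Longrightarrow> B' \<subseteq> B \<Longrightarrow> densely P B'"
  unfolding densely_def by (meson order_trans)

text \<open>The alternative is decided by comparing the orders of \<open>N\<close> and \<open>D\<close> in \<open>e\<close>.\<close>

lemma quotient_limit_dichotomy:
  assumes N: "hol3 A S (ball 0 r) N" and D: "hol3 A S (ball 0 r) D" and r: "0 < r"
    and dom: "open A" "connected A" "open S" "connected S"
    and ne: "a \<in> A" "b \<in> S" "d \<in> ball 0 r" "D a b d \<noteq> 0"
    and Q: "\<And>x y e. x \<in> A \<Longrightarrow> y \<in> S \<Longrightarrow> e \<in> ball 0 r - {0} \<Longrightarrow> D x y e \<noteq> 0 \<Longrightarrow> Q x y e = N x y e / (e^k * D x y e)"
  shows "densely (\<lambda>x y. (Q x y \<longlongrightarrow> 0) (at 0)) (A \<times> S) \<or> densely (\<lambda>x y. \<not> (Q x y \<longlongrightarrow> 0) (at 0)) (A \<times> S)"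
proof (rule hol3_order[OF D dom(1,3) ne])
  fix n :: nat and D1 a1 b1
  assume D1: "hol3 A S (ball 0 r) D1"
      "\<And>x y e. x \<in> A \<Longrightarrow> y \<in> S \<Longrightarrow> e \<in> ball 0 r \<Longrightarrow> D x y e = e^n * D1 x y e"
    and ab1: "a1 \<in> A" "b1 \<in> S" "D1 a1 b1 0 \<noteq> 0"
  have lim: "(G x y \<longlongrightarrow> G x y 0) (at 0)" if "hol3 A S (ball 0 r) G" "x \<in> A" "y \<in> S" for G x y
    using hol3_continuous_thd[OF that] r by (simp add: continuous_on_eq_continuous_at isCont_def)
  have ev: "eventually (\<lambda>e. e \<in> ball 0 r - {0} \<and> D1 x y e \<noteq> 0 \<and> Q x y e = N x y e / (e^(k + n) * D1 x y e)) (at 0)"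
    if "x \<in> A" "y \<in> S" "D1 x y 0 \<noteq> 0" for x y
  proof -
    have "eventually (\<lambda>e. e \<in> ball 0 r - {0}) (at 0)"
      using eventually_at_in_open[OF open_ball, of 0 0 r] r by simp
    moreover have "eventually (\<lambda>e. D1 x y e \<noteq> 0) (at 0)"
      using tendsto_imp_eventually_ne[OF lim[OF D1(1) that(1,2)] that(3)] .
    ultimately show ?thesis
    proof eventually_elim
      case (elim e)
      have "D x y e = e^n * D1 x y e" using D1(2) that elim by auto
      then show ?case using Q[OF that(1,2)] elim by (simp add: power_add mult.assoc)
    qed
  qed
  show ?thesis
  proof (cases "\<exists>x\<in>A. \<exists>y\<in>S. \<exists>e\<in>ball 0 r. N x y e \<noteq> 0")
    \<comment> \<open>An identically vanishing numerator has no order in \<open>e\<close> and is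
      treated apart.\<close>
    case False
    have "(Q x y \<longlongrightarrow> 0) (at 0)" if "x \<in> A" "y \<in> S" "D1 x y 0 \<noteq> 0" for x y
    proof (rule tendsto_eventually)
      show "eventually (\<lambda>e. Q x y e = 0) (at 0)"
        using ev[OF that] by eventually_elim (use False that in auto)
    qed
    note good = this
    have "densely (\<lambda>x y. (Q x y \<longlongrightarrow> 0) (at 0)) (A \<times> S)"
      unfolding densely_def
    proof (intro allI impI, elim conjE)
      fix W assume W: "open W" "W \<subseteq> A \<times> S" "W \<noteq> {}"
      show "\<exists>W'. open W' \<and> W' \<subseteq> W \<and> W' \<noteq> {} \<and> (\<forall>x y. (x, y) \<in> W' \<longrightarrow> (Q x y \<longlongrightarrow> 0) (at 0))"
      proof (rule hol3_slice_nonzero[OF D1(1) r dom ab1 W])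
        fix W' assume W': "open W'" "W' \<subseteq> W" "W' \<noteq> {}" "\<And>x y. (x, y) \<in> W' \<Longrightarrow> D1 x y 0 \<noteq> 0"
        have "(Q x y \<longlongrightarrow> 0) (at 0)" if "(x, y) \<in> W'" for x y
          by (rule good) (use that W' W(2) in auto)
        then show ?thesis using W'(1-3) by blast
      qed
    qed
    then show ?thesis ..
  next
    case True
    then obtain a2 b2 d2 where ne2: "a2 \<in> A" "b2 \<in> S" "d2 \<in> ball 0 r" "N a2 b2 d2 \<noteq> 0" by blast
    show ?thesis
    proof (rule hol3_order[OF N dom(1,3) ne2])
      fix l :: nat and N1 a3 b3
      assume N1: "hol3 A S (ball 0 r) N1"
          "\<And>x y e. x \<in> A \<Longrightarrow> y \<in> S \<Longrightarrow> e \<in> ball 0 r \<Longrightarrow> N x y e = e^l * N1 x y e"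
        and ab3: "a3 \<in> A" "b3 \<in> S" "N1 a3 b3 0 \<noteq> 0"
      have ratio: "((\<lambda>e. N1 x y e / D1 x y e) \<longlongrightarrow> N1 x y 0 / D1 x y 0) (at 0)"
        if "x \<in> A" "y \<in> S" "D1 x y 0 \<noteq> 0" for x y
        using that by (intro tendsto_divide lim N1(1) D1(1))
      \<comment> \<open>The open set is shrunk twice, first to make the leading coefficient of
        \<open>D\<close> nonzero and then that of \<open>N\<close>.\<close>
      have dens: "densely P (A \<times> S)"
        if good: "\<And>x y. x \<in> A \<Longrightarrow> y \<in> S \<Longrightarrow> D1 x y 0 \<noteq> 0 \<Longrightarrow> N1 x y 0 \<noteq> 0 \<Longrightarrow> P x y" for P
        unfolding densely_def
      proof (intro allI impI, elim conjE)
        fix W assume W: "open W" "W \<subseteq> A \<times> S" "W \<noteq> {}"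
        show "\<exists>W'. open W' \<and> W' \<subseteq> W \<and> W' \<noteq> {} \<and> (\<forall>x y. (x, y) \<in> W' \<longrightarrow> P x y)"
        proof (rule hol3_slice_nonzero[OF D1(1) r dom ab1 W])
          fix W' assume W': "open W'" "W' \<subseteq> W" "W' \<noteq> {}" "\<And>x y. (x, y) \<in> W' \<Longrightarrow> D1 x y 0 \<noteq> 0"
          have sub: "W' \<subseteq> A \<times> S" using W'(2) W(2) by blast
          show ?thesis
          proof (rule hol3_slice_nonzero[OF N1(1) r dom ab3 W'(1) sub W'(3)])
            fix W'' assume W'': "open W''" "W'' \<subseteq> W'" "W'' \<noteq> {}" "\<And>x y. (x, y) \<in> W'' \<Longrightarrow> N1 x y 0 \<noteq> 0"
            have "P x y" if "(x, y) \<in> W''" for x y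
            proof (rule good)
              have "(x, y) \<in> W'" using W''(2) that by blast
              then show "x \<in> A" "y \<in> S" "D1 x y 0 \<noteq> 0" using sub W'(4) by auto
              show "N1 x y 0 \<noteq> 0" by (rule W''(4)[OF that])
            qed
            moreover have "W'' \<subseteq> W" using W''(2) W'(2) by blast
            ultimately show ?thesis using W''(1,3) by blast
          qed
        qed
      qed
      show ?thesis
      proof (cases "l > k + n")
        case True
        have "(Q x y \<longlongrightarrow> 0) (at 0)" if "x \<in> A" "y \<in> S" "D1 x y 0 \<noteq> 0" "N1 x y 0 \<noteq> 0" for x y
        proof -
          have "((\<lambda>e. e^(l - (k + n)) * (N1 x y e / D1 x y e)) \<longlongrightarrow> 0^(l - (k + n)) * (N1 x y 0 / D1 x y 0)) (at 0)"
            by (intro tendsto_intros ratio that)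
          then have "((\<lambda>e. e^(l - (k + n)) * (N1 x y e / D1 x y e)) \<longlongrightarrow> 0) (at 0)"
            using True by (simp add: power_0_left)
          moreover have "eventually (\<lambda>e. e^(l - (k + n)) * (N1 x y e / D1 x y e) = Q x y e) (at 0)"
            using ev[OF that(1-3)]
          proof eventually_elim
            case (elim e)
            have "e^l = e^(l - (k + n)) * e^(k + n)" using True by (simp flip: power_add)
            moreover have "N x y e = e^l * N1 x y e" using N1(2) that elim by auto
            ultimately show ?case using elim by simp
          qed
          ultimately show ?thesis by (rule Lim_transform_eventually)
        qed
        then have "densely (\<lambda>x y. (Q x y \<longlongrightarrow> 0) (at 0)) (A \<times> S)" by (rule dens)
        then show ?thesis ..
      next
        case False
        have "\<not> (Q x y \<longlongrightarrow> 0) (at 0)" if "x \<in> A" "y \<in> S" "D1 x y 0 \<noteq> 0" "N1 x y 0 \<noteq> 0" for x y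
        proof
          assume "(Q x y \<longlongrightarrow> 0) (at 0)"
          \<comment> \<open>If \<open>Q\<close> tended to 0, so would its product with this
            nonnegative power of \<open>e\<close>; but that product tends to the nonzero ratio of
            the leading coefficients.\<close>
          then have "((\<lambda>e. e^(k + n - l) * Q x y e) \<longlongrightarrow> 0^(k + n - l) * 0) (at 0)"
            by (intro tendsto_intros)
          then have "((\<lambda>e. e^(k + n - l) * Q x y e) \<longlongrightarrow> 0) (at 0)" by simp
          moreover have "eventually (\<lambda>e. e^(k + n - l) * Q x y e = N1 x y e / D1 x y e) (at 0)"
            using ev[OF that(1-3)]
          proof eventually_elim
            case (elim e)
            have "e^(k + n) = e^(k + n - l) * e^l" using False by (simp flip: power_add)
            moreover have "N x y e = e^l * N1 x y e" using N1(2) that elim by auto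
            ultimately show ?case using elim by simp
          qed
          ultimately have "((\<lambda>e. N1 x y e / D1 x y e) \<longlongrightarrow> 0) (at 0)" by (rule Lim_transform_eventually)
          then have "N1 x y 0 / D1 x y 0 = 0" using ratio[OF that(1-3)] LIM_unique by blast
          with that show False by simp
        qed
        then have "densely (\<lambda>x y. \<not> (Q x y \<longlongrightarrow> 0) (at 0)) (A \<times> S)" by (rule dens)
        then show ?thesis ..
      qed
    qed
  qed
qed

text \<open>The asymptotic relation says that a meromorphic function tends to 0 as \<open>e\<close>
  does. The radius \<open>\<delta>\<close> is fixed before \<open>u\<close>, \<open>p\<close>,
  \<open>m\<close>, \<open>k\<close>, \<open>C\<close>, because at \<open>c\<close> these data come
  from a chart that must lie inside the polydisc of radius \<open>\<delta>\<close>.\<close>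

lemma asymptotic_dichotomy:
  assumes mer: "meromorphic_in b U" and p0: "(vector [x0, y0], 0) \<in> U" and "x0 \<noteq> 0"
  obtains \<delta> where "0 < \<delta>"
    "\<And>u p m k C r. 0 < r \<Longrightarrow> u holomorphic_on ball 0 r \<Longrightarrow> p holomorphic_on ball 0 r \<Longrightarrow>
      (\<And>e. e \<in> ball 0 r \<Longrightarrow> u e \<noteq> 0) \<Longrightarrow>
      densely (asymptotic b c u p m k C) (ball x0 \<delta> \<times> ball y0 \<delta>) \<or>
      densely (\<lambda>x y. \<not> asymptotic b c u p m k C x y) (ball x0 \<delta> \<times> ball y0 \<delta>)"
proof (rule meromorphic_chart[OF mer p0])
  fix \<delta>1 g h
  assume 1: "0 < \<delta>1" "hol3 (ball x0 \<delta>1) (ball y0 \<delta>1) (ball 0 \<delta>1) g" "hol3 (ball x0 \<delta>1) (ball y0 \<delta>1) (ball 0 \<delta>1) h"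
    and nz: "\<And>\<delta>'. 0 < \<delta>' \<Longrightarrow> \<delta>' \<le> \<delta>1 \<Longrightarrow> \<exists>x\<in>ball x0 \<delta>'. \<exists>y\<in>ball y0 \<delta>'. \<exists>e\<in>ball 0 \<delta>'. h x y e \<noteq> 0"
    and b: "\<And>x y e. x \<in> ball x0 \<delta>1 \<Longrightarrow> y \<in> ball y0 \<delta>1 \<Longrightarrow> e \<in> ball 0 \<delta>1 \<Longrightarrow> h x y e \<noteq> 0 \<Longrightarrow>
      b (vector [x, y], e) = g x y e / h x y e \<and> holomorphic_near b (vector [x, y], e)"
  define \<delta> where "\<delta> = min \<delta>1 (norm x0)"
  have \<delta>: "0 < \<delta>" "\<delta> \<le> \<delta>1" "\<delta> \<le> norm x0" using 1(1) \<open>x0 \<noteq> 0\<close> by (auto simp: \<delta>_def)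
  have xnz: "x \<noteq> 0" if "x \<in> ball x0 \<delta>" for x using that \<delta>(3) by auto
  show ?thesis
  proof (rule that[OF \<delta>(1)])
    fix u p m k C and r :: real
    assume r: "0 < r" and u: "u holomorphic_on ball 0 r" and p: "p holomorphic_on ball 0 r"
      and une: "\<And>e. e \<in> ball 0 r \<Longrightarrow> u e \<noteq> 0"
    \<comment> \<open>Only the disc of \<open>e\<close> shrinks with the domain of \<open>u\<close>
      and \<open>p\<close>; the polydisc of states keeps the radius \<open>\<delta>\<close>.\<close>
    define r' where "r' = min r \<delta>"
    have r': "0 < r'" "r' \<le> r" "r' \<le> \<delta>" using r \<delta> by (auto simp: r'_def)
    let ?A = "ball x0 \<delta>" and ?S = "ball y0 \<delta>" and ?E = "ball (0::complex) r'"
    have sub: "?A \<subseteq> ball x0 \<delta>1" "?S \<subseteq> ball y0 \<delta>1" "?E \<subseteq> ball 0 \<delta>1" "?E \<subseteq> ball 0 r"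
      using \<delta> r' by auto
    note g = hol3_subset[OF 1(2) sub(1-3)] and h = hol3_subset[OF 1(3) sub(1-3)]
    note u' = holomorphic_on_subset[OF u sub(4)] and p' = holomorphic_on_subset[OF p sub(4)]
    define D where "D = (\<lambda>x y e. x^3 * u e * h x y e)"
    \<comment> \<open>Obtained by clearing denominators, so that the deviation \<open>Q\<close> from
      the limit \<open>C\<close> equals \<open>N / (e^k * D)\<close>.\<close>
    define N where "N = (\<lambda>x y e. e^m * g x y e * x^2 - p e * D x y e + (y - c - C * x^3) * e^k * (u e * h x y e))"
    define Q where "Q = (\<lambda>x y e. (e^m * b (vector [x, y], e) / (x * u e) - p e) / e^k + (y - c) / x^3 - C)"
    have D: "hol3 ?A ?S ?E D"
      unfolding D_def by (intro hol3_intros h hol3_thd[OF u'] hol3_fst) (intro holomorphic_intros)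
    have N: "hol3 ?A ?S ?E N"
      unfolding N_def by (intro hol3_intros g h D hol3_thd[OF u'] hol3_thd[OF p'] hol3_fst hol3_snd hol3_thd; intro holomorphic_intros)
    obtain x1 y1 e1 where ne: "x1 \<in> ball x0 r'" "y1 \<in> ball y0 r'" "e1 \<in> ?E" "h x1 y1 e1 \<noteq> 0"
      using nz[of r'] r' \<delta>(2) by auto
    then have ne': "x1 \<in> ?A" "y1 \<in> ?S" using r' by auto
    have "D x1 y1 e1 \<noteq> 0"
      using ne(4) xnz[OF ne'(1)] une[OF subsetD[OF sub(4) ne(3)]] by (simp add: D_def)
    note ne'' = ne' ne(3) this
    have Qeq: "Q x y e = N x y e / (e^k * D x y e)"
      if x: "x \<in> ?A" "y \<in> ?S" "e \<in> ?E - {0}" "D x y e \<noteq> 0" for x y e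
    proof -
      have nz: "x \<noteq> 0" "u e \<noteq> 0" "h x y e \<noteq> 0" "e^k \<noteq> 0" using x by (auto simp: D_def)
      have "b (vector [x, y], e) = g x y e / h x y e" using b[of x y e] x sub nz(3) by blast
      then show ?thesis
        unfolding Q_def N_def D_def using nz by (simp add: field_simps eval_nat_numeral)
    qed
    have "asymptotic b c u p m k C x y \<longleftrightarrow> (Q x y \<longlongrightarrow> 0) (at 0)" for x y
      unfolding asymptotic_def Q_def by (rule LIM_zero_iff[symmetric])
    then have "asymptotic b c u p m k C = (\<lambda>x y. (Q x y \<longlongrightarrow> 0) (at 0))" by blast
    then show "densely (asymptotic b c u p m k C) (?A \<times> ?S) \<or> densely (\<lambda>x y. \<not> asymptotic b c u p m k C x y) (?A \<times> ?S)"
      using quotient_limit_dichotomy[OF N D r'(1) open_ball connected_ball open_ball connected_ball ne'' Qeq] by simp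
  qed
qed

section \<open>The connectedness argument along the orbit\<close>

lemma open_densely_near: "open {y. \<exists>\<delta>>0. densely P (ball x0 \<delta> \<times> ball y \<delta>)}"
  unfolding open_contains_ball
proof
  fix y assume "y \<in> {y. \<exists>\<delta>>0. densely P (ball x0 \<delta> \<times> ball y \<delta>)}"
  then obtain \<delta> where \<delta>: "\<delta> > 0" "densely P (ball x0 \<delta> \<times> ball y \<delta>)" by blast
  have "densely P (ball x0 (\<delta> / 2) \<times> ball z (\<delta> / 2))" if "z \<in> ball y (\<delta> / 2)" for z
  proof (rule densely_subset[OF \<delta>(2)])
    have "ball z (\<delta> / 2) \<subseteq> ball y \<delta>"
    proof
      fix w assume "w \<in> ball z (\<delta> / 2)"
      with that dist_triangle[of y w z] show "w \<in> ball y \<delta>" by simp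
    qed
    moreover have "ball x0 (\<delta> / 2) \<subseteq> ball x0 \<delta>" using \<delta>(1) by auto
    ultimately show "ball x0 (\<delta> / 2) \<times> ball z (\<delta> / 2) \<subseteq> ball x0 \<delta> \<times> ball y \<delta>" by blast
  qed
  then have "ball y (\<delta> / 2) \<subseteq> {y. \<exists>\<delta>>0. densely P (ball x0 \<delta> \<times> ball y \<delta>)}"
    using half_gt_zero[OF \<delta>(1)] by blast
  then show "\<exists>\<epsilon>>0. ball y \<epsilon> \<subseteq> {y. \<exists>\<delta>>0. densely P (ball x0 \<delta> \<times> ball y \<delta>)}"
    using half_gt_zero[OF \<delta>(1)] by blast
qed

lemma densely_exclusive:
  assumes "densely P (ball x0 \<delta> \<times> ball y \<delta>)" "densely (\<lambda>x y. \<not> P x y) (ball x0 \<delta>' \<times> ball y \<delta>')"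
    and "0 < \<delta>" "0 < \<delta>'"
  shows False
proof -
  let ?W = "ball x0 (min \<delta> \<delta>') \<times> ball y (min \<delta> \<delta>')"
  have W: "open ?W" "?W \<noteq> {}" "?W \<subseteq> ball x0 \<delta> \<times> ball y \<delta>" "?W \<subseteq> ball x0 \<delta>' \<times> ball y \<delta>'"
    using assms(3,4) by (auto intro: open_Times)
  then obtain W' where W': "open W'" "W' \<subseteq> ?W" "W' \<noteq> {}" "\<forall>x y. (x, y) \<in> W' \<longrightarrow> P x y"
    using assms(1) unfolding densely_def by meson
  then have "W' \<subseteq> ball x0 \<delta>' \<times> ball y \<delta>'" using W(4) by (meson order_trans)
  then obtain W'' where W'': "W'' \<subseteq> W'" "W'' \<noteq> {}" "\<forall>x y. (x, y) \<in> W'' \<longrightarrow> \<not> P x y"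
    using assms(2) W'(1,3) unfolding densely_def by meson
  then obtain x y where "(x, y) \<in> W''" by fastforce
  with W'' W'(4) show False by blast
qed

text \<open>The full preimage of a connected set under a covering may be disconnected. Here the real
  line lies in \<open>\<Gamma>\<close> and joins all translates, so the component of 0 and its
  complement in \<open>\<Gamma>\<close> are both open and invariant, and the complement must be
  empty.\<close>

lemma connected_if_connectedin_quotient:
  fixes \<Gamma> :: "complex set"
  assumes op: "openin (quotient_topology (multiples (of_real T))) \<Gamma>"
    and con: "connectedin (quotient_topology (multiples (of_real T))) \<Gamma>" and R: "\<real> \<subseteq> \<Gamma>"
  shows "connected \<Gamma>"
proof -
  let ?L = "multiples (of_real T)"
  have op': "open \<Gamma>" "\<And>p l. p \<in> \<Gamma> \<Longrightarrow> l \<in> ?L \<Longrightarrow> p + l \<in> \<Gamma>"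
    using op by (auto simp: openin_quotient_topology)
  have LR: "?L \<subseteq> \<real>" by (auto simp: multiples_def)
  have Lneg: "- l \<in> ?L" if l: "l \<in> ?L" for l
  proof -
    obtain k :: int where "l = of_int k * of_real T" using l by (auto simp: multiples_def)
    then have "- l = of_int (- k) * of_real T" by simp
    then show ?thesis unfolding multiples_def by (rule range_eqI)
  qed
  \<comment> \<open>The component containing the real line is invariant under the real period.\<close>
  define K where "K = connected_component_set \<Gamma> 0"
  have K: "open K" "connected K" "K \<subseteq> \<Gamma>"
    using op'(1) by (auto simp: K_def open_connected_component connected_component_subset)
  have RK: "\<real> \<subseteq> K"
    unfolding K_def by (rule connected_component_maximal) (use R in \<open>auto intro: convex_connected convex_Reals\<close>)
  have shift: "p + l \<in> K" if "p \<in> K" "l \<in> ?L" for p l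
  proof -
    have "(\<lambda>p. p + l) ` K \<subseteq> K"
    proof -
      have "connected ((\<lambda>p. p + l) ` K)"
        by (intro connected_continuous_image continuous_intros K)
      moreover have "(\<lambda>p. p + l) ` K \<subseteq> \<Gamma>" using op'(2) K(3) that(2) by auto
      \<comment> \<open>The translate of 0; being real, \<open>l\<close> has the same component as
        0.\<close>
      moreover have "l \<in> (\<lambda>p. p + l) ` K" using RK by (auto intro!: image_eqI[of _ _ 0])
      ultimately have "(\<lambda>p. p + l) ` K \<subseteq> connected_component_set \<Gamma> l"
        by (intro connected_component_maximal)
      also have "connected_component_set \<Gamma> l = K"
        using RK LR that(2) unfolding K_def by (metis connected_component_eq subsetD)
      finally show ?thesis .
    qed
    with that(1) show ?thesis by blast
  qed
  have "open (\<Gamma> - K)"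
  proof -
    have "closedin (top_of_set \<Gamma>) K" unfolding K_def by (rule closedin_connected_component)
    then show ?thesis using op'(1) by (metis openin_diff openin_open_eq openin_subtopology_self)
  qed
  moreover have "p + l \<in> \<Gamma> - K" if "p \<in> \<Gamma> - K" "l \<in> ?L" for p l
    using that op'(2) shift[OF _ Lneg[OF that(2)], of "p + l"] by auto
  ultimately have "openin (quotient_topology ?L) (\<Gamma> - K)" by (simp add: openin_quotient_topology)
  moreover have "openin (quotient_topology ?L) K" using K(1) shift by (simp add: openin_quotient_topology)
  moreover have "\<Gamma> \<subseteq> K \<union> (\<Gamma> - K)" "K \<inter> (\<Gamma> - K) \<inter> \<Gamma> = {}" by auto
  moreover have "K \<inter> \<Gamma> \<noteq> {}" using RK R by auto
  ultimately have "(\<Gamma> - K) \<inter> \<Gamma> = {}" using con unfolding connectedin by blast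
  then have "\<Gamma> = K" using K(3) by auto
  with K(2) show ?thesis by simp
qed

text \<open>Subtracting the two limits cancels the terms in \<open>b\<close>, \<open>u\<close> and
  \<open>p\<close> by periodicity and leaves \<open>P / x^3 = 0\<close>.\<close>

lemma asymptotic_periodic:
  assumes "asymptotic b c u p m k C x y" "asymptotic b c u p m k C x (y + P)"
    and "0 < r" "\<And>e. e \<in> ball 0 r \<Longrightarrow> b (vector [x, y + P], e) = b (vector [x, y], e)" and "x \<noteq> 0"
  shows "P = 0"
proof -
  let ?f = "\<lambda>e. (e^m * b (vector [x, y], e) / (x * u e) - p e) / e^k"
  have "((\<lambda>e. ?f e + (y + P - c) / x^3) \<longlongrightarrow> C) (at 0)"
    by (rule Lim_transform_within_open[OF assms(2)[unfolded asymptotic_def] open_ball[of 0 r]])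
       (use assms(3,4) in auto)
  from tendsto_diff[OF this assms(1)[unfolded asymptotic_def]]
  have "((\<lambda>e::complex. (y + P - c) / x^3 - (y - c) / x^3) \<longlongrightarrow> 0) (at 0)" by simp
  then have "(y + P - c) / x^3 - (y - c) / x^3 = 0" by (simp add: tendsto_const_iff)
  then show ?thesis using \<open>x \<noteq> 0\<close> by (simp add: field_simps)
qed

text \<open>\<open>Y\<close> stands for the orbit unrolled to the covering. The points near which
  the asymptotics hold densely and those near which they fail densely form two disjoint open sets
  covering \<open>Y\<close>; as \<open>c\<close> is of the first kind, so is
  \<open>c + 2 * of_real pi\<close>.\<close>

lemma not_integrable_2:
  assumes \<kappa>: "0 < \<kappa>" "\<kappa> < 1" and c: "c = \<i> * of_real (arcosh (1 / \<kappa>))"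
    and U: "open U" and "x0 \<noteq> 0"
    and Y: "connected Y" "c \<in> Y" "c + 2 * of_real pi \<in> Y" "\<And>y. y \<in> Y \<Longrightarrow> (vector [x0, y], 0) \<in> U"
  shows "\<not> bogoyavlenskij_integrable_in 2 angle_periods (forced_rotor \<kappa>) U"
proof
  assume int: "bogoyavlenskij_integrable_in 2 angle_periods (forced_rotor \<kappa>) U"
  show False
  proof (rule integrable_2_asymptotic[OF \<kappa> c U Y(4)[OF Y(2)] \<open>x0 \<noteq> 0\<close> int])
    fix b
    assume mer: "meromorphic_in b U"
      and per: "\<And>p l. p \<in> U \<Longrightarrow> l \<in> angle_periods \<Longrightarrow> b (fst p + l, snd p) = b p"
      and asy: "\<And>\<delta>. 0 < \<delta> \<Longrightarrow> \<exists>A S r u p m k C. open A \<and> A \<noteq> {} \<and> A \<subseteq> ball x0 \<delta> \<and> open S \<and> S \<noteq> {} \<and> S \<subseteq> ball c \<delta> \<and>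
       0 < r \<and> u holomorphic_on ball 0 r \<and> p holomorphic_on ball 0 r \<and> (\<forall>e\<in>ball 0 r. u e \<noteq> 0) \<and>
       (\<forall>x\<in>A. \<forall>y\<in>S. asymptotic b c u p m k C x y)"
    show False
    proof (rule asymptotic_dichotomy[OF mer Y(4)[OF Y(2)] \<open>x0 \<noteq> 0\<close>, of c])
      fix \<delta>c :: real
      assume \<delta>c: "0 < \<delta>c" and dich: "\<And>u p m k C r. 0 < r \<Longrightarrow> u holomorphic_on ball 0 r \<Longrightarrow> p holomorphic_on ball 0 r \<Longrightarrow>
        (\<And>e. e \<in> ball 0 r \<Longrightarrow> u e \<noteq> 0) \<Longrightarrow>
        densely (asymptotic b c u p m k C) (ball x0 \<delta>c \<times> ball c \<delta>c) \<or>
        densely (\<lambda>x y. \<not> asymptotic b c u p m k C x y) (ball x0 \<delta>c \<times> ball c \<delta>c)"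
      from asy[OF \<delta>c] obtain A S r u p m k C where
        AS: "open A" "A \<noteq> {}" "A \<subseteq> ball x0 \<delta>c" "open S" "S \<noteq> {}" "S \<subseteq> ball c \<delta>c"
        and r: "0 < r" and u: "u holomorphic_on ball 0 r" and p: "p holomorphic_on ball 0 r"
        and une: "\<forall>e\<in>ball 0 r. u e \<noteq> 0"
        and P: "\<forall>x\<in>A. \<forall>y\<in>S. asymptotic b c u p m k C x y"
        by (elim exE conjE)
      let ?P = "asymptotic b c u p m k C"
      let ?G = "{y. \<exists>\<delta>>0. densely ?P (ball x0 \<delta> \<times> ball y \<delta>)}"
      let ?B = "{y. \<exists>\<delta>>0. densely (\<lambda>x y. \<not> ?P x y) (ball x0 \<delta> \<times> ball y \<delta>)}"
      \<comment> \<open>On the open set \<open>A \<times> S\<close> the asymptotics hold everywhere,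
        which decides the dichotomy at \<open>c\<close>.\<close>
      have "\<not> densely (\<lambda>x y. \<not> ?P x y) (ball x0 \<delta>c \<times> ball c \<delta>c)"
      proof
        assume "densely (\<lambda>x y. \<not> ?P x y) (ball x0 \<delta>c \<times> ball c \<delta>c)"
        moreover have "open (A \<times> S)" "A \<times> S \<noteq> {}" "A \<times> S \<subseteq> ball x0 \<delta>c \<times> ball c \<delta>c"
          using AS by (auto intro: open_Times)
        ultimately obtain W' where W': "W' \<subseteq> A \<times> S" "W' \<noteq> {}" "\<forall>x y. (x, y) \<in> W' \<longrightarrow> \<not> ?P x y"
          unfolding densely_def by meson
        then obtain x y where "(x, y) \<in> W'" by fastforce
        with W' P show False by blast
      qed
      then have cG: "c \<in> ?G" using dich[OF r u p] une \<delta>c by blast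
      have "Y \<subseteq> ?G \<union> ?B"
      proof
        fix y assume "y \<in> Y"
        show "y \<in> ?G \<union> ?B"
        proof (rule asymptotic_dichotomy[OF mer Y(4)[OF \<open>y \<in> Y\<close>] \<open>x0 \<noteq> 0\<close>, of c])
          fix \<delta> :: real
          assume \<delta>: "0 < \<delta>" and d: "\<And>u p m k C r. 0 < r \<Longrightarrow> u holomorphic_on ball 0 r \<Longrightarrow> p holomorphic_on ball 0 r \<Longrightarrow>
            (\<And>e. e \<in> ball 0 r \<Longrightarrow> u e \<noteq> 0) \<Longrightarrow>
            densely (asymptotic b c u p m k C) (ball x0 \<delta> \<times> ball y \<delta>) \<or>
            densely (\<lambda>x y. \<not> asymptotic b c u p m k C x y) (ball x0 \<delta> \<times> ball y \<delta>)"
          have "densely ?P (ball x0 \<delta> \<times> ball y \<delta>) \<or> densely (\<lambda>x y. \<not> ?P x y) (ball x0 \<delta> \<times> ball y \<delta>)"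
            by (rule d[OF r u p]) (use une in blast)
          then show "y \<in> ?G \<union> ?B" using \<delta> by blast
        qed
      qed
      moreover have "?G \<inter> ?B \<inter> Y = {}" using densely_exclusive by blast
      ultimately have "?G \<inter> Y = {} \<or> ?B \<inter> Y = {}"
        using connectedD[OF Y(1) open_densely_near open_densely_near] by blast
      then have "?B \<inter> Y = {}" using cG Y(2) by blast
      then have "c + 2 * of_real pi \<in> ?G" using \<open>Y \<subseteq> ?G \<union> ?B\<close> Y(3) by blast
      then obtain \<delta>2 where \<delta>2: "\<delta>2 > 0" "densely ?P (ball x0 \<delta>2 \<times> ball (c + 2 * of_real pi) \<delta>2)" by blast
      obtain \<delta>1 where \<delta>1: "\<delta>1 > 0" "densely ?P (ball x0 \<delta>1 \<times> ball c \<delta>1)" using cG by blast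
      obtain \<delta>U where \<delta>U: "0 < \<delta>U"
        "\<And>x y e. x \<in> ball x0 \<delta>U \<Longrightarrow> y \<in> ball c \<delta>U \<Longrightarrow> e \<in> ball 0 \<delta>U \<Longrightarrow> (vector [x, y], e) \<in> U"
        by (rule vector_polydisc[OF U Y(4)[OF Y(2)]]) (rule that)
      define \<delta> where "\<delta> = min (min \<delta>1 \<delta>2) (min \<delta>U (norm x0))"
      have \<delta>: "0 < \<delta>" "\<delta> \<le> \<delta>1" "\<delta> \<le> \<delta>2" "\<delta> \<le> \<delta>U" "\<delta> \<le> norm x0"
        using \<delta>1 \<delta>2 \<delta>U \<open>x0 \<noteq> 0\<close> by (auto simp: \<delta>_def)
      let ?W = "ball x0 \<delta> \<times> ball c \<delta>"
      have "open ?W" "?W \<noteq> {}" "?W \<subseteq> ball x0 \<delta>1 \<times> ball c \<delta>1" using \<delta> by (auto intro: open_Times)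
      then obtain W1 where W1: "open W1" "W1 \<subseteq> ?W" "W1 \<noteq> {}" "\<forall>x y. (x, y) \<in> W1 \<longrightarrow> ?P x y"
        using \<delta>1(2) unfolding densely_def by meson
      \<comment> \<open>\<open>W1\<close> moved by one period: shrinking within it finds a point
        whose translate back by one period still lies in \<open>W1\<close>, so the asymptotics hold
        at both.\<close>
      let ?W2 = "(\<lambda>q. (fst q, snd q - 2 * of_real pi)) -` W1"
      have "open ?W2" using W1(1) by (intro open_vimage continuous_intros)
      moreover have "?W2 \<noteq> {}"
      proof -
        obtain q where "q \<in> W1" using W1(3) by blast
        then have "(fst q, snd q + 2 * of_real pi) \<in> ?W2" by simp
        then show ?thesis by blast
      qed
      moreover have "?W2 \<subseteq> ball x0 \<delta>2 \<times> ball (c + 2 * of_real pi) \<delta>2"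
      proof
        fix q assume "q \<in> ?W2"
        then have "(fst q, snd q - 2 * of_real pi) \<in> ?W" using W1(2) by blast
        then show "q \<in> ball x0 \<delta>2 \<times> ball (c + 2 * of_real pi) \<delta>2"
          using \<delta>(3) by (cases q) (auto simp: dist_norm algebra_simps)
      qed
      ultimately obtain W3 where W3: "W3 \<subseteq> ?W2" "W3 \<noteq> {}" "\<forall>x y. (x, y) \<in> W3 \<longrightarrow> ?P x y"
        using \<delta>2(2) unfolding densely_def by meson
      then obtain x y' where xy': "(x, y') \<in> W3" by fastforce
      define y where "y = y' - 2 * of_real pi"
      have W1xy: "(x, y) \<in> W1" using xy' W3(1) by (auto simp: y_def)
      have P1: "?P x y" using W1xy W1(4) by blast
      have P2: "?P x (y + 2 * of_real pi)" using xy' W3(3) by (simp add: y_def)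
      have xy: "x \<in> ball x0 \<delta>" "y \<in> ball c \<delta>" using W1xy W1(2) by auto
      have "x \<noteq> 0" using xy(1) \<delta>(5) by auto
      have l: "vector [0, 2 * of_real pi] \<in> angle_periods"
        unfolding angle_periods_def multiples_def by (auto intro!: exI[of _ "2 * of_real pi"] range_eqI[of _ _ 1])
      have "b (vector [x, y + 2 * of_real pi], e) = b (vector [x, y], e)" if "e \<in> ball 0 \<delta>" for e
      proof -
        have "(vector [x, y], e) \<in> U" by (rule \<delta>U(2)) (use xy that \<delta>(4) in auto)
        moreover have "vector [x, y + 2 * of_real pi] = vector [x, y] + (vector [0, 2 * of_real pi] :: complex^2)"
          by (simp add: vec_eq_iff forall_2)
        ultimately show ?thesis using per[OF _ l, of "(vector [x, y], e)"] by simp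
      qed
      from asymptotic_periodic[OF P1 P2 \<delta>(1) this \<open>x \<noteq> 0\<close>] show False by simp
    qed
  qed
qed

theorem proposition5p2:
  fixes \<kappa> I \<theta> \<omega> T :: real and \<tau>star :: complex and \<Gamma> :: "complex set"
  assumes "0 < \<kappa>" and "\<kappa> < 1"
    and "I \<noteq> 0"
    and "\<omega> = I" and "T = 2 * pi / I"
    and "\<tau>star = - of_real \<theta> / of_real I + \<i> / of_real I * of_real (arcosh (1 / \<kappa>))"
    and "openin (quotient_topology (multiples (of_real T))) \<Gamma>"
    and "connectedin (quotient_topology (multiples (of_real T))) \<Gamma>"
    and "\<real> \<subseteq> \<Gamma>" and "\<tau>star \<in> \<Gamma>"
  shows "\<not> meromorphically_integrable_near angle_periods (forced_rotor \<kappa>)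
           {vector [of_real I, of_real \<omega> * \<tau> + of_real \<theta>] | \<tau>. \<tau> \<in> \<Gamma>}"
proof
  assume "meromorphically_integrable_near angle_periods (forced_rotor \<kappa>)
           {vector [of_real I, of_real \<omega> * \<tau> + of_real \<theta>] | \<tau>. \<tau> \<in> \<Gamma>}"
  then obtain q U where q: "q \<in> {1..CARD(2)}" and U0: "openin (quotient_topology (angle_periods \<times> {0})) U"
    and orb: "{vector [of_real I, of_real \<omega> * \<tau> + of_real \<theta>] | \<tau>. \<tau> \<in> \<Gamma>} \<times> {0} \<subseteq> U"
    and int: "bogoyavlenskij_integrable_in q angle_periods (forced_rotor \<kappa>) U"
    unfolding meromorphically_integrable_near_def by blast
  define c where "c = \<i> * of_real (arcosh (1 / \<kappa>))"
  \<comment> \<open>The angles on the orbit; the affine map sends \<open>\<tau>star\<close> to the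
    pole \<open>c\<close> and the period \<open>T\<close> to \<open>2 * pi\<close>.\<close>
  define Y where "Y = (\<lambda>\<tau>. of_real I * \<tau> + of_real \<theta>) ` \<Gamma>"
  have "open U" using U0 by (simp add: openin_quotient_topology)
  have Y: "(vector [of_real I, y], 0) \<in> U" if "y \<in> Y" for y
    using that orb \<open>\<omega> = I\<close> unfolding Y_def by blast
  have "connected Y"
    unfolding Y_def using connected_if_connectedin_quotient[OF assms(7-9)]
    by (intro connected_continuous_image continuous_intros)
  have "c = of_real I * \<tau>star + of_real \<theta>"
    using \<open>I \<noteq> 0\<close> by (simp add: c_def assms(6) field_simps)
  then have "c \<in> Y" using \<open>\<tau>star \<in> \<Gamma>\<close> by (auto simp: Y_def)
  have "of_real T \<in> multiples (of_real T)"
    unfolding multiples_def by (rule range_eqI[of _ _ 1]) simp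
  \<comment> \<open>As a subset of the covering, \<open>\<Gamma>\<close> contains with
    \<open>\<tau>star\<close> all its translates; this one provides the second endpoint
    \<open>c + 2 * of_real pi\<close>.\<close>
  then have "\<tau>star + of_real T \<in> \<Gamma>"
    using assms(7) \<open>\<tau>star \<in> \<Gamma>\<close> by (simp add: openin_quotient_topology)
  moreover have "c + 2 * of_real pi = of_real I * (\<tau>star + of_real T) + of_real \<theta>"
    using \<open>I \<noteq> 0\<close> \<open>c = of_real I * \<tau>star + of_real \<theta>\<close> by (simp add: assms(5) field_simps)
  ultimately have "c + 2 * of_real pi \<in> Y" by (auto simp: Y_def)
  have I0: "of_real I \<noteq> (0 :: complex)" using \<open>I \<noteq> 0\<close> by simp
  have "q = 1 \<or> q = 2" using q by auto
  then show False
    using int not_integrable_1[OF assms(1,2) c_def \<open>open U\<close> Y[OF \<open>c \<in> Y\<close>] I0]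
      not_integrable_2[OF assms(1,2) c_def \<open>open U\<close> I0 \<open>connected Y\<close> \<open>c \<in> Y\<close> \<open>c + 2 * of_real pi \<in> Y\<close> Y]
    by blast
qed

end
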